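(* Suppose there exists a pair $(\alpha^*,\beta^* )\in\mathcal A_m^\pi\times\mathcal B_m^\pi$ of saddle-point mixed strategies for $\mathbf G_{lq}$ whose projected statistical moments $(\phi_1(\alpha^* ),\phi_2(\beta^* ))$ are uniformly Lipschitz continuous. Suppose also that the capacity conditions $$\gamma_1^2I-P(t)B_1R_1^{-2}B_1^\top P(t)\succeq0,\qquad \gamma_2^2I-P(t)B_2(R_2+\lambda_2(t)I)^{-2}B_2^\top P(t)\succeq0\qquad(t\in[t_0,T])$$ hold. Then the analytical game value $\tilde V_p(t_0,x_0)=x_0^\top P(t_0)x_0$ of the surrogate game $\tilde{\mathbf G}_{lq}$ approximates the game value $V_m^\pi(t_0,x_0)$ of $\mathbf G_{lq}$ with error $$\big|V_m^\pi(t_0,x_0)-\tilde V_p(t_0,x_0)\big|=\mathcal O(\bar\pi^{1/2}).$$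
   Context: **Game $\mathbf G_{lq}$.** Fix $t_0<T$, $x_0\in\mathbb R^d$, $A\in\mathbb R^{d\times d}$, $B_i\in\mathbb R^{d\times d_i}$ ($i=1,2$), symmetric positive definite $Q,Q_T\in\mathbb R^{d\times d}$, $R_i\in\mathbb R^{d_i\times d_i}$, with $(A,B_1)$ stabilizable and $(A,Q^{1/2})$ detectable; fix $\gamma_1,\gamma_2>0$. Dynamics: $\dot x=Ax+B_1u+B_2v$, $x(t_0)=x_0$. Cost: $J=\mathbb E\big[\int_{t_0}^T(x^\top Qx+u^\top R_1u-v^\top R_2v)dt+x(T)^\top Q_Tx(T)\big]$, minimized by Player 1 (control $u\in U=\mathbb R^{d_1}$), maximized by Player 2 (control $v\in V=\mathbb R^{d_2}$). **Partition.** $\pi=\{t_0<t_1<\dots<t_N=T\}$, $\bar\pi=\max_k(t_{k+1}-t_k)$, $\delta_\pi(t)=t_{k+1}-t_k$ on $[t_k,t_{k+1})$. **Mixed strategies.** $\alpha=\{\mu_k\}_{k=0}^{N-1}\in\mathcal A_m^\pi$: measurable maps $x\mapsto\mu_k(\cdot\mid x)$ into the probability measures on $U$ with $\int\|u\|^2\mu_k(du\mid x)\le\gamma_1^2\|x\|^2$. $\beta=\{\nu_k\}\in\mathcal B_m^\pi$: likewise on $V$ with $\gamma_2$. At $t_k$, given $x(t_k)$, $u_k\sim\mu_k(\cdot\mid x(t_k))$ and $v_k\sim\nu_k(\cdot\mid x(t_k))$ are sampled independently and held on $[t_k,t_{k+1})$. $J(t_0,x_0,\alpha,\beta)$ is the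 resulting cost. The game value $V_m^\pi(t_0,x_0)$ is the common value of $\inf_\alpha\sup_\beta J$ and $\sup_\beta\inf_\alpha J$ over $\mathcal A_m^\pi\times\mathcal B_m^\pi$. $(\alpha^*,\beta^* )$ is a saddle point if $J(\alpha^*,\beta)\le J(\alpha^*,\beta^* )\le J(\alpha,\beta^* )$ for all $\alpha,\beta$. **Projected moments.** $\phi_1(\{\mu_k\})$ is the sequence of maps $x\mapsto(\tilde\Gamma_1,\tilde\Lambda_1)$ with $\tilde\Gamma_1=\int u\,\mu_k(du\mid x)$ and $\tilde\Sigma_1=\tilde\Lambda_1\tilde\Lambda_1^\top=\int(u-\tilde\Gamma_1)(u-\tilde\Gamma_1)^\top\mu_k(du\mid x)$; $\phi_2$ is defined in the same way from $\nu_k$. "Uniformly Lipschitz" means all these maps of $x$ are Lipschitz with one constant, independent of $k$ and of $\pi$. **Surrogate game and Riccati equation.** $\tilde{\mathbf G}_{lq}$ is the stochastic differential game $d\tilde x=(A\tilde x+B_1\tilde\Gamma_1+B_2\tilde\Gamma_2)dt+\delta_\pi^{1/2}(t)[B_1\tilde\Lambda_1,B_2\tilde\Lambda_2]dW_t$, $\tilde x(t_0)=x_0$, with cost $\tilde J=\mathbb E\big[\int_{t_0}^T(\tilde x^\top Q\tilde x+\tilde\Gamma_1^\top R_1\tilde\Gamma_1-\tilde\Gamma_2^\top R_2\tilde\Gamma_2+\mathrm{tr}(\tilde\Lambda_1^\top R_1\tilde\Lambda_1)-\mathrm{tr}(\tilde\Lambda_2^\top R_2\tilde\Lambda_2))dt+\tilde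 x(T)^\top Q_T\tilde x(T)\big]$, where Player $i$ uses continuous-time state feedbacks $(\tilde\Gamma_i,\tilde\Lambda_i)$ with $\|\tilde\Gamma_i\|^2+\mathrm{tr}(\tilde\Lambda_i\tilde\Lambda_i^\top)\le\gamma_i^2\|\tilde x\|^2$. Its saddle-point value is $\tilde V_p(t,x)=x^\top P(t)x$, where $P$ is the (unique) symmetric solution on $[t_0,T]$ of $$-\dot P=A^\top P+PA+Q-PB_1R_1^{-1}B_1^\top P+PB_2(R_2+\lambda_2I)^{-1}B_2^\top P+\lambda_2\gamma_2^2I,\quad P(T)=Q_T,$$ with $\lambda_2(t)=\max\big(0,\lambda_{\max}(\delta_\pi(t)B_2^\top P(t)B_2-R_2)\big)$. ($P$, $\lambda_2$ depend on $\pi$.) **Convention.** $\mathcal O(\cdot)$ is as $\bar\pi\to0$ over partitions $\pi$ of $[t_0,T]$ for which the hypotheses hold; the implied constant may depend on the game data, $x_0$ and the uniform Lipschitz constant, but not on $\pi$. *)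

theory Defs
  imports "HOL-Probability.Probability"
begin

section \<open>Matrices\<close>

definition pos_semidef :: "real ^ 'n ^ 'n \<Rightarrow> bool" where
  "pos_semidef M \<longleftrightarrow> transpose M = M \<and> (\<forall>x. 0 \<le> x \<bullet> (M *v x))"

definition pos_def :: "real ^ 'n ^ 'n \<Rightarrow> bool" where
  "pos_def M \<longleftrightarrow> transpose M = M \<and> (\<forall>x. x \<noteq> 0 \<longrightarrow> 0 < x \<bullet> (M *v x))"

definition matrix_sqrt :: "real ^ 'n ^ 'n \<Rightarrow> real ^ 'n ^ 'n" where
  "matrix_sqrt M = (THE S. pos_semidef S \<and> S ** S = M)"

text \<open>Only used for symmetric matrices, whose eigenvalues are all real.\<close>

definition lambda_max :: "real ^ 'n ^ 'n \<Rightarrow> real" where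
  "lambda_max M = Max {l. \<exists>v. v \<noteq> 0 \<and> M *v v = l *s v}"

text \<open>Eigenvalues of a real matrix are taken over the complex numbers here.\<close>

definition hurwitz :: "real ^ 'n ^ 'n \<Rightarrow> bool" where
  "hurwitz M \<longleftrightarrow>
    (\<forall>l w. w \<noteq> 0 \<and> map_matrix complex_of_real M *v w = l *s w \<longrightarrow> Re l < 0)"

definition stabilizable :: "real ^ 'n ^ 'n \<Rightarrow> real ^ 'm ^ 'n \<Rightarrow> bool" where
  "stabilizable A B \<longleftrightarrow> (\<exists>K. hurwitz (A + B ** K))"

definition detectable :: "real ^ 'n ^ 'n \<Rightarrow> real ^ 'n ^ 'm \<Rightarrow> bool" where
  "detectable A C \<longleftrightarrow> (\<exists>L. hurwitz (A + L ** C))"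


section \<open>Game data\<close>

text \<open>The type parameters index the state space and the control spaces of Player 1
  (minimizer) and Player 2 (maximizer).\<close>

record ('d::finite, 'p::finite, 'q::finite) lq_game =
  t_init :: real
  t_end :: real
  x_init :: "real ^ 'd"
  mat_A :: "real ^ 'd ^ 'd"
  mat_B1 :: "real ^ 'p ^ 'd"
  mat_B2 :: "real ^ 'q ^ 'd"
  mat_Q :: "real ^ 'd ^ 'd"
  mat_QT :: "real ^ 'd ^ 'd"
  mat_R1 :: "real ^ 'p ^ 'p"
  mat_R2 :: "real ^ 'q ^ 'q"
  gam1 :: real
  gam2 :: real

definition lq_game_data :: "('d::finite, 'p::finite, 'q::finite) lq_game \<Rightarrow> bool" where
  "lq_game_data G \<longleftrightarrow>
     t_init G < t_end G \<and>
     pos_def (mat_Q G) \<and> pos_def (mat_QT G) \<and> pos_def (mat_R1 G) \<and> pos_def (mat_R2 G) \<and>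
     stabilizable (mat_A G) (mat_B1 G) \<and>
     detectable (mat_A G) (matrix_sqrt (mat_Q G)) \<and>
     0 < gam1 G \<and> 0 < gam2 G"


section \<open>Partitions\<close>

definition time_partition :: "real \<Rightarrow> real \<Rightarrow> nat \<Rightarrow> (nat \<Rightarrow> real) \<Rightarrow> bool" where
  "time_partition a b N \<tau> \<longleftrightarrow> 0 < N \<and> \<tau> 0 = a \<and> \<tau> N = b \<and> (\<forall>k<N. \<tau> k < \<tau> (Suc k))"

definition mesh :: "nat \<Rightarrow> (nat \<Rightarrow> real) \<Rightarrow> real" where
  "mesh N \<tau> = Max ((\<lambda>k. \<tau> (Suc k) - \<tau> k) ` {..<N})"

text \<open>The index \<open>k\<close> with \<open>t \<in> [\<tau> k, \<tau> (k + 1))\<close>; the terminal time is attached to the last interval,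
  so that \<open>step_at\<close> is extended to the terminal time by its left limit.\<close>

definition interval_index :: "nat \<Rightarrow> (nat \<Rightarrow> real) \<Rightarrow> real \<Rightarrow> nat" where
  "interval_index N \<tau> t = Max {k. k < N \<and> \<tau> k \<le> t}"

definition step_at :: "nat \<Rightarrow> (nat \<Rightarrow> real) \<Rightarrow> real \<Rightarrow> real" where
  "step_at N \<tau> t = \<tau> (Suc (interval_index N \<tau> t)) - \<tau> (interval_index N \<tau> t)"


section \<open>Mixed strategies and the cost of the sampled game\<close>

definition mixed_strategies ::
  "real \<Rightarrow> nat \<Rightarrow> (nat \<Rightarrow> real ^ 'd \<Rightarrow> (real ^ 'm) measure) set" where
  "mixed_strategies \<gamma> N = {\<mu>. \<forall>k<N.
     \<mu> k \<in> borel \<rightarrow>\<^sub>M prob_algebra borel \<and>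
     (\<forall>x. (\<integral>\<^sup>+u. ennreal ((norm u)\<^sup>2) \<partial>\<mu> k x) \<le> ennreal (\<gamma>\<^sup>2 * (norm x)\<^sup>2))}"

abbreviation strategies1 where "strategies1 G N \<equiv> mixed_strategies (gam1 G) N"
abbreviation strategies2 where "strategies2 G N \<equiv> mixed_strategies (gam2 G) N"

text \<open>Solution of \<open>y' = A y + b\<close>, \<open>y 0 = x\<close> (constant input \<open>b\<close>).\<close>

definition affine_flow :: "real ^ 'd ^ 'd \<Rightarrow> real ^ 'd \<Rightarrow> real ^ 'd \<Rightarrow> real \<Rightarrow> real ^ 'd" where
  "affine_flow A b x =
     (THE y. y 0 = x \<and> (\<forall>s. (y has_vector_derivative (A *v y s + b)) (at s)))"

text \<open>In the following, \<open>\<omega> k\<close> is the pair of controls \<open>(u, v)\<close> held on \<open>[\<tau> k, \<tau> (k + 1))\<close>.\<close>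

definition control_input ::
  "('d::finite, 'p::finite, 'q::finite) lq_game \<Rightarrow> (real ^ 'p) \<times> (real ^ 'q) \<Rightarrow> real ^ 'd" where
  "control_input G a = mat_B1 G *v fst a + mat_B2 G *v snd a"

primrec sampled_state ::
  "('d::finite, 'p::finite, 'q::finite) lq_game \<Rightarrow> (nat \<Rightarrow> real) \<Rightarrow>
   (nat \<Rightarrow> (real ^ 'p) \<times> (real ^ 'q)) \<Rightarrow> nat \<Rightarrow> real ^ 'd" where
  "sampled_state G \<tau> \<omega> 0 = x_init G"
| "sampled_state G \<tau> \<omega> (Suc k) =
     affine_flow (mat_A G) (control_input G (\<omega> k)) (sampled_state G \<tau> \<omega> k) (\<tau> (Suc k) - \<tau> k)"

definition state_at ::
  "('d::finite, 'p::finite, 'q::finite) lq_game \<Rightarrow> nat \<Rightarrow> (nat \<Rightarrow> real) \<Rightarrow>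
   (nat \<Rightarrow> (real ^ 'p) \<times> (real ^ 'q)) \<Rightarrow> real \<Rightarrow> real ^ 'd" where
  "state_at G N \<tau> \<omega> t =
     (let k = interval_index N \<tau> t
      in affine_flow (mat_A G) (control_input G (\<omega> k)) (sampled_state G \<tau> \<omega> k) (t - \<tau> k))"

text \<open>Joint law of the first \<open>k\<close> control pairs. Given the past, the next pair is drawn from the
  product measure, i.e. the two players randomize independently.\<close>

primrec control_law ::
  "('d::finite, 'p::finite, 'q::finite) lq_game \<Rightarrow> (nat \<Rightarrow> real) \<Rightarrow>
   (nat \<Rightarrow> real ^ 'd \<Rightarrow> (real ^ 'p) measure) \<Rightarrow> (nat \<Rightarrow> real ^ 'd \<Rightarrow> (real ^ 'q) measure) \<Rightarrow>
   nat \<Rightarrow> (nat \<Rightarrow> (real ^ 'p) \<times> (real ^ 'q)) measure" where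
  "control_law G \<tau> \<mu> \<nu> 0 = return (PiM {0..<0} (\<lambda>_. borel)) (\<lambda>_. undefined)"
| "control_law G \<tau> \<mu> \<nu> (Suc k) =
     bind (control_law G \<tau> \<mu> \<nu> k)
       (\<lambda>\<omega>. distr (\<mu> k (sampled_state G \<tau> \<omega> k) \<Otimes>\<^sub>M \<nu> k (sampled_state G \<tau> \<omega> k))
              (PiM {0..<Suc k} (\<lambda>_. borel)) (fun_upd \<omega> k))"

definition path_cost ::
  "('d::finite, 'p::finite, 'q::finite) lq_game \<Rightarrow> nat \<Rightarrow> (nat \<Rightarrow> real) \<Rightarrow>
   (nat \<Rightarrow> (real ^ 'p) \<times> (real ^ 'q)) \<Rightarrow> real" where
  "path_cost G N \<tau> \<omega> =
     (LINT t:{t_init G..t_end G}|lborel.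
        (let x = state_at G N \<tau> \<omega> t;
             u = fst (\<omega> (interval_index N \<tau> t));
             v = snd (\<omega> (interval_index N \<tau> t))
         in x \<bullet> (mat_Q G *v x) + u \<bullet> (mat_R1 G *v u) - v \<bullet> (mat_R2 G *v v)))
     + (let x = state_at G N \<tau> \<omega> (t_end G) in x \<bullet> (mat_QT G *v x))"

definition mixed_cost ::
  "('d::finite, 'p::finite, 'q::finite) lq_game \<Rightarrow> nat \<Rightarrow> (nat \<Rightarrow> real) \<Rightarrow>
   (nat \<Rightarrow> real ^ 'd \<Rightarrow> (real ^ 'p) measure) \<Rightarrow> (nat \<Rightarrow> real ^ 'd \<Rightarrow> (real ^ 'q) measure) \<Rightarrow>
   real" where
  "mixed_cost G N \<tau> \<mu> \<nu> = (\<integral>\<omega>. path_cost G N \<tau> \<omega> \<partial>control_law G \<tau> \<mu> \<nu> N)"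

definition is_game_value ::
  "('d::finite, 'p::finite, 'q::finite) lq_game \<Rightarrow> nat \<Rightarrow> (nat \<Rightarrow> real) \<Rightarrow> real \<Rightarrow> bool" where
  "is_game_value G N \<tau> V \<longleftrightarrow>
     ereal V = (INF \<mu>\<in>strategies1 G N. SUP \<nu>\<in>strategies2 G N. ereal (mixed_cost G N \<tau> \<mu> \<nu>)) \<and>
     ereal V = (SUP \<nu>\<in>strategies2 G N. INF \<mu>\<in>strategies1 G N. ereal (mixed_cost G N \<tau> \<mu> \<nu>))"

definition saddle_point ::
  "('d::finite, 'p::finite, 'q::finite) lq_game \<Rightarrow> nat \<Rightarrow> (nat \<Rightarrow> real) \<Rightarrow>
   (nat \<Rightarrow> real ^ 'd \<Rightarrow> (real ^ 'p) measure) \<Rightarrow> (nat \<Rightarrow> real ^ 'd \<Rightarrow> (real ^ 'q) measure) \<Rightarrow>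
   bool" where
  "saddle_point G N \<tau> \<mu>' \<nu>' \<longleftrightarrow>
     \<mu>' \<in> strategies1 G N \<and> \<nu>' \<in> strategies2 G N \<and>
     (\<forall>\<nu>\<in>strategies2 G N. mixed_cost G N \<tau> \<mu>' \<nu> \<le> mixed_cost G N \<tau> \<mu>' \<nu>') \<and>
     (\<forall>\<mu>\<in>strategies1 G N. mixed_cost G N \<tau> \<mu>' \<nu>' \<le> mixed_cost G N \<tau> \<mu> \<nu>')"


section \<open>Projected moments\<close>

definition mean_vec :: "(real ^ 'm) measure \<Rightarrow> real ^ 'm" where
  "mean_vec \<mu> = (\<integral>u. u \<partial>\<mu>)"

definition cov_matrix :: "(real ^ 'm) measure \<Rightarrow> real ^ 'm ^ 'm" where
  "cov_matrix \<mu> = (\<integral>u. (\<chi> i j. (u - mean_vec \<mu>) $ i * (u - mean_vec \<mu>) $ j) \<partial>\<mu>)"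

text \<open>The factor \<open>\<Lambda>\<close> of the covariance is determined only up to an orthogonal matrix, so the
  projection is a relation rather than a function.\<close>

definition projected_moments ::
  "nat \<Rightarrow> (nat \<Rightarrow> real ^ 'd \<Rightarrow> (real ^ 'm) measure) \<Rightarrow>
   (nat \<Rightarrow> real ^ 'd \<Rightarrow> (real ^ 'm) \<times> (real ^ 'm ^ 'm)) \<Rightarrow> bool" where
  "projected_moments N \<mu> \<phi> \<longleftrightarrow> (\<forall>k<N. \<forall>x.
     fst (\<phi> k x) = mean_vec (\<mu> k x) \<and>
     snd (\<phi> k x) ** transpose (snd (\<phi> k x)) = cov_matrix (\<mu> k x))"

definition lipschitz_moments ::
  "real \<Rightarrow> nat \<Rightarrow> (nat \<Rightarrow> real ^ 'd \<Rightarrow> (real ^ 'm) measure) \<Rightarrow> bool" where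
  "lipschitz_moments L N \<mu> \<longleftrightarrow>
     (\<exists>\<phi>. projected_moments N \<mu> \<phi> \<and> (\<forall>k<N. L-lipschitz_on UNIV (\<phi> k)))"


section \<open>Riccati equation and surrogate value\<close>

definition lambda2 ::
  "('d::finite, 'p::finite, 'q::finite) lq_game \<Rightarrow> nat \<Rightarrow> (nat \<Rightarrow> real) \<Rightarrow>
   (real \<Rightarrow> real ^ 'd ^ 'd) \<Rightarrow> real \<Rightarrow> real" where
  "lambda2 G N \<tau> P t =
     max 0 (lambda_max (step_at N \<tau> t *\<^sub>R (transpose (mat_B2 G) ** P t ** mat_B2 G) - mat_R2 G))"

definition riccati_rhs ::
  "('d::finite, 'p::finite, 'q::finite) lq_game \<Rightarrow> nat \<Rightarrow> (nat \<Rightarrow> real) \<Rightarrow>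
   (real \<Rightarrow> real ^ 'd ^ 'd) \<Rightarrow> real \<Rightarrow> real ^ 'd ^ 'd" where
  "riccati_rhs G N \<tau> P t =
     transpose (mat_A G) ** P t + P t ** mat_A G + mat_Q G
     - P t ** mat_B1 G ** matrix_inv (mat_R1 G) ** transpose (mat_B1 G) ** P t
     + P t ** mat_B2 G ** matrix_inv (mat_R2 G + mat (lambda2 G N \<tau> P t))
         ** transpose (mat_B2 G) ** P t
     + mat (lambda2 G N \<tau> P t * (gam2 G)\<^sup>2)"

text \<open>The right-hand side jumps at the partition points, so \<open>P\<close> is a continuous function
  satisfying the equation on each interval \<open>[\<tau> k, \<tau> (k + 1))\<close> (one-sidedly at \<open>\<tau> k\<close>).\<close>

definition riccati_solution ::
  "('d::finite, 'p::finite, 'q::finite) lq_game \<Rightarrow> nat \<Rightarrow> (nat \<Rightarrow> real) \<Rightarrow>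
   (real \<Rightarrow> real ^ 'd ^ 'd) \<Rightarrow> bool" where
  "riccati_solution G N \<tau> P \<longleftrightarrow>
     continuous_on {t_init G..t_end G} P \<and>
     (\<forall>t\<in>{t_init G..t_end G}. transpose (P t) = P t) \<and>
     P (t_end G) = mat_QT G \<and>
     (\<forall>k<N. \<forall>t\<in>{\<tau> k..<\<tau> (Suc k)}.
        (P has_vector_derivative - riccati_rhs G N \<tau> P t) (at t within {\<tau> k..<\<tau> (Suc k)}))"

definition capacity_conditions ::
  "('d::finite, 'p::finite, 'q::finite) lq_game \<Rightarrow> nat \<Rightarrow> (nat \<Rightarrow> real) \<Rightarrow>
   (real \<Rightarrow> real ^ 'd ^ 'd) \<Rightarrow> bool" where
  "capacity_conditions G N \<tau> P \<longleftrightarrow> (\<forall>t\<in>{t_init G..t_end G}.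
     (let S1 = matrix_inv (mat_R1 G);
          S2 = matrix_inv (mat_R2 G + mat (lambda2 G N \<tau> P t))
      in pos_semidef (mat ((gam1 G)\<^sup>2)
           - P t ** mat_B1 G ** (S1 ** S1) ** transpose (mat_B1 G) ** P t) \<and>
         pos_semidef (mat ((gam2 G)\<^sup>2)
           - P t ** mat_B2 G ** (S2 ** S2) ** transpose (mat_B2 G) ** P t)))"

text \<open>Closed form of the saddle-point value of the surrogate stochastic differential game,
  \<open>P\<close> being the solution of the Riccati equation.\<close>

definition surrogate_value :: "(real \<Rightarrow> real ^ 'd ^ 'd) \<Rightarrow> real \<Rightarrow> real ^ 'd \<Rightarrow> real" where
  "surrogate_value P t x = x \<bullet> (P t *v x)"

end

theory Submission
  imports Defs
begin

text \<open>
  For a small mesh the multiplier \<open>\<lambda>\<^sub>2\<close> vanishes: the capacity conditions bound both quadratic terms of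
  the Riccati equation, so its right-hand side grows at most linearly in \<open>P\<close> and Gronwall's inequality
  bounds \<open>P\<close> uniformly over all partitions. The surrogate game then has optimal strategies without
  diffusion, and both players can imitate them in the sampled game by holding the pure Riccati feedbacks
  \<open>u = - R\<^sub>1\<^sup>-\<^sup>1 B\<^sub>1\<^sup>T P x\<close> and \<open>v = R\<^sub>2\<^sup>-\<^sup>1 B\<^sub>2\<^sup>T P x\<close>, which the capacity conditions make admissible.

  Completing the squares along a trajectory shows that, on every path, the cost minus \<open>x\<^sub>0\<^sup>T P(t\<^sub>0) x\<^sub>0\<close> is
  the integral of \<open>\<bar>u + R\<^sub>1\<^sup>-\<^sup>1 B\<^sub>1\<^sup>T P x\<bar>\<^sup>2\<close> (weighted by \<open>R\<^sub>1\<close>) minus that of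
  \<open>\<bar>v - R\<^sub>2\<^sup>-\<^sup>1 B\<^sub>2\<^sup>T P x\<bar>\<^sup>2\<close> (weighted by \<open>R\<^sub>2\<close>). If Player 1 holds the Riccati feedback, the first square is
  only due to the drift within one step and is of the order of the squared step, whatever Player 2 does;
  so the saddle point value exceeds the surrogate value by at most \<open>O(mesh\<^sup>2)\<close>. The other inequality is
  symmetric. Second moments of the state are bounded uniformly because those of the controls are.
\<close>

subsection \<open>Matrices\<close>

text \<open>The multiplier and the solution determine each other, so \<open>P\<close> must be
  bounded while \<open>lambda2\<close> is still unknown. That bound uses only that
  \<open>lambda2\<close> grows at most linearly in \<open>P\<close>, with a factor proportional to
  the mesh; the coercivity of \<open>mat_R2 G\<close> removes the multiplier afterwards. The path
  estimate of each step is a function of the state and \<open>u\<close> plus a function of the state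
  and \<open>v\<close>. For such sums only the two conditional second moments and the second moment
  of the state enter, so the sampled process is never compared with a diffusion. Expected costs are
  Bochner integrals, which are 0 for nonintegrable functions. A one-sided bound on the path cost is
  therefore not enough: each pair of strategies gets an upper and a lower bound, one of them small
  and the other possibly crude but integrable. All constants are explicit expressions in the game
  data, which makes their independence of the partition visible. The rate in the statement follows
  from the quadratic one, because \<open>x\<^sup>2 \<le> sqrt x\<close> on the unit
  interval.\<close>

lemma norm_sq_vec: "(norm (x :: 'a::real_normed_vector ^ 'n))\<^sup>2 = (\<Sum>i\<in>UNIV. (norm (x $ i))\<^sup>2)"
  by (simp add: norm_vec_def L2_set_def sum_nonneg)

text \<open>The norm on \<open>real ^ 'n ^ 'm\<close> is the Euclidean norm of all entries (the
  Frobenius norm), so this is Cauchy-Schwarz row by row.\<close>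

lemma norm_matrix_vector_le: "norm (M *v x) \<le> norm M * norm x" for M :: "real ^ 'n ^ 'm"
proof -
  have "(norm (M *v x))\<^sup>2 = (\<Sum>i\<in>UNIV. (M $ i \<bullet> x)\<^sup>2)"
    by (simp add: norm_sq_vec matrix_vector_mult_def inner_vec_def)
  also have "\<dots> \<le> (\<Sum>i\<in>UNIV. (norm (M $ i))\<^sup>2 * (norm x)\<^sup>2)"
    by (intro sum_mono) (metis Cauchy_Schwarz_ineq2 abs_ge_zero power2_abs power_mono power_mult_distrib)
  also have "\<dots> = (norm M * norm x)\<^sup>2"
    unfolding power_mult_distrib norm_sq_vec[of M] sum_distrib_right ..
  finally show ?thesis
    by (rule power2_le_imp_le) simp
qed

lemma norm_transpose: "norm (transpose M) = norm M" for M :: "real ^ 'n ^ 'm"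
proof -
  have "(norm (transpose M))\<^sup>2 = (norm M)\<^sup>2"
    unfolding norm_sq_vec by (subst sum.swap) (simp add: transpose_def)
  then show ?thesis
    by (rule power2_eq_imp_eq) simp_all
qed

lemma norm_matrix_mult_le: "norm (M ** K) \<le> norm M * norm K"
  for M :: "real ^ 'n ^ 'm" and K :: "real ^ 'l ^ 'n"
proof -
  have row: "(M ** K) $ i = transpose K *v (M $ i)" for i
    by (simp add: vec_eq_iff matrix_matrix_mult_def matrix_vector_mult_def transpose_def mult.commute)
  have "(norm (M ** K))\<^sup>2 \<le> (\<Sum>i\<in>UNIV. (norm K)\<^sup>2 * (norm (M $ i))\<^sup>2)"
    unfolding norm_sq_vec[of "M ** K"] row
    using norm_matrix_vector_le[of "transpose K"]
    by (intro sum_mono) (simp add: norm_transpose flip: power_mult_distrib)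
  also have "\<dots> = (norm M * norm K)\<^sup>2"
    unfolding power_mult_distrib norm_sq_vec[of M] sum_distrib_left[symmetric] by (rule mult.commute)
  finally show ?thesis
    by (rule power2_le_imp_le) simp
qed

text \<open>Each column is the image of a unit vector, so an operator norm bound controls the
  Frobenius norm up to the number of columns. The capacity conditions give bounds of the first kind;
  the estimates of matrix products use the second.\<close>

lemma norm_matrix_le_of_bound:
  fixes M :: "real ^ 'n ^ 'm"
  assumes "\<And>x. norm (M *v x) \<le> c * norm x"
  shows "norm M \<le> real CARD('n) * c"
proof -
  have "norm M = norm (transpose M)"
    by (simp add: norm_transpose)
  also have "\<dots> \<le> (\<Sum>j\<in>UNIV. norm (transpose M $ j))"
    unfolding norm_vec_def[of "transpose M"] by (rule L2_set_le_sum) simp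
  also have "\<dots> \<le> (\<Sum>j\<in>(UNIV::'n set). c::real)"
  proof (rule sum_mono)
    fix j :: 'n
    have "transpose M $ j = M *v axis j 1"
      by (simp add: transpose_def matrix_vector_mul_component column_def matrix_vector_mult_basis)
    then show "norm (transpose M $ j) \<le> c"
      using assms[of "axis j 1"] by simp
  qed
  finally show ?thesis by simp
qed

lemma mat_mult_vec: "mat c *v x = c *\<^sub>R x" for x :: "real ^ 'n"
  by (simp add: vec_eq_iff matrix_vector_mult_def mat_def if_distrib[of "\<lambda>y. y * _"] cong: if_cong)

lemma norm_mat: "norm (mat c :: real ^ 'n ^ 'n) \<le> real CARD('n) * \<bar>c\<bar>"
proof (rule norm_matrix_le_of_bound)
  show "norm (mat c *v x) \<le> \<bar>c\<bar> * norm x" for x :: "real ^ 'n"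
    by (simp add: mat_mult_vec)
qed

lemma inner_transpose_mult: "x \<bullet> (M *v y) = (transpose M *v x) \<bullet> y" for M :: "real ^ 'n ^ 'm"
  by (simp add: dot_lmul_matrix)

lemma matrix_vector_mult_uminus: "(- M) *v x = - (M *v x)" for M :: "real ^ 'n ^ 'm"
  by (simp add: matrix_vector_mult_def vec_eq_iff sum_negf)

text \<open>By compactness the quadratic form attains a positive minimum on the unit sphere, and
  homogeneity carries it to all vectors. For \<open>mat_R2 G\<close> this minimum later decides how
  fine the mesh must be.\<close>

lemma pos_def_coercive:
  assumes "pos_def M"
  obtains r where "r > 0" "\<And>x. r * (norm x)\<^sup>2 \<le> x \<bullet> (M *v x)"
proof -
  have cont: "continuous_on (sphere 0 1) (\<lambda>x. x \<bullet> (M *v x))"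
    by (intro continuous_intros linear_continuous_on matrix_vector_mul_bounded_linear)
  have "axis undefined 1 \<in> sphere (0::real^'a) 1" by simp
  then obtain z where z: "z \<in> sphere 0 1" "\<And>y. y \<in> sphere 0 1 \<Longrightarrow> z \<bullet> (M *v z) \<le> y \<bullet> (M *v y)"
    using continuous_attains_inf[OF compact_sphere _ cont] by blast
  show ?thesis
  proof
    show "z \<bullet> (M *v z) > 0"
      using assms z(1) unfolding pos_def_def by (metis mem_sphere_0 norm_zero zero_neq_one)
    fix x
    show "z \<bullet> (M *v z) * (norm x)\<^sup>2 \<le> x \<bullet> (M *v x)"
    proof (cases "x = 0")
      case False
      then have "z \<bullet> (M *v z) \<le> (x /\<^sub>R norm x) \<bullet> (M *v (x /\<^sub>R norm x))"
        by (intro z) simp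
      also have "\<dots> = x \<bullet> (M *v x) / (norm x)\<^sup>2"
        by (simp add: matrix_vector_mult_scaleR divide_inverse power2_eq_square)
      finally show ?thesis
        using False by (simp add: field_simps)
    qed simp
  qed
qed

lemma pos_def_invertible:
  assumes "pos_def M"
  shows "invertible M"
proof -
  have "M *v x = 0 \<Longrightarrow> x = 0" for x
    using assms by (force simp: pos_def_def)
  then show ?thesis
    by (simp add: invertible_left_inverse matrix_left_invertible_ker)
qed

lemma matrix_inv_pos_def:
  assumes "pos_def M"
  shows "M ** matrix_inv M = mat 1" "matrix_inv M ** M = mat 1"
    "transpose (matrix_inv M) = matrix_inv M"
proof -
  have "\<exists>N. M ** N = mat 1 \<and> N ** M = mat 1"
    using pos_def_invertible[OF assms] by (simp add: invertible_def)
  then have inv: "M ** matrix_inv M = mat 1 \<and> matrix_inv M ** M = mat 1"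
    unfolding matrix_inv_def by (rule someI_ex)
  then show "M ** matrix_inv M = mat 1" "matrix_inv M ** M = mat 1" by auto
  have "transpose (matrix_inv M) ** M = mat 1"
    using inv assms matrix_transpose_mul[of M "matrix_inv M"]
    by (simp add: pos_def_def transpose_mat)
  then show "transpose (matrix_inv M) = matrix_inv M"
    by (metis inv matrix_mul_assoc matrix_mul_lid matrix_mul_rid)
qed

lemma pos_def_add_mat:
  assumes "pos_def M" "0 \<le> c"
  shows "pos_def (M + mat c)"
proof -
  have "transpose (M + mat c) = transpose M + transpose (mat c)"
    by (simp add: transpose_def vec_eq_iff)
  then show ?thesis
    using assms unfolding pos_def_def
    by (simp add: transpose_mat matrix_vector_mult_add_rdistrib inner_add_right mat_mult_vec add_pos_nonneg)
qed

text \<open>A maximizer of the quadratic form on the unit sphere is an eigenvector. This makes the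
  set under the \<open>Max\<close> in \<open>lambda_max\<close> nonempty.\<close>

lemma symmetric_eigenvector:
  fixes M :: "real ^ 'n ^ 'n"
  assumes sym: "transpose M = M"
  shows "\<exists>l v. v \<noteq> 0 \<and> M *v v = l *s v"
proof -
  have cont: "continuous_on (sphere 0 1) (\<lambda>x. x \<bullet> (M *v x))"
    by (intro continuous_intros linear_continuous_on matrix_vector_mul_bounded_linear)
  have "axis undefined 1 \<in> sphere (0::real^'n) 1" by simp
  then obtain z where z: "z \<in> sphere 0 1" "\<And>y. y \<in> sphere 0 1 \<Longrightarrow> y \<bullet> (M *v y) \<le> z \<bullet> (M *v z)"
    using continuous_attains_sup[OF compact_sphere _ cont] by blast
  define l where "l = z \<bullet> (M *v z)"
  have le: "x \<bullet> (M *v x) \<le> l * (x \<bullet> x)" for x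
  proof (cases "x = 0")
    case False
    then have "(x /\<^sub>R norm x) \<bullet> (M *v (x /\<^sub>R norm x)) \<le> l"
      unfolding l_def by (intro z) simp
    then have "x \<bullet> (M *v x) / (norm x)\<^sup>2 \<le> l"
      by (simp add: matrix_vector_mult_scaleR divide_inverse power2_eq_square mult_ac)
    then show ?thesis
      using False by (simp add: field_simps flip: power2_norm_eq_inner)
  qed simp
  \<comment> \<open>The residual of the eigenvalue equation at the maximizer \<open>z\<close>.
    Moving from \<open>z\<close> in the direction \<open>- w\<close> would violate \<open>le\<close>
    unless \<open>w\<close> vanishes.\<close>
  define w where "w = l *\<^sub>R z - M *v z"
  define q where "q = l * (w \<bullet> w) - w \<bullet> (M *v w)"
  have zz: "z \<bullet> z = 1" using z(1) by (simp add: power2_norm_eq_inner[symmetric])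
  have Mzw: "z \<bullet> (M *v w) = (M *v z) \<bullet> w"
    using inner_transpose_mult[of z M w] sym by simp
  \<comment> \<open>The form \<open>l * (x \<bullet> x) - x \<bullet> (M *v x)\<close> is
    nonnegative and vanishes at \<open>z\<close>, so along \<open>z - t *\<^sub>R w\<close> only its
    linear and quadratic terms in \<open>t\<close> remain.\<close>
  have *: "0 \<le> t\<^sup>2 * q - 2 * t * (w \<bullet> w)" for t
  proof -
    have "0 \<le> l * ((z - t *\<^sub>R w) \<bullet> (z - t *\<^sub>R w)) - (z - t *\<^sub>R w) \<bullet> (M *v (z - t *\<^sub>R w))"
      using le by simp
    also have "\<dots> = l * (1 - 2 * t * (z \<bullet> w) + t\<^sup>2 * (w \<bullet> w))
        - (l - 2 * t * ((M *v z) \<bullet> w) + t\<^sup>2 * (w \<bullet> (M *v w)))"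
      by (simp add: matrix_vector_mult_diff_distrib matrix_vector_mult_scaleR inner_diff_left
          inner_diff_right zz l_def[symmetric] Mzw inner_commute[of w z] inner_commute[of w "M *v z"]
          power2_eq_square algebra_simps)
    also have "\<dots> = t\<^sup>2 * q - 2 * t * (l * (z \<bullet> w) - (M *v z) \<bullet> w)"
      by (simp add: q_def algebra_simps)
    also have "l * (z \<bullet> w) - (M *v z) \<bullet> w = w \<bullet> w"
      by (subst (3) w_def) (simp add: inner_diff_left)
    finally show ?thesis .
  qed
  have "w \<bullet> w = 0"
  proof (rule ccontr)
    assume "w \<bullet> w \<noteq> 0"
    then have pos: "w \<bullet> w > 0" by simp
    \<comment> \<open>Small enough that the quadratic term cannot compensate the linear one:
      \<open>t * q\<close> is at most \<open>w \<bullet> w\<close>, while the inequality above asks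
      for twice that.\<close>
    define t where "t = (w \<bullet> w) / (\<bar>q\<bar> + 1)"
    have t: "t > 0" using pos by (simp add: t_def add_nonneg_pos)
    then have "2 * (w \<bullet> w) \<le> t * q"
      using *[of t] by (simp add: power2_eq_square)
    also have "\<dots> \<le> t * (\<bar>q\<bar> + 1)" using t by simp
    also have "\<dots> = w \<bullet> w" by (simp add: t_def)
    finally show False using pos by simp
  qed
  then have "M *v z = l *s z"
    by (simp add: w_def scalar_mult_eq_scaleR)
  moreover have "z \<noteq> 0" using z(1) by auto
  ultimately show ?thesis by blast
qed

text \<open>Eigenvectors of distinct eigenvalues are orthogonal, hence independent, and an
  independent set in finite dimension is finite. \<open>Max\<close> in \<open>lambda_max\<close> has
  its usual meaning only on a finite set.\<close>

lemma finite_eigenvalues: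
  fixes M :: "real ^ 'n ^ 'n"
  assumes sym: "transpose M = M"
  shows "finite {l. \<exists>v. v \<noteq> 0 \<and> M *v v = l *s v}" (is "finite ?E")
proof -
  define f where "f l = (SOME v. v \<noteq> 0 \<and> M *v v = l *s v)" for l
  have f: "f l \<noteq> 0" "M *v f l = l *\<^sub>R f l" if "l \<in> ?E" for l
    using someI_ex[of "\<lambda>v. v \<noteq> 0 \<and> M *v v = l *s v"] that
    unfolding f_def by (auto simp: scalar_mult_eq_scaleR)
  have orth: "f l \<bullet> f m = 0" if "l \<in> ?E" "m \<in> ?E" "l \<noteq> m" for l m
  proof -
    have "f l \<bullet> (M *v f m) = (M *v f l) \<bullet> f m"
      using inner_transpose_mult[of "f l" M "f m"] sym by simp
    then show ?thesis using f that by simp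
  qed
  \<comment> \<open>A common eigenvector of two distinct eigenvalues would be orthogonal to
    itself.\<close>
  have inj: "inj_on f ?E"
  proof (rule inj_onI)
    fix l m assume "l \<in> ?E" "m \<in> ?E" "f l = f m"
    then show "l = m" using orth[of l m] f(1)[of l] by (cases "l = m") simp_all
  qed
  have "pairwise orthogonal (f ` ?E)"
    unfolding pairwise_def orthogonal_def using orth by blast
  moreover have "0 \<notin> f ` ?E"
    using f(1) by fastforce
  ultimately have "finite (f ` ?E)"
    using pairwise_orthogonal_independent independent_imp_finite by blast
  then show ?thesis
    using inj finite_imageD by blast
qed

lemma lambda_max_le:
  fixes M :: "real ^ 'n ^ 'n"
  assumes sym: "transpose M = M" and c: "\<And>x. x \<bullet> (M *v x) \<le> c * (x \<bullet> x)"
  shows "lambda_max M \<le> c"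
proof -
  have "l \<le> c" if "v \<noteq> 0" "M *v v = l *s v" for l v
  proof -
    have "l * (v \<bullet> v) \<le> c * (v \<bullet> v)"
      using c[of v] that by (simp add: scalar_mult_eq_scaleR)
    then show ?thesis using that by simp
  qed
  then show ?thesis
    unfolding lambda_max_def using symmetric_eigenvector[OF sym]
    by (subst Max_le_iff[OF finite_eigenvalues[OF sym]]) auto
qed

subsection \<open>Linear differential equations\<close>

text \<open>The function \<open>exp (- c * t) * f t\<close> is nonincreasing. The derivative is
  required only inside the interval, because the derivative of the Riccati solution may jump at the
  partition points.\<close>

lemma gronwall_deriv_le:
  fixes f :: "real \<Rightarrow> real"
  assumes "a \<le> b" and cont: "continuous_on {a..b} f"
    and deriv: "\<And>t. a < t \<Longrightarrow> t < b \<Longrightarrow> (f has_real_derivative f' t) (at t)"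
    and le: "\<And>t. a < t \<Longrightarrow> t < b \<Longrightarrow> f' t \<le> c * f t"
  shows "f b \<le> exp (c * (b - a)) * f a"
proof -
  define g where "g t = exp (- c * t) * f t" for t
  have "g b \<le> g a"
  proof (cases "a = b")
    case False
    then have ab: "a < b" using \<open>a \<le> b\<close> by simp
    have cg: "continuous_on {a..b} g"
      unfolding g_def by (intro continuous_intros cont)
    have dg: "(g has_real_derivative exp (- c * t) * (f' t - c * f t)) (at t)" if "a < t" "t < b" for t
      unfolding g_def by (rule derivative_eq_intros deriv that refl)+ (simp add: algebra_simps)
    show ?thesis
    proof (rule DERIV_nonpos_imp_decreasing_open[OF \<open>a \<le> b\<close> _ cg])
      fix t assume t: "a < t" "t < b"
      have "exp (- c * t) * (f' t - c * f t) \<le> 0"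
        using le[OF t] by (intro mult_nonneg_nonpos) auto
      then show "\<exists>y. (g has_real_derivative y) (at t) \<and> y \<le> 0"
        using dg[OF t] by blast
    qed
  qed simp
  then have "exp (c * b) * (exp (- c * b) * f b) \<le> exp (c * b) * (exp (- c * a) * f a)"
    by (simp add: g_def)
  then show ?thesis
    by (simp add: mult_exp_exp[symmetric] algebra_simps exp_add[symmetric] exp_diff exp_minus field_simps)
qed

text \<open>Time reversal of the previous bound: the Riccati equation prescribes the value at the
  right end and is estimated backwards.\<close>

lemma gronwall_deriv_ge:
  fixes f :: "real \<Rightarrow> real"
  assumes "a \<le> b" and cont: "continuous_on {a..b} f"
    and deriv: "\<And>t. a < t \<Longrightarrow> t < b \<Longrightarrow> (f has_real_derivative f' t) (at t)"
    and ge: "\<And>t. a < t \<Longrightarrow> t < b \<Longrightarrow> - c * f t \<le> f' t"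
  shows "f a \<le> exp (c * (b - a)) * f b"
proof -
  define g where "g t = f (- t)" for t
  have "g (- a) \<le> exp (c * (- a - (- b))) * g (- b)"
  proof (rule gronwall_deriv_le)
    show "continuous_on {- b..- a} g"
      unfolding g_def by (intro continuous_on_compose2[OF cont] continuous_intros) auto
    show "(g has_real_derivative - f' (- t)) (at t)" if "- b < t" "t < - a" for t
      using DERIV_mirror[of f "f' (- t)" t] deriv[of "- t"] that unfolding g_def by simp
    show "- f' (- t) \<le> c * g t" if "- b < t" "t < - a" for t
      using ge[of "- t"] that by (simp add: g_def)
  qed (use \<open>a \<le> b\<close> in simp)
  then show ?thesis by (simp add: g_def)
qed

section \<open>Energy estimate, uniqueness and existence for affine equations\<close>

lemma has_real_derivative_norm_sq:
  fixes y :: "real \<Rightarrow> 'a::real_inner"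
  assumes "(y has_vector_derivative y') (at t)"
  shows "((\<lambda>t. (norm (y t))\<^sup>2) has_real_derivative 2 * (y t \<bullet> y')) (at t)"
proof -
  have "((\<lambda>t. y t \<bullet> y t) has_vector_derivative (y t \<bullet> y' + y' \<bullet> y t)) (at t)"
    using bounded_bilinear.has_vector_derivative[OF bounded_bilinear_inner assms assms] .
  then show ?thesis
    by (simp add: power2_norm_eq_inner has_real_derivative_iff_has_vector_derivative inner_commute)
qed

text \<open>Adding the constant \<open>(norm b)\<^sup>2\<close> to the energy makes the differential
  inequality homogeneous, so Gronwall applies although the equation has an input.\<close>

lemma affine_ode_energy:
  fixes A :: "real ^ 'd ^ 'd"
  assumes y: "\<And>s. (y has_vector_derivative A *v y s + b) (at s)" and "0 \<le> s"
  shows "(norm (y s))\<^sup>2 + (norm b)\<^sup>2 \<le> exp ((2 * norm A + 1) * s) * ((norm (y 0))\<^sup>2 + (norm b)\<^sup>2)"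
proof -
  have deriv: "((\<lambda>s. (norm (y s))\<^sup>2 + (norm b)\<^sup>2) has_real_derivative 2 * (y s \<bullet> (A *v y s + b))) (at s)" for s
    using DERIV_add[OF has_real_derivative_norm_sq[OF y] DERIV_const] by simp
  have "2 * (y s \<bullet> (A *v y s + b)) \<le> (2 * norm A + 1) * ((norm (y s))\<^sup>2 + (norm b)\<^sup>2)" for s
  proof -
    have "y s \<bullet> (A *v y s) \<le> norm (y s) * (norm A * norm (y s))"
      using norm_cauchy_schwarz[of "y s" "A *v y s"] norm_matrix_vector_le[of A "y s"]
      by (meson mult_left_mono norm_ge_zero order_trans)
    moreover have "2 * (y s \<bullet> b) \<le> (norm (y s))\<^sup>2 + (norm b)\<^sup>2"
      using norm_cauchy_schwarz[of "y s" b] sum_squares_bound[of "norm (y s)" "norm b"] by simp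
    moreover have "0 \<le> norm A * (norm b)\<^sup>2" by simp
    moreover have "(2 * norm A + 1) * ((norm (y s))\<^sup>2 + (norm b)\<^sup>2) = 2 * (norm (y s) * (norm A * norm (y s)))
        + 2 * (norm A * (norm b)\<^sup>2) + ((norm (y s))\<^sup>2 + (norm b)\<^sup>2)"
      by (simp add: algebra_simps power2_eq_square)
    ultimately show ?thesis
      unfolding inner_add_right distrib_left by linarith
  qed
  then show ?thesis
    using gronwall_deriv_le[OF \<open>0 \<le> s\<close> _ deriv] DERIV_continuous_on[OF has_field_derivative_at_within[OF deriv]]
    by simp
qed

lemma affine_ode_unique:
  fixes A :: "real ^ 'd ^ 'd"
  assumes y: "\<And>s. (y has_vector_derivative A *v y s + b) (at s)"
    and z: "\<And>s. (z has_vector_derivative A *v z s + b) (at s)"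
    and "y 0 = z 0"
  shows "y = z"
proof
  fix s
  define w where "w s = y s - z s" for s
  have w: "(w has_vector_derivative A *v w s + 0) (at s)" for s
    unfolding w_def using has_vector_derivative_diff[OF y z]
    by (simp add: matrix_vector_mult_diff_distrib)
  have w0: "w 0 = 0" using \<open>y 0 = z 0\<close> by (simp add: w_def)
  have "w s = 0"
  proof (cases "0 \<le> s")
    case True
    then show ?thesis using affine_ode_energy[OF w True] w0 by simp
  next
    case False
    \<comment> \<open>Negative times: reflection turns \<open>A\<close> into \<open>- A\<close>, and
      the energy estimate applies to the reflected function.\<close>
    define v where "v s = w (- s)" for s
    have "(v has_vector_derivative (- A) *v v s + 0) (at s)" for s
    proof -
      have "((\<lambda>s. w (- s)) has_vector_derivative (- 1) *\<^sub>R (A *v w (- s) + 0)) (at s)"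
        using vector_diff_chain_at[OF has_vector_derivative_minus[OF has_vector_derivative_id] w, of s]
        by (simp add: o_def)
      then show ?thesis
        unfolding v_def by (simp add: matrix_vector_mult_uminus)
    qed
    from affine_ode_energy[OF this, of "- s"] False w0 show ?thesis by (simp add: v_def)
  qed
  then show "y s = z s" by (simp add: w_def)
qed

text \<open>The derivatives at time 0 of the solution of \<open>y' = A y + b\<close>,
  \<open>y 0 = x\<close>; the input enters directly only in the first one.\<close>

primrec affine_taylor :: "real ^ 'd ^ 'd \<Rightarrow> real ^ 'd \<Rightarrow> real ^ 'd \<Rightarrow> nat \<Rightarrow> real ^ 'd" where
  "affine_taylor A b x 0 = x"
| "affine_taylor A b x (Suc n) = A *v affine_taylor A b x n + (if n = 0 then b else 0)"

lemma norm_affine_taylor_le: "norm (affine_taylor A b x n) \<le> (norm A + 1) ^ n * (norm x + norm b)"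
proof (induction n)
  case (Suc n)
  let ?K = "norm A + 1"
  have b: "norm (if n = 0 then b else 0) \<le> ?K ^ n * (norm x + norm b)"
    by (auto intro: mult_nonneg_nonneg)
  have "norm (affine_taylor A b x (Suc n)) \<le> norm A * norm (affine_taylor A b x n) + norm (if n = 0 then b else 0)"
    using norm_triangle_ineq[of "A *v affine_taylor A b x n" "if n = 0 then b else 0"]
      norm_matrix_vector_le[of A "affine_taylor A b x n"] by simp
  also have "\<dots> \<le> norm A * (?K ^ n * (norm x + norm b)) + ?K ^ n * (norm x + norm b)"
    using Suc b by (intro add_mono mult_left_mono) auto
  also have "\<dots> = ?K ^ Suc n * (norm x + norm b)" by (simp add: algebra_simps)
  finally show ?case .
qed simp

text \<open>Together with uniqueness this gives the \<open>THE\<close> in \<open>affine_flow\<close>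
  its meaning. The solution is its Taylor series, taken componentwise: the derivatives at 0 grow at
  most geometrically, so the series converges everywhere and may be differentiated termwise.\<close>

lemma affine_ode_exists:
  fixes A :: "real ^ 'd ^ 'd"
  obtains y where "y 0 = x" "\<And>s. (y has_vector_derivative A *v y s + b) (at s)"
proof -
  define c where "c = affine_taylor A b x"
  define K where "K = norm A + 1"
  have summ: "summable (\<lambda>n. c n $ i / fact n * s ^ n)" for i s
  proof (rule summable_comparison_test')
    show "summable (\<lambda>n. (norm x + norm b) * (inverse (fact n) * (K * \<bar>s\<bar>) ^ n))"
      by (intro summable_mult summable_exp)
    fix n :: nat
    have "\<bar>c n $ i\<bar> \<le> K ^ n * (norm x + norm b)"
      using component_le_norm_cart[of "c n" i] norm_affine_taylor_le[of A b x n] by (simp add: c_def K_def)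
    then have "\<bar>c n $ i\<bar> * \<bar>s\<bar> ^ n \<le> (K ^ n * (norm x + norm b)) * \<bar>s\<bar> ^ n"
      by (intro mult_right_mono) auto
    then have "\<bar>c n $ i\<bar> * \<bar>s\<bar> ^ n / fact n \<le> (K ^ n * (norm x + norm b)) * \<bar>s\<bar> ^ n / fact n"
      by (intro divide_right_mono) auto
    then show "norm (c n $ i / fact n * s ^ n) \<le> (norm x + norm b) * (inverse (fact n) * (K * \<bar>s\<bar>) ^ n)"
      by (simp add: abs_mult power_abs power_mult_distrib divide_inverse mult_ac)
  qed
  define y where "y s = (\<chi> i. \<Sum>n. c n $ i / fact n * s ^ n)" for s
  have "(y has_vector_derivative A *v y s + b) (at s)" for s
  proof -
    have comp: "((\<lambda>s. y s $ i) has_real_derivative (A *v y s + b) $ i) (at s)" for i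
    proof -
      have "diffs (\<lambda>n. c n $ i / fact n) n = c (Suc n) $ i / fact n" for n
        by (simp add: diffs_def field_simps del: of_nat_Suc)
      then have 1: "((\<lambda>s. y s $ i) has_real_derivative (\<Sum>n. c (Suc n) $ i / fact n * s ^ n)) (at s)"
        using termdiffs_strong_converges_everywhere[OF summ, of i s] by (simp add: y_def)
      have "(\<lambda>n. \<Sum>j\<in>UNIV. A $ i $ j * (c n $ j / fact n * s ^ n)) sums
          (\<Sum>j\<in>UNIV. A $ i $ j * (\<Sum>n. c n $ j / fact n * s ^ n))"
        by (intro sums_sum sums_mult summable_sums summ)
      moreover have "(\<lambda>n. if n = 0 then b $ i else 0) sums b $ i"
        using sums_single[of 0 "\<lambda>_. b $ i"] by simp
      ultimately have "(\<lambda>n. (\<Sum>j\<in>UNIV. A $ i $ j * (c n $ j / fact n * s ^ n)) + (if n = 0 then b $ i else 0))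
          sums ((\<Sum>j\<in>UNIV. A $ i $ j * (\<Sum>n. c n $ j / fact n * s ^ n)) + b $ i)"
        by (rule sums_add)
      moreover have "(\<Sum>j\<in>UNIV. A $ i $ j * (c n $ j / fact n * s ^ n)) + (if n = 0 then b $ i else 0)
          = c (Suc n) $ i / fact n * s ^ n" for n
        by (simp add: c_def matrix_vector_mult_def sum_distrib_left sum_distrib_right sum_divide_distrib mult_ac)
      ultimately have "(\<Sum>n. c (Suc n) $ i / fact n * s ^ n) = (A *v y s + b) $ i"
        by (simp add: sums_iff y_def matrix_vector_mult_def)
      then show ?thesis using 1 by simp
    qed
    show ?thesis
      unfolding has_vector_derivative_def
    proof (subst has_derivative_componentwise_within, rule ballI)
      fix e :: "real ^ 'd" assume "e \<in> Basis"
      then obtain i where e: "e = axis i 1"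
        by (auto simp: Basis_vec_def)
      show "((\<lambda>t. y t \<bullet> e) has_derivative (\<lambda>h. (h *\<^sub>R (A *v y s + b)) \<bullet> e)) (at s)"
        using comp[of i] unfolding has_field_derivative_def e inner_axis
        by (simp add: mult_commute_abs)
    qed
  qed
  moreover have "y 0 = x"
    unfolding vec_eq_iff y_def using powser_zero[of "\<lambda>n. c n $ i / fact n" for i] by (simp add: c_def)
  ultimately show thesis using that by blast
qed

lemma affine_flow_eqI:
  assumes "y 0 = x" "\<And>s. (y has_vector_derivative A *v y s + b) (at s)"
  shows "affine_flow A b x = y"
  unfolding affine_flow_def
  using assms affine_ode_unique[of _ A b y] by (intro the_equality) auto

lemma affine_flow_0 [simp]: "affine_flow A b x 0 = x"
  and affine_flow_deriv: "(affine_flow A b x has_vector_derivative A *v affine_flow A b x s + b) (at s)"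
proof -
  obtain y where y: "y 0 = x" "\<And>s. (y has_vector_derivative A *v y s + b) (at s)"
    using affine_ode_exists[of x A b] by blast
  show "affine_flow A b x 0 = x"
    and "(affine_flow A b x has_vector_derivative A *v affine_flow A b x s + b) (at s)"
    using y affine_flow_eqI[OF y] by auto
qed

lemma continuous_on_affine_flow: "continuous_on S (affine_flow A b x)"
  by (meson affine_flow_deriv continuous_at_imp_continuous_on has_vector_derivative_continuous)

lemma affine_flow_linear:
  "affine_flow A (a *\<^sub>R b + c *\<^sub>R b') (a *\<^sub>R x + c *\<^sub>R x') s
    = a *\<^sub>R affine_flow A b x s + c *\<^sub>R affine_flow A b' x' s"
proof -
  have "affine_flow A (a *\<^sub>R b + c *\<^sub>R b') (a *\<^sub>R x + c *\<^sub>R x')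
    = (\<lambda>s. a *\<^sub>R affine_flow A b x s + c *\<^sub>R affine_flow A b' x' s)"
  proof (rule affine_flow_eqI)
    fix s
    have "((\<lambda>s. a *\<^sub>R affine_flow A b x s + c *\<^sub>R affine_flow A b' x' s) has_vector_derivative
       a *\<^sub>R (A *v affine_flow A b x s + b) + c *\<^sub>R (A *v affine_flow A b' x' s + b')) (at s)"
      by (rule has_vector_derivative_add affine_flow_deriv
          bounded_linear.has_vector_derivative[OF bounded_linear_scaleR_right])+
    then show "((\<lambda>s. a *\<^sub>R affine_flow A b x s + c *\<^sub>R affine_flow A b' x' s) has_vector_derivative
       A *v (a *\<^sub>R affine_flow A b x s + c *\<^sub>R affine_flow A b' x' s) + (a *\<^sub>R b + c *\<^sub>R b')) (at s)"
      by (simp add: matrix_vector_right_distrib matrix_vector_mult_scaleR algebra_simps)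
  qed simp
  then show ?thesis by simp
qed

text \<open>For fixed \<open>s\<close> the flow is linear in the pair of input and initial state,
  hence a finite combination of flows for basis vectors, each continuous in \<open>s\<close> alone.
  Joint continuity yields the measurability of sampled states and costs.\<close>

lemma continuous_on_affine_flow_joint:
  "continuous_on UNIV (\<lambda>(b, x, s). affine_flow A b x s)" for A :: "real ^ 'd ^ 'd"
proof -
  define f where "f p s = affine_flow A (fst p) (snd p) s" for p s
  have lin: "linear (\<lambda>p. f p s)" for s
  proof (rule linearI)
    show "f (p + q) s = f p s + f q s" for p q
      using affine_flow_linear[of A 1 "fst p" 1 "fst q" "snd p" "snd q" s] by (simp add: f_def)
    show "f (c *\<^sub>R p) s = c *\<^sub>R f p s" for c p
      using affine_flow_linear[of A c "fst p" 0 0 "snd p" 0 s] by (simp add: f_def)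
  qed
  have "f p s = (\<Sum>e\<in>Basis. (p \<bullet> e) *\<^sub>R f e s)" for p s
  proof -
    have "f p s = f (\<Sum>e\<in>Basis. (p \<bullet> e) *\<^sub>R e) s"
      by (simp only: euclidean_representation)
    also have "\<dots> = (\<Sum>e\<in>Basis. f ((p \<bullet> e) *\<^sub>R e) s)"
      by (rule linear_sum[OF lin])
    finally show ?thesis
      by (simp only: linear_cmul[OF lin])
  qed
  then have "(\<lambda>(b, x, s). affine_flow A b x s)
      = (\<lambda>z. \<Sum>e\<in>Basis. ((fst z, fst (snd z)) \<bullet> e) *\<^sub>R f e (snd (snd z)))"
    unfolding case_prod_beta by (intro ext) (metis f_def fst_conv snd_conv)
  moreover have "continuous_on UNIV (\<lambda>z. \<Sum>e\<in>Basis. ((fst z, fst (snd z)) \<bullet> e) *\<^sub>R f e (snd (snd z)))"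
    unfolding f_def
    by (intro continuous_intros continuous_on_compose2[OF continuous_on_affine_flow[of UNIV]]) auto
  ultimately show ?thesis
    by (simp only:)
qed

subsection \<open>The law of the sampled controls\<close>

lemma borel_measurable_affine_flow [measurable (raw)]:
  fixes A :: "real ^ 'd ^ 'd"
  assumes [measurable]: "f \<in> borel_measurable M" "g \<in> borel_measurable M" "h \<in> borel_measurable M"
  shows "(\<lambda>w. affine_flow A (f w) (g w) (h w)) \<in> borel_measurable M"
proof -
  have flow: "(\<lambda>(b, x, s). affine_flow A b x s) \<in> borel_measurable borel"
    by (rule borel_measurable_continuous_onI[OF continuous_on_affine_flow_joint])
  have "(\<lambda>w. (f w, g w, h w)) \<in> borel_measurable M"
    by (intro borel_measurable_Pair assms)
  from measurable_compose[OF this flow] show ?thesis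
    by (simp only: case_prod_conv)
qed

lemma borel_measurable_matrix_mult [measurable (raw)]:
  fixes M' :: "real ^ 'n ^ 'm"
  assumes "f \<in> borel_measurable M"
  shows "(\<lambda>w. M' *v f w) \<in> borel_measurable M"
  using assms
  by (rule borel_measurable_continuous_on[rotated])
     (intro linear_continuous_on matrix_vector_mul_bounded_linear)

lemma borel_measurable_control_input [measurable (raw)]:
  assumes [measurable]: "f \<in> borel_measurable M"
  shows "(\<lambda>w. control_input G (f w)) \<in> borel_measurable M"
proof -
  have [measurable]: "(\<lambda>w. fst (f w)) \<in> borel_measurable M" "(\<lambda>w. snd (f w)) \<in> borel_measurable M"
    by (rule borel_measurable_continuous_on[OF _ assms], intro continuous_intros)+
  show ?thesis unfolding control_input_def by measurable
qed

abbreviation controls_space :: "nat \<Rightarrow> (nat \<Rightarrow> (real ^ 'p::finite) \<times> (real ^ 'q::finite)) measure" where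
  "controls_space k \<equiv> PiM {0..<k} (\<lambda>_. borel)"

text \<open>Causality: the state at a node is determined by the controls chosen before it.\<close>

lemma sampled_state_upd [simp]: "k \<le> j \<Longrightarrow> sampled_state G \<tau> (fun_upd \<omega> j a) k = sampled_state G \<tau> \<omega> k"
  by (induction k) auto

lemma measurable_sampled_state [measurable]:
  "k \<le> n \<Longrightarrow> (\<lambda>\<omega>. sampled_state G \<tau> \<omega> k) \<in> borel_measurable (controls_space n)"
proof (induction k)
  case (Suc k)
  then have [measurable]: "(\<lambda>\<omega>. \<omega> k) \<in> controls_space n \<rightarrow>\<^sub>M borel"
    "(\<lambda>\<omega>. sampled_state G \<tau> \<omega> k) \<in> borel_measurable (controls_space n)"
    by auto
  show ?case by simp
qed simp

lemma measurable_control_fst [measurable]: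
  "k < n \<Longrightarrow> (\<lambda>\<omega>. fst (\<omega> k)) \<in> borel_measurable (controls_space n)"
  by (rule borel_measurable_continuous_on[where g="\<lambda>\<omega>. \<omega> k"]) (auto intro: continuous_intros)

lemma measurable_control_snd [measurable]:
  "k < n \<Longrightarrow> (\<lambda>\<omega>. snd (\<omega> k)) \<in> borel_measurable (controls_space n)"
  by (rule borel_measurable_continuous_on[where g="\<lambda>\<omega>. \<omega> k"]) (auto intro: continuous_intros)

lemma borel_measurable_case_prod_compose:
  fixes f :: "'z \<Rightarrow> 'a::second_countable_topology" and g :: "'z \<Rightarrow> 'b::second_countable_topology"
  assumes "case_prod F \<in> borel_measurable borel" "f \<in> borel_measurable M" "g \<in> borel_measurable M"
  shows "(\<lambda>w. F (f w) (g w)) \<in> borel_measurable M"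
  using measurable_compose[OF borel_measurable_Pair[OF assms(2,3)] assms(1)]
  by (simp only: case_prod_conv)

lemma strategy_moments:
  assumes "\<mu> \<in> mixed_strategies \<gamma> N" "k < N"
  shows "prob_space (\<mu> k x)" "sets (\<mu> k x) = sets borel"
    "(\<integral>\<^sup>+u. ennreal ((norm u)\<^sup>2) \<partial>\<mu> k x) \<le> ennreal (\<gamma>\<^sup>2 * (norm x)\<^sup>2)"
  using assms measurable_space[of "\<mu> k" borel "prob_algebra borel" x]
  by (auto simp: mixed_strategies_def space_prob_algebra)

locale mixed_play =
  fixes G :: "('d::finite, 'p::finite, 'q::finite) lq_game" and \<tau> :: "nat \<Rightarrow> real" and N :: nat
    and \<mu> :: "nat \<Rightarrow> real ^ 'd \<Rightarrow> (real ^ 'p) measure" and \<nu> :: "nat \<Rightarrow> real ^ 'd \<Rightarrow> (real ^ 'q) measure"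
    and \<gamma> \<gamma>' :: real
  assumes \<mu>: "\<mu> \<in> mixed_strategies \<gamma> N" and \<nu>: "\<nu> \<in> mixed_strategies \<gamma>' N"
begin

abbreviation "law \<equiv> control_law G \<tau> \<mu> \<nu>"
abbreviation "state k \<omega> \<equiv> sampled_state G \<tau> \<omega> k"

lemma measurable_strategy1 [measurable]: "k < N \<Longrightarrow> \<mu> k \<in> borel \<rightarrow>\<^sub>M prob_algebra borel"
  and measurable_strategy2 [measurable]: "k < N \<Longrightarrow> \<nu> k \<in> borel \<rightarrow>\<^sub>M prob_algebra borel"
  using \<mu> \<nu> by (auto simp: mixed_strategies_def)

lemmas prob_space_strategy1 = strategy_moments(1)[OF \<mu>]
  and sets_strategy1 [measurable_cong] = strategy_moments(2)[OF \<mu>]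
  and second_moment1 = strategy_moments(3)[OF \<mu>]
  and prob_space_strategy2 = strategy_moments(1)[OF \<nu>]
  and sets_strategy2 [measurable_cong] = strategy_moments(2)[OF \<nu>]
  and second_moment2 = strategy_moments(3)[OF \<nu>]

text \<open>The transition kernel of one step: the next pair is drawn and written into coordinate
  \<open>k\<close>. Its measurability is what makes \<open>bind\<close> in
  \<open>control_law\<close> produce a probability measure and obey the integral formula
  below.\<close>

lemma measurable_pair_kernel:
  assumes "k < N"
  shows "(\<lambda>\<omega>. distr (\<mu> k (state k \<omega>) \<Otimes>\<^sub>M \<nu> k (state k \<omega>)) (controls_space (Suc k)) (fun_upd \<omega> k))
    \<in> controls_space k \<rightarrow>\<^sub>M prob_algebra (controls_space (Suc k))"
proof (rule measurable_distr_prob_space2)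
  note [measurable] = measurable_strategy1[OF assms] measurable_strategy2[OF assms]
  show "(\<lambda>\<omega>. \<mu> k (state k \<omega>) \<Otimes>\<^sub>M \<nu> k (state k \<omega>))
      \<in> controls_space k \<rightarrow>\<^sub>M prob_algebra (borel \<Otimes>\<^sub>M borel)"
    by measurable
  have "insert k {0..<k} = {0..<Suc k}" by auto
  then show "(\<lambda>(\<omega>, a). fun_upd \<omega> k a) \<in> controls_space k \<Otimes>\<^sub>M (borel \<Otimes>\<^sub>M borel) \<rightarrow>\<^sub>M controls_space (Suc k)"
    using measurable_add_dim[of k "{0..<k}" "\<lambda>_. borel"] by (simp add: borel_prod)
qed

lemma control_law_in_space: "k \<le> N \<Longrightarrow> law k \<in> space (prob_algebra (controls_space k))"
proof (induction k)
  case 0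
  then show ?case
    by (simp add: space_prob_algebra prob_space_return space_PiM)
next
  case (Suc k)
  then have "law k \<in> space (prob_algebra (controls_space k))" by simp
  then show ?case
    using sets_bind'[OF _ measurable_pair_kernel] prob_space_bind'[OF _ measurable_pair_kernel] Suc.prems
    by (simp add: space_prob_algebra)
qed

lemma sets_control_law [measurable_cong]: "k \<le> N \<Longrightarrow> sets (law k) = sets (controls_space k)"
  and prob_space_control_law: "k \<le> N \<Longrightarrow> prob_space (law k)"
  using control_law_in_space by (auto simp: space_prob_algebra)

text \<open>Tower property: condition on the first \<open>k\<close> pairs, then average over the new
  one. Nonnegative integrals postpone every question of integrability.\<close>

lemma nn_integral_control_law_Suc:
  assumes "k < N" and [measurable]: "f \<in> borel_measurable (controls_space (Suc k))"
  shows "(\<integral>\<^sup>+\<omega>. f \<omega> \<partial>law (Suc k))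
    = (\<integral>\<^sup>+\<omega>. \<integral>\<^sup>+a. f (fun_upd \<omega> k a) \<partial>(\<mu> k (state k \<omega>) \<Otimes>\<^sub>M \<nu> k (state k \<omega>)) \<partial>law k)"
proof -
  let ?K = "\<lambda>\<omega>. distr (\<mu> k (state k \<omega>) \<Otimes>\<^sub>M \<nu> k (state k \<omega>)) (controls_space (Suc k)) (fun_upd \<omega> k)"
  have K: "?K \<in> law k \<rightarrow>\<^sub>M subprob_algebra (controls_space (Suc k))"
    using measurable_prob_algebraD[OF measurable_pair_kernel[OF assms(1)]] sets_control_law[of k] assms(1)
    by (simp cong: measurable_cong_sets)
  have sp: "space (law k) = space (controls_space k)"
    using sets_eq_imp_space_eq[OF sets_control_law[of k]] assms(1) by simp
  have "(\<integral>\<^sup>+\<omega>. f \<omega> \<partial>law (Suc k)) = (\<integral>\<^sup>+\<omega>. \<integral>\<^sup>+\<omega>'. f \<omega>' \<partial>?K \<omega> \<partial>law k)"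
    using nn_integral_bind[OF assms(2) K] by simp
  also have "\<dots> = (\<integral>\<^sup>+\<omega>. \<integral>\<^sup>+a. f (fun_upd \<omega> k a) \<partial>(\<mu> k (state k \<omega>) \<Otimes>\<^sub>M \<nu> k (state k \<omega>)) \<partial>law k)"
  proof (intro nn_integral_cong)
    fix \<omega> assume "\<omega> \<in> space (law k)"
    then have \<omega>: "\<omega> \<in> space (controls_space k)" by (simp add: sp)
    have "insert k {0..<k} = {0..<Suc k}" by auto
    then have "(\<lambda>(\<omega>, a). fun_upd \<omega> k a) \<in> controls_space k \<Otimes>\<^sub>M (borel \<Otimes>\<^sub>M borel) \<rightarrow>\<^sub>M controls_space (Suc k)"
      using measurable_add_dim[of k "{0..<k}" "\<lambda>_. borel"] by (simp add: borel_prod)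
    then have "(\<lambda>a. fun_upd \<omega> k a) \<in> (borel \<Otimes>\<^sub>M borel) \<rightarrow>\<^sub>M controls_space (Suc k)"
      using measurable_Pair2[OF _ \<omega>, of "\<lambda>(\<omega>, a). fun_upd \<omega> k a"] by (simp only: case_prod_conv)
    moreover have "sets (\<mu> k (state k \<omega>) \<Otimes>\<^sub>M \<nu> k (state k \<omega>)) = sets (borel \<Otimes>\<^sub>M borel)"
      using sets_strategy1[OF assms(1)] sets_strategy2[OF assms(1)] by (intro sets_pair_measure_cong) auto
    ultimately have "fun_upd \<omega> k \<in> (\<mu> k (state k \<omega>) \<Otimes>\<^sub>M \<nu> k (state k \<omega>)) \<rightarrow>\<^sub>M controls_space (Suc k)"
      by (simp cong: measurable_cong_sets)
    then show "(\<integral>\<^sup>+\<omega>'. f \<omega>' \<partial>?K \<omega>) = (\<integral>\<^sup>+a. f (fun_upd \<omega> k a) \<partial>(\<mu> k (state k \<omega>) \<Otimes>\<^sub>M \<nu> k (state k \<omega>)))"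
      using assms(2) by (simp add: nn_integral_distr)
  qed
  finally show ?thesis .
qed

text \<open>The kernel has total mass 1, so averaging over a pair that the integrand ignores changes
  nothing.\<close>

lemma nn_integral_control_law_past:
  assumes "k < N" and "f \<in> borel_measurable (controls_space (Suc k))"
    and "\<And>\<omega> a. f (fun_upd \<omega> k a) = f \<omega>"
  shows "(\<integral>\<^sup>+\<omega>. f \<omega> \<partial>law (Suc k)) = (\<integral>\<^sup>+\<omega>. f \<omega> \<partial>law k)"
proof -
  have "prob_space (\<mu> k x \<Otimes>\<^sub>M \<nu> k x)" for x
    using prob_space_strategy1[OF assms(1)] prob_space_strategy2[OF assms(1)] by (rule prob_space_pair)
  then show ?thesis
    unfolding nn_integral_control_law_Suc[OF assms(1,2)] assms(3)
    by (simp add: prob_space.emeasure_space_1)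
qed

text \<open>The integrand splits into a part in \<open>u\<close> and a part in \<open>v\<close>, so
  Fubini leaves the two conditional expectations, each at most a multiple of the squared
  state.\<close>

lemma nn_integral_control_law_step_le:
  assumes "k < N"
    and \<phi> [measurable]: "case_prod \<phi> \<in> borel_measurable borel" and \<psi> [measurable]: "case_prod \<psi> \<in> borel_measurable borel"
    and \<phi>_le: "\<And>x. (\<integral>\<^sup>+u. \<phi> x u \<partial>\<mu> k x) \<le> p * ennreal ((norm x)\<^sup>2)"
    and \<psi>_le: "\<And>x. (\<integral>\<^sup>+v. \<psi> x v \<partial>\<nu> k x) \<le> q * ennreal ((norm x)\<^sup>2)"
  shows "(\<integral>\<^sup>+\<omega>. \<phi> (state k \<omega>) (fst (\<omega> k)) + \<psi> (state k \<omega>) (snd (\<omega> k)) \<partial>law (Suc k))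
    \<le> (p + q) * (\<integral>\<^sup>+\<omega>. ennreal ((norm (state k \<omega>))\<^sup>2) \<partial>law k)"
proof -
  note [measurable_cong] = sets_strategy1[OF assms(1)] sets_strategy2[OF assms(1)]
  have m: "(\<lambda>\<omega>. \<phi> (state k \<omega>) (fst (\<omega> k)) + \<psi> (state k \<omega>) (snd (\<omega> k))) \<in> borel_measurable (controls_space (Suc k))"
    by (intro borel_measurable_add borel_measurable_case_prod_compose[OF \<phi>]
        borel_measurable_case_prod_compose[OF \<psi>] measurable_sampled_state measurable_control_fst
        measurable_control_snd) auto
  have pair: "(\<integral>\<^sup>+a. \<phi> x (fst a) + \<psi> x (snd a) \<partial>(\<mu> k x \<Otimes>\<^sub>M \<nu> k x)) \<le> (p + q) * ennreal ((norm x)\<^sup>2)" for x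
  proof -
    interpret \<mu>: prob_space "\<mu> k x" using prob_space_strategy1[OF assms(1)] .
    interpret \<nu>: prob_space "\<nu> k x" using prob_space_strategy2[OF assms(1)] .
    have [measurable]: "\<phi> x \<in> borel_measurable borel" "\<psi> x \<in> borel_measurable borel"
      using borel_measurable_case_prod_compose[OF \<phi>, of "\<lambda>_. x" borel "\<lambda>u. u"]
        borel_measurable_case_prod_compose[OF \<psi>, of "\<lambda>_. x" borel "\<lambda>u. u"] by simp_all
    have "(\<integral>\<^sup>+a. \<phi> x (fst a) + \<psi> x (snd a) \<partial>(\<mu> k x \<Otimes>\<^sub>M \<nu> k x))
        = (\<integral>\<^sup>+u. \<integral>\<^sup>+v. \<phi> x u + \<psi> x v \<partial>\<nu> k x \<partial>\<mu> k x)"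
      by (subst \<nu>.nn_integral_fst[symmetric]) auto
    also have "\<dots> = (\<integral>\<^sup>+u. \<phi> x u \<partial>\<mu> k x) + (\<integral>\<^sup>+v. \<psi> x v \<partial>\<nu> k x)"
      by (simp add: nn_integral_add \<mu>.emeasure_space_1 \<nu>.emeasure_space_1)
    also have "\<dots> \<le> (p + q) * ennreal ((norm x)\<^sup>2)"
      using add_mono[OF \<phi>_le[of x] \<psi>_le[of x]] by (simp add: distrib_right)
    finally show ?thesis .
  qed
  have "(\<integral>\<^sup>+\<omega>. \<phi> (state k \<omega>) (fst (\<omega> k)) + \<psi> (state k \<omega>) (snd (\<omega> k)) \<partial>law (Suc k))
      \<le> (\<integral>\<^sup>+\<omega>. (p + q) * ennreal ((norm (state k \<omega>))\<^sup>2) \<partial>law k)"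
    unfolding nn_integral_control_law_Suc[OF assms(1) m]
    by (intro nn_integral_mono) (use pair in simp)
  also have "\<dots> = (p + q) * (\<integral>\<^sup>+\<omega>. ennreal ((norm (state k \<omega>))\<^sup>2) \<partial>law k)"
    using sets_control_law[of k] assms(1) measurable_sampled_state[of k k G \<tau>]
    by (intro nn_integral_cmult) (simp cong: measurable_cong_sets)
  finally show ?thesis .
qed

end

section \<open>Second moments of the state, uniformly over partitions\<close>

lemma norm_sum_sq_le: "(norm (x + y))\<^sup>2 \<le> 2 * (norm x)\<^sup>2 + 2 * (norm y)\<^sup>2" for x y :: "'a::real_inner"
proof -
  have "0 \<le> (norm (x - y))\<^sup>2" by simp
  then show ?thesis
    by (simp add: power2_norm_eq_inner inner_add_left inner_add_right inner_diff_left inner_diff_right inner_commute)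
qed

lemma norm_matrix_vector_sq_le: "(norm (M *v x))\<^sup>2 \<le> (norm M)\<^sup>2 * (norm x)\<^sup>2" for M :: "real ^ 'n ^ 'm"
  using norm_matrix_vector_le[of M x] by (simp add: power_mono flip: power_mult_distrib)

lemma norm_control_input_sq_le:
  "(norm (control_input G a))\<^sup>2
    \<le> 2 * (norm (mat_B1 G))\<^sup>2 * (norm (fst a))\<^sup>2 + 2 * (norm (mat_B2 G))\<^sup>2 * (norm (snd a))\<^sup>2"
  using norm_sum_sq_le[of "mat_B1 G *v fst a" "mat_B2 G *v snd a"]
    norm_matrix_vector_sq_le[of "mat_B1 G" "fst a"] norm_matrix_vector_sq_le[of "mat_B2 G" "snd a"]
  unfolding control_input_def by linarith

text \<open>The factor in front of \<open>(norm b)\<^sup>2\<close> is of order \<open>s\<close>. A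
  factor of order 1 would compound over the steps to a bound that depends on their number.\<close>

lemma affine_flow_norm_sq_le:
  assumes "0 \<le> s"
  shows "(norm (affine_flow A b x s))\<^sup>2
    \<le> exp ((2 * norm A + 1) * s) * (norm x)\<^sup>2 + (exp ((2 * norm A + 1) * s) - 1) * (norm b)\<^sup>2"
  using affine_ode_energy[OF affine_flow_deriv assms, of A b x] by (simp add: algebra_simps)

lemma affine_flow_norm_sq_le_unit:
  assumes "0 \<le> s" "s \<le> 1"
  shows "(norm (affine_flow A b x s))\<^sup>2 \<le> exp (2 * norm A + 1) * ((norm x)\<^sup>2 + (norm b)\<^sup>2)"
proof -
  have "exp ((2 * norm A + 1) * s) \<le> exp (2 * norm A + 1)"
    using assms by (simp add: mult_left_le)
  then have "exp ((2 * norm A + 1) * s) * ((norm x)\<^sup>2 + (norm b)\<^sup>2) \<le> exp (2 * norm A + 1) * ((norm x)\<^sup>2 + (norm b)\<^sup>2)"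
    by (intro mult_right_mono) auto
  moreover have "(norm (affine_flow A b x s))\<^sup>2 \<le> exp ((2 * norm A + 1) * s) * ((norm x)\<^sup>2 + (norm b)\<^sup>2)"
    using affine_ode_energy[OF affine_flow_deriv assms(1), of A b x]
    by (smt (verit) affine_flow_0 zero_le_power2)
  ultimately show ?thesis by linarith
qed

text \<open>The energy estimate bounds the velocity \<open>A *v y + b\<close> on a unit time
  interval, and the mean value inequality turns this into a displacement of order
  \<open>s\<close>.\<close>

lemma affine_flow_increment:
  assumes "0 \<le> s" "s \<le> 1"
  shows "(norm (affine_flow A b x s - x))\<^sup>2
    \<le> s\<^sup>2 * ((2 * (norm A)\<^sup>2 * exp (2 * norm A + 1) + 2) * ((norm x)\<^sup>2 + (norm b)\<^sup>2))"
proof -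
  let ?K = "(2 * (norm A)\<^sup>2 * exp (2 * norm A + 1) + 2) * ((norm x)\<^sup>2 + (norm b)\<^sup>2)"
  let ?y = "affine_flow A b x"
  have bound: "norm (A *v ?y t + b) \<le> sqrt ?K" if "t \<in> {0..s}" for t
  proof -
    have "(norm (A *v ?y t + b))\<^sup>2 \<le> 2 * ((norm A)\<^sup>2 * (norm (?y t))\<^sup>2) + 2 * (norm b)\<^sup>2"
      using norm_sum_sq_le[of "A *v ?y t" b] norm_matrix_vector_sq_le[of A "?y t"] by linarith
    also have "\<dots> \<le> 2 * ((norm A)\<^sup>2 * (exp (2 * norm A + 1) * ((norm x)\<^sup>2 + (norm b)\<^sup>2))) + 2 * ((norm x)\<^sup>2 + (norm b)\<^sup>2)"
      using that assms by (intro add_mono mult_left_mono affine_flow_norm_sq_le_unit) auto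
    also have "\<dots> = ?K" by (simp add: algebra_simps)
    finally show ?thesis by (rule real_le_rsqrt)
  qed
  have "norm (?y s - ?y 0) \<le> sqrt ?K * norm (s - 0)"
  proof (rule differentiable_bound[of "{0..s}"])
    show "(?y has_derivative (\<lambda>h. h *\<^sub>R (A *v ?y t + b))) (at t within {0..s})" for t
      using affine_flow_deriv[of A b x t] has_vector_derivative_at_within
      unfolding has_vector_derivative_def by blast
    show "onorm (\<lambda>h. h *\<^sub>R (A *v ?y t + b)) \<le> sqrt ?K" if "t \<in> {0..s}" for t
      using bound[OF that] by (simp add: onorm_scaleR_left onorm_id)
  qed (use assms in auto)
  then have "(norm (?y s - x))\<^sup>2 \<le> (sqrt ?K * s)\<^sup>2"
    using assms(1) by (intro power_mono) auto
  then show ?thesis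
    by (simp add: power_mult_distrib mult.commute)
qed

text \<open>Replaces the growth factor of one step by an exponential that is linear in
  \<open>h\<close> in its exponent, so that the product over all steps depends only on the total
  time.\<close>

lemma exp_growth_step:
  fixes c \<kappa> h :: real
  assumes "0 \<le> c" "0 \<le> \<kappa>" "0 \<le> h" "h \<le> 1"
  shows "exp (c * h) + (exp (c * h) - 1) * \<kappa> \<le> exp ((1 + \<kappa>) * c * exp c * h)"
proof -
  \<comment> \<open>Multiplied by \<open>exp (c * h)\<close> this becomes
    \<open>exp x - 1 \<le> x * exp x\<close> for \<open>x = c * h\<close>, which shows that the
    growth over one step is of order \<open>h\<close>.\<close>
  have "1 - c * h \<le> exp (- (c * h))"
    using exp_ge_add_one_self[of "- (c * h)"] by simp
  then have "(1 - c * h) * exp (c * h) \<le> exp (- (c * h)) * exp (c * h)"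
    by (rule mult_right_mono) simp
  then have "exp (c * h) - 1 \<le> c * h * exp (c * h)"
    by (simp add: algebra_simps exp_minus)
  also have "\<dots> \<le> c * h * exp c"
    using assms by (intro mult_left_mono) (auto simp: mult_left_le)
  finally have "(1 + \<kappa>) * (exp (c * h) - 1) \<le> (1 + \<kappa>) * (c * h * exp c)"
    using assms by (intro mult_left_mono) auto
  moreover have "1 + (1 + \<kappa>) * c * exp c * h \<le> exp ((1 + \<kappa>) * c * exp c * h)"
    by (rule exp_ge_add_one_self)
  moreover have "exp (c * h) + (exp (c * h) - 1) * \<kappa> = 1 + (1 + \<kappa>) * (exp (c * h) - 1)"
    "(1 + \<kappa>) * (c * h * exp c) = (1 + \<kappa>) * c * exp c * h"
    by (simp_all add: algebra_simps)
  ultimately show ?thesis by linarith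
qed

text \<open>The rate of \<open>exp_growth_step\<close>, where \<open>c\<close> is the constant of
  the energy estimate and \<open>\<kappa>\<close> the factor by which admissibility bounds the
  conditional second moment of \<open>control_input\<close> in terms of the squared state.\<close>

definition growth_rate :: "('d::finite, 'p::finite, 'q::finite) lq_game \<Rightarrow> real \<Rightarrow> real \<Rightarrow> real" where
  "growth_rate G \<gamma> \<gamma>' =
    (1 + (2 * (norm (mat_B1 G))\<^sup>2 * \<gamma>\<^sup>2 + 2 * (norm (mat_B2 G))\<^sup>2 * \<gamma>'\<^sup>2))
      * (2 * norm (mat_A G) + 1) * exp (2 * norm (mat_A G) + 1)"

lemma growth_rate_nonneg: "0 \<le> growth_rate G \<gamma> \<gamma>'"
  by (simp add: growth_rate_def add_nonneg_nonneg)

lemma nn_integral_const_add_le: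
  assumes "prob_space M" "sets M = sets borel" "0 \<le> a" "0 \<le> b"
    and "(\<integral>\<^sup>+u. ennreal ((norm u)\<^sup>2) \<partial>M) \<le> ennreal c" "0 \<le> c"
  shows "(\<integral>\<^sup>+u. ennreal (a + b * (norm u)\<^sup>2) \<partial>M) \<le> ennreal (a + b * c)"
proof -
  interpret prob_space M by fact
  note [measurable_cong] = assms(2)
  have "(\<integral>\<^sup>+u. ennreal (a + b * (norm u)\<^sup>2) \<partial>M) = (\<integral>\<^sup>+u. ennreal a + ennreal b * ennreal ((norm u)\<^sup>2) \<partial>M)"
    using assms by (simp add: ennreal_plus ennreal_mult)
  also have "\<dots> = ennreal a + ennreal b * (\<integral>\<^sup>+u. ennreal ((norm u)\<^sup>2) \<partial>M)"
    by (simp add: nn_integral_add nn_integral_cmult emeasure_space_1)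
  also have "\<dots> \<le> ennreal a + ennreal b * ennreal c"
    using assms by (intro add_left_mono mult_left_mono) auto
  also have "\<dots> = ennreal (a + b * c)"
    using assms by (simp add: ennreal_plus ennreal_mult)
  finally show ?thesis .
qed

context mixed_play
begin

lemma state_second_moment_step:
  assumes k: "k < N" and h: "0 \<le> \<tau> (Suc k) - \<tau> k" "\<tau> (Suc k) - \<tau> k \<le> 1"
  shows "(\<integral>\<^sup>+\<omega>. ennreal ((norm (state (Suc k) \<omega>))\<^sup>2) \<partial>law (Suc k))
    \<le> ennreal (exp (growth_rate G \<gamma> \<gamma>' * (\<tau> (Suc k) - \<tau> k))) * (\<integral>\<^sup>+\<omega>. ennreal ((norm (state k \<omega>))\<^sup>2) \<partial>law k)"
proof -
  define h where "h = \<tau> (Suc k) - \<tau> k"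
  define c where "c = 2 * norm (mat_A G) + 1"
  define e where "e = exp (c * h)"
  define b1 where "b1 = 2 * (norm (mat_B1 G))\<^sup>2"
  define b2 where "b2 = 2 * (norm (mat_B2 G))\<^sup>2"
  have nn: "0 \<le> c" "0 \<le> b1" "0 \<le> b2" "0 \<le> h" "h \<le> 1"
    using assms by (auto simp: c_def b1_def b2_def h_def)
  then have e: "1 \<le> e" by (simp add: e_def)
  \<comment> \<open>The whole state term goes into \<open>\<phi>\<close>. The summand 0 in
    \<open>\<psi>\<close> only produces the shape expected by
    \<open>nn_integral_const_add_le\<close>.\<close>
  define \<phi> where "\<phi> = (\<lambda>(x::real^'d) (u::real^'p). ennreal (e * (norm x)\<^sup>2 + (e - 1) * b1 * (norm u)\<^sup>2))"
  define \<psi> where "\<psi> = (\<lambda>(x::real^'d) (v::real^'q). ennreal (0 + (e - 1) * b2 * (norm v)\<^sup>2))"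
  have "(\<integral>\<^sup>+\<omega>. ennreal ((norm (state (Suc k) \<omega>))\<^sup>2) \<partial>law (Suc k))
      \<le> (\<integral>\<^sup>+\<omega>. \<phi> (state k \<omega>) (fst (\<omega> k)) + \<psi> (state k \<omega>) (snd (\<omega> k)) \<partial>law (Suc k))"
  proof (rule nn_integral_mono)
    fix \<omega>
    let ?b = "control_input G (\<omega> k)"
    have "(norm (state (Suc k) \<omega>))\<^sup>2 \<le> e * (norm (state k \<omega>))\<^sup>2 + (e - 1) * (norm ?b)\<^sup>2"
      using affine_flow_norm_sq_le[of h "mat_A G" ?b "state k \<omega>"] nn by (simp add: e_def c_def h_def)
    also have "\<dots> \<le> e * (norm (state k \<omega>))\<^sup>2 + (e - 1) * (b1 * (norm (fst (\<omega> k)))\<^sup>2 + b2 * (norm (snd (\<omega> k)))\<^sup>2)"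
      using norm_control_input_sq_le[of G "\<omega> k"] e by (intro add_left_mono mult_left_mono) (auto simp: b1_def b2_def)
    also have "\<dots> = (e * (norm (state k \<omega>))\<^sup>2 + (e - 1) * b1 * (norm (fst (\<omega> k)))\<^sup>2) + (0 + (e - 1) * b2 * (norm (snd (\<omega> k)))\<^sup>2)"
      by (simp add: algebra_simps)
    finally show "ennreal ((norm (state (Suc k) \<omega>))\<^sup>2) \<le> \<phi> (state k \<omega>) (fst (\<omega> k)) + \<psi> (state k \<omega>) (snd (\<omega> k))"
      unfolding \<phi>_def \<psi>_def using e nn
      by (subst ennreal_plus[symmetric]) (auto intro!: ennreal_leI add_nonneg_nonneg simp del: ennreal_plus)
  qed
  also have "\<dots> \<le> (ennreal (e + (e - 1) * b1 * \<gamma>\<^sup>2) + ennreal ((e - 1) * b2 * \<gamma>'\<^sup>2))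
      * (\<integral>\<^sup>+\<omega>. ennreal ((norm (state k \<omega>))\<^sup>2) \<partial>law k)"
  proof (rule nn_integral_control_law_step_le[OF k])
    show "case_prod \<phi> \<in> borel_measurable borel"
      unfolding \<phi>_def case_prod_beta
      by (intro measurable_compose[OF _ measurable_ennreal] borel_measurable_continuous_onI continuous_intros)
    show "case_prod \<psi> \<in> borel_measurable borel"
      unfolding \<psi>_def case_prod_beta
      by (intro measurable_compose[OF _ measurable_ennreal] borel_measurable_continuous_onI continuous_intros)
    fix x :: "real ^ 'd"
    have "(\<integral>\<^sup>+u. \<phi> x u \<partial>\<mu> k x) \<le> ennreal (e * (norm x)\<^sup>2 + (e - 1) * b1 * (\<gamma>\<^sup>2 * (norm x)\<^sup>2))"
      unfolding \<phi>_def using e nn second_moment1[OF k, of x]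
      by (intro nn_integral_const_add_le prob_space_strategy1 sets_strategy1 k) auto
    also have "\<dots> = ennreal (e + (e - 1) * b1 * \<gamma>\<^sup>2) * ennreal ((norm x)\<^sup>2)"
      using e nn by (subst ennreal_mult[symmetric]) (auto simp: distrib_right mult.assoc)
    finally show "(\<integral>\<^sup>+u. \<phi> x u \<partial>\<mu> k x) \<le> ennreal (e + (e - 1) * b1 * \<gamma>\<^sup>2) * ennreal ((norm x)\<^sup>2)" .
    have "(\<integral>\<^sup>+v. \<psi> x v \<partial>\<nu> k x) \<le> ennreal (0 + (e - 1) * b2 * (\<gamma>'\<^sup>2 * (norm x)\<^sup>2))"
      unfolding \<psi>_def using e nn second_moment2[OF k, of x]
      by (intro nn_integral_const_add_le prob_space_strategy2 sets_strategy2 k) auto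
    also have "\<dots> = ennreal ((e - 1) * b2 * \<gamma>'\<^sup>2) * ennreal ((norm x)\<^sup>2)"
      using e nn by (subst ennreal_mult[symmetric]) (auto simp: distrib_right mult.assoc)
    finally show "(\<integral>\<^sup>+v. \<psi> x v \<partial>\<nu> k x) \<le> ennreal ((e - 1) * b2 * \<gamma>'\<^sup>2) * ennreal ((norm x)\<^sup>2)" .
  qed
  also have "ennreal (e + (e - 1) * b1 * \<gamma>\<^sup>2) + ennreal ((e - 1) * b2 * \<gamma>'\<^sup>2)
      = ennreal (e + (e - 1) * (b1 * \<gamma>\<^sup>2 + b2 * \<gamma>'\<^sup>2))"
    using e nn by (subst ennreal_plus[symmetric]) (auto simp: distrib_left mult.assoc simp del: ennreal_plus)
  also have "\<dots> \<le> ennreal (exp (growth_rate G \<gamma> \<gamma>' * h))"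
    using exp_growth_step[of c "b1 * \<gamma>\<^sup>2 + b2 * \<gamma>'\<^sup>2" h] nn
    by (intro ennreal_leI) (auto simp: e_def growth_rate_def c_def b1_def b2_def)
  finally show ?thesis
    by (simp add: h_def mult_right_mono)
qed

text \<open>The exponents of the single steps are proportional to their lengths and add up to the
  elapsed time, so the number of steps disappears.\<close>

lemma state_second_moment:
  assumes h: "\<And>k. k < N \<Longrightarrow> 0 \<le> \<tau> (Suc k) - \<tau> k \<and> \<tau> (Suc k) - \<tau> k \<le> 1"
  shows "k \<le> N \<Longrightarrow> (\<integral>\<^sup>+\<omega>. ennreal ((norm (state k \<omega>))\<^sup>2) \<partial>law k)
    \<le> ennreal (exp (growth_rate G \<gamma> \<gamma>' * (\<tau> k - \<tau> 0)) * (norm (x_init G))\<^sup>2)"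
proof (induction k)
  case 0
  then show ?case
    using prob_space_control_law[of 0] by (simp add: prob_space.emeasure_space_1 del: control_law.simps)
next
  case (Suc k)
  then have "(\<integral>\<^sup>+\<omega>. ennreal ((norm (state (Suc k) \<omega>))\<^sup>2) \<partial>law (Suc k))
      \<le> ennreal (exp (growth_rate G \<gamma> \<gamma>' * (\<tau> (Suc k) - \<tau> k))) * ennreal (exp (growth_rate G \<gamma> \<gamma>' * (\<tau> k - \<tau> 0)) * (norm (x_init G))\<^sup>2)"
    using h[of k] by (intro order_trans[OF state_second_moment_step] mult_left_mono) auto
  also have "\<dots> = ennreal (exp (growth_rate G \<gamma> \<gamma>' * (\<tau> (Suc k) - \<tau> 0)) * (norm (x_init G))\<^sup>2)"
  proof -
    have "growth_rate G \<gamma> \<gamma>' * (\<tau> (Suc k) - \<tau> 0)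
        = growth_rate G \<gamma> \<gamma>' * (\<tau> (Suc k) - \<tau> k) + growth_rate G \<gamma> \<gamma>' * (\<tau> k - \<tau> 0)"
      by (simp add: algebra_simps)
    then show ?thesis
      by (subst ennreal_mult[symmetric]) (simp_all only: exp_add mult.assoc exp_ge_zero zero_le_power2 mult_nonneg_nonneg)
  qed
  finally show ?case .
qed

text \<open>The induction has to move the law along with the sum: earlier summands do not see the
  newest pair and fall back to the shorter law, and the newest summand is controlled by the state
  moment.\<close>

lemma running_sum_expectation_le:
  fixes \<phi> :: "nat \<Rightarrow> real ^ 'd \<Rightarrow> real ^ 'p \<Rightarrow> ennreal" and \<psi> :: "nat \<Rightarrow> real ^ 'd \<Rightarrow> real ^ 'q \<Rightarrow> ennreal"
  assumes h: "\<And>k. k < N \<Longrightarrow> 0 \<le> \<tau> (Suc k) - \<tau> k \<and> \<tau> (Suc k) - \<tau> k \<le> 1"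
    and meas: "\<And>k. k < N \<Longrightarrow> case_prod (\<phi> k) \<in> borel_measurable borel"
      "\<And>k. k < N \<Longrightarrow> case_prod (\<psi> k) \<in> borel_measurable borel"
    and le: "\<And>k x. k < N \<Longrightarrow> (\<integral>\<^sup>+u. \<phi> k x u \<partial>\<mu> k x) \<le> ennreal p * ennreal ((norm x)\<^sup>2)"
      "\<And>k x. k < N \<Longrightarrow> (\<integral>\<^sup>+v. \<psi> k x v \<partial>\<nu> k x) \<le> ennreal q * ennreal ((norm x)\<^sup>2)"
    and nn: "0 \<le> p" "0 \<le> q"
  shows "n \<le> N \<Longrightarrow> (\<integral>\<^sup>+\<omega>. (\<Sum>k<n. ennreal (\<tau> (Suc k) - \<tau> k) *
        (\<phi> k (state k \<omega>) (fst (\<omega> k)) + \<psi> k (state k \<omega>) (snd (\<omega> k)))) \<partial>law n)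
    \<le> ennreal ((\<tau> n - \<tau> 0) * ((p + q) * (exp (growth_rate G \<gamma> \<gamma>' * (\<tau> n - \<tau> 0)) * (norm (x_init G))\<^sup>2)))"
proof (induction n)
  case (Suc n)
  define g where "g k \<omega> = \<phi> k (state k \<omega>) (fst (\<omega> k)) + \<psi> k (state k \<omega>) (snd (\<omega> k))" for k \<omega>
  define E where "E k = exp (growth_rate G \<gamma> \<gamma>' * (\<tau> k - \<tau> 0)) * (norm (x_init G))\<^sup>2" for k
  have mg: "g k \<in> borel_measurable (controls_space m)" if "k < m" "m \<le> N" for k m
    unfolding g_def using that meas[of k]
    by (intro borel_measurable_add borel_measurable_case_prod_compose[of "\<phi> k"]
        borel_measurable_case_prod_compose[of "\<psi> k"] measurable_sampled_state measurable_control_fst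
        measurable_control_snd) auto
  have n: "n < N" using Suc.prems by simp
  let ?h = "\<tau> (Suc n) - \<tau> n"
  have pos: "0 \<le> \<tau> n - \<tau> 0"
  proof -
    have "\<tau> 0 \<le> \<tau> j" if "j \<le> N" for j
      using that
    proof (induction j)
      case (Suc j)
      then show ?case using h[of j] by simp
    qed simp
    then show ?thesis using n by simp
  qed
  have ms: "(\<lambda>\<omega>. \<Sum>k<n. ennreal (\<tau> (Suc k) - \<tau> k) * g k \<omega>) \<in> borel_measurable (controls_space (Suc n))"
    using n by (intro borel_measurable_sum borel_measurable_times_ennreal mg borel_measurable_const) auto
  have "(\<integral>\<^sup>+\<omega>. (\<Sum>k<Suc n. ennreal (\<tau> (Suc k) - \<tau> k) * g k \<omega>) \<partial>law (Suc n))
      = (\<integral>\<^sup>+\<omega>. (\<Sum>k<n. ennreal (\<tau> (Suc k) - \<tau> k) * g k \<omega>) \<partial>law (Suc n))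
        + ennreal ?h * (\<integral>\<^sup>+\<omega>. g n \<omega> \<partial>law (Suc n))"
  proof -
    have s: "sets (law (Suc n)) = sets (controls_space (Suc n))"
      using sets_control_law[OF Suc.prems] .
    show ?thesis
      unfolding sum.lessThan_Suc using ms mg[of n "Suc n"] Suc.prems s
      by (subst nn_integral_add) (auto simp: nn_integral_cmult cong: measurable_cong_sets simp del: control_law.simps)
  qed
  also have "(\<integral>\<^sup>+\<omega>. (\<Sum>k<n. ennreal (\<tau> (Suc k) - \<tau> k) * g k \<omega>) \<partial>law (Suc n))
      = (\<integral>\<^sup>+\<omega>. (\<Sum>k<n. ennreal (\<tau> (Suc k) - \<tau> k) * g k \<omega>) \<partial>law n)"
    by (rule nn_integral_control_law_past[OF n ms]) (simp add: g_def)
  also have "\<dots> \<le> ennreal ((\<tau> n - \<tau> 0) * ((p + q) * E n))"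
    using Suc.IH n by (simp add: g_def E_def)
  also have "(\<integral>\<^sup>+\<omega>. g n \<omega> \<partial>law (Suc n)) \<le> (ennreal p + ennreal q) * (\<integral>\<^sup>+\<omega>. ennreal ((norm (state n \<omega>))\<^sup>2) \<partial>law n)"
    unfolding g_def by (rule nn_integral_control_law_step_le[OF n meas(1)[OF n] meas(2)[OF n] le(1)[OF n] le(2)[OF n]])
  also have "\<dots> \<le> (ennreal p + ennreal q) * ennreal (E n)"
    unfolding E_def using state_second_moment[OF h, of n] n by (intro mult_left_mono) auto
  finally have "(\<integral>\<^sup>+\<omega>. (\<Sum>k<Suc n. ennreal (\<tau> (Suc k) - \<tau> k) * g k \<omega>) \<partial>law (Suc n))
      \<le> ennreal ((\<tau> n - \<tau> 0) * ((p + q) * E n)) + ennreal ?h * ((ennreal p + ennreal q) * ennreal (E n))"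
    by (simp add: add_mono mult_left_mono)
  also have "\<dots> = ennreal ((\<tau> (Suc n) - \<tau> 0) * ((p + q) * E n))"
  proof -
    have "ennreal ?h * ((ennreal p + ennreal q) * ennreal (E n)) = ennreal (?h * ((p + q) * E n))"
      using nn h[OF n] by (simp add: ennreal_mult[symmetric] ennreal_plus[symmetric] E_def del: ennreal_plus)
    moreover have "(\<tau> (Suc n) - \<tau> 0) * ((p + q) * E n) = (\<tau> n - \<tau> 0) * ((p + q) * E n) + ?h * ((p + q) * E n)"
      by (simp only: distrib_right[symmetric]) simp
    moreover have "0 \<le> (p + q) * E n"
      using nn by (simp add: E_def)
    ultimately show ?thesis
      using pos h[OF n] by (simp only: ennreal_plus mult_nonneg_nonneg)
  qed
  \<comment> \<open>The moment bound increases with time, so its latest value may replace the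
    earlier one.\<close>
  also have "\<dots> \<le> ennreal ((\<tau> (Suc n) - \<tau> 0) * ((p + q) * E (Suc n)))"
    using nn pos h[OF n] growth_rate_nonneg[of G \<gamma> \<gamma>'] unfolding E_def
    by (intro ennreal_leI mult_left_mono mult_right_mono) (auto intro: mult_left_mono)
  finally show ?case by (simp add: g_def E_def)
qed simp

end

subsection \<open>Partitions\<close>

lemma time_partition_mono:
  assumes "time_partition a b N \<tau>" "i \<le> j" "j \<le> N"
  shows "\<tau> i \<le> \<tau> j"
  using assms(2,3)
proof (induction j rule: dec_induct)
  case (step m)
  then have "\<tau> m < \<tau> (Suc m)"
    using assms(1) by (auto simp: time_partition_def)
  then show ?case using step by simp
qed simp

lemma time_partition_bounds:
  assumes "time_partition a b N \<tau>" "k \<le> N"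
  shows "a \<le> \<tau> k" "\<tau> k \<le> b"
  using time_partition_mono[OF assms(1), of 0 k] time_partition_mono[OF assms(1), of k N] assms
  by (auto simp: time_partition_def)

lemma interval_index_eq:
  assumes part: "time_partition a b N \<tau>" and k: "k < N" and t: "\<tau> k \<le> t" "t < \<tau> (Suc k)"
  shows "interval_index N \<tau> t = k"
  unfolding interval_index_def
proof (rule Max_eqI)
  fix j assume j: "j \<in> {k. k < N \<and> \<tau> k \<le> t}"
  show "j \<le> k"
  proof (rule ccontr)
    assume "\<not> j \<le> k"
    then have "\<tau> (Suc k) \<le> \<tau> j"
      using time_partition_mono[OF part, of "Suc k" j] j by simp
    then show False using j t by simp
  qed
qed (use k t in auto)

lemma interval_index_end:
  assumes part: "time_partition a b N \<tau>"
  shows "interval_index N \<tau> b = N - 1"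
  unfolding interval_index_def
  using part time_partition_bounds[OF part]
  by (intro Max_eqI) (auto simp: time_partition_def)

lemma step_le_mesh:
  assumes "k < N"
  shows "\<tau> (Suc k) - \<tau> k \<le> mesh N \<tau>"
  unfolding mesh_def using assms by (intro Max_ge) auto

lemma mesh_pos:
  assumes "time_partition a b N \<tau>"
  shows "0 < mesh N \<tau>"
proof -
  have "0 < N" "\<tau> 0 < \<tau> (Suc 0)" using assms by (auto simp: time_partition_def)
  then show ?thesis using step_le_mesh[of 0 N \<tau>] by simp
qed

lemma time_partition_cover:
  assumes part: "time_partition a b N \<tau>" and "a \<le> t" "t < b"
  shows "\<exists>k<N. \<tau> k \<le> t \<and> t < \<tau> (Suc k)"
proof -
  have 0: "\<tau> 0 = a" "\<tau> N = b" using part by (auto simp: time_partition_def)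
  have "\<exists>k<n. \<tau> k \<le> t \<and> t < \<tau> (Suc k)" if "n \<le> N" "t < \<tau> n" for n
    using that
  proof (induction n)
    case (Suc n)
    then show ?case
      by (cases "t < \<tau> n") (auto intro: less_SucI)
  qed (use 0 assms in simp)
  then show ?thesis using 0 assms by auto
qed

lemma step_at_bounds:
  assumes part: "time_partition a b N \<tau>" and t: "a \<le> t" "t \<le> b"
  shows "0 < step_at N \<tau> t" "step_at N \<tau> t \<le> mesh N \<tau>"
proof -
  have N: "0 < N" using part by (simp add: time_partition_def)
  \<comment> \<open>The terminal time lies in no half-open interval and needs its own case.\<close>
  have "\<exists>k<N. interval_index N \<tau> t = k"
  proof (cases "t = b")
    case True
    then show ?thesis using interval_index_end[OF part] N by auto
  next
    case False
    then show ?thesis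
      using time_partition_cover[OF part t(1)] t interval_index_eq[OF part] by (metis less_le)
  qed
  then show "0 < step_at N \<tau> t" "step_at N \<tau> t \<le> mesh N \<tau>"
    using part step_le_mesh[of "interval_index N \<tau> t" N \<tau>]
    by (auto simp: step_at_def time_partition_def)
qed

subsection \<open>A priori bounds for the Riccati equation\<close>

text \<open>The constant \<open>r\<close> is a parameter because the bound serves twice:
  \<open>r = 0\<close> gives linear growth in \<open>P\<close> while \<open>P\<close> is not yet
  bounded, and the coercivity constant of \<open>mat_R2 G\<close> makes the multiplier vanish on
  fine partitions.\<close>

lemma lambda2_bounds:
  fixes G :: "('d::finite, 'p::finite, 'q::finite) lq_game"
  assumes part: "time_partition a b N \<tau>" and t: "a \<le> t" "t \<le> b" and sym: "transpose (P t) = P t"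
    and R2: "pos_def (mat_R2 G)" and r: "\<And>v. r * (norm v)\<^sup>2 \<le> v \<bullet> (mat_R2 G *v v)" "0 \<le> r"
  shows "0 \<le> lambda2 G N \<tau> P t"
    and "lambda2 G N \<tau> P t \<le> max 0 (mesh N \<tau> * (norm (mat_B2 G))\<^sup>2 * norm (P t) - r)"
proof -
  show "0 \<le> lambda2 G N \<tau> P t" by (simp add: lambda2_def)
  let ?s = "step_at N \<tau> t" and ?B = "mat_B2 G"
  let ?M = "?s *\<^sub>R (transpose ?B ** P t ** ?B) - mat_R2 G"
  have R2s: "transpose (mat_R2 G) = mat_R2 G" using R2 by (simp add: pos_def_def)
  have "transpose (transpose ?B ** P t ** ?B) = transpose ?B ** P t ** ?B"
    by (simp add: matrix_transpose_mul sym matrix_mul_assoc)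
  then have M: "transpose ?M = ?M"
    using R2s by (simp add: transpose_def vec_eq_iff)
  have "v \<bullet> (?M *v v) \<le> (mesh N \<tau> * (norm ?B)\<^sup>2 * norm (P t) - r) * (v \<bullet> v)" for v
  proof -
    have "v \<bullet> ((transpose ?B ** P t ** ?B) *v v) = (?B *v v) \<bullet> (P t *v (?B *v v))"
      using inner_transpose_mult[of v "transpose ?B" "P t *v (?B *v v)"]
      by (simp add: matrix_vector_mul_assoc matrix_mul_assoc)
    also have "\<dots> \<le> norm (?B *v v) * (norm (P t) * norm (?B *v v))"
      by (meson norm_cauchy_schwarz norm_matrix_vector_le mult_left_mono norm_ge_zero order_trans)
    also have "\<dots> = norm (P t) * (norm (?B *v v))\<^sup>2"
      by (simp add: power2_eq_square)
    also have "\<dots> \<le> norm (P t) * ((norm ?B)\<^sup>2 * (norm v)\<^sup>2)"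
      by (intro mult_left_mono norm_matrix_vector_sq_le) simp
    finally have "?s * (v \<bullet> ((transpose ?B ** P t ** ?B) *v v)) \<le> ?s * (norm (P t) * ((norm ?B)\<^sup>2 * (norm v)\<^sup>2))"
      using step_at_bounds[OF part t] by (intro mult_left_mono) auto
    also have "\<dots> \<le> mesh N \<tau> * (norm (P t) * ((norm ?B)\<^sup>2 * (norm v)\<^sup>2))"
      using step_at_bounds[OF part t] by (intro mult_right_mono) auto
    finally have "?s * (v \<bullet> ((transpose ?B ** P t ** ?B) *v v)) \<le> mesh N \<tau> * (norm ?B)\<^sup>2 * norm (P t) * (norm v)\<^sup>2"
      by (simp add: mult_ac)
    moreover have "v \<bullet> (?M *v v) = ?s * (v \<bullet> ((transpose ?B ** P t ** ?B) *v v)) - v \<bullet> (mat_R2 G *v v)"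
      by (simp only: matrix_vector_mult_diff_rdistrib scaleR_matrix_vector_assoc[symmetric] inner_diff_right inner_scaleR_right)
    moreover have "(mesh N \<tau> * (norm ?B)\<^sup>2 * norm (P t) - r) * (v \<bullet> v)
        = mesh N \<tau> * (norm ?B)\<^sup>2 * norm (P t) * (norm v)\<^sup>2 - r * (norm v)\<^sup>2"
      by (simp add: left_diff_distrib power2_norm_eq_inner)
    ultimately show ?thesis using r(1)[of v] by linarith
  qed
  then show "lambda2 G N \<tau> P t \<le> max 0 (mesh N \<tau> * (norm (mat_B2 G))\<^sup>2 * norm (P t) - r)"
    unfolding lambda2_def by (intro max.mono order_refl lambda_max_le[OF M])
qed

text \<open>The quadratic term of the Riccati equation is \<open>K\<^sup>T R K\<close> for the gain \<open>K = R\<^sup>-\<^sup>1 B\<^sup>T P\<close>, and the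
  capacity condition says exactly that \<open>K\<close> has operator norm at most \<open>\<gamma>\<close>.\<close>

lemma gain_bound:
  fixes P :: "real ^ 'd ^ 'd" and B :: "real ^ 'm ^ 'd"
  assumes P: "transpose P = P" and R: "pos_def R"
    and cap: "pos_semidef (mat (\<gamma>\<^sup>2) - P ** B ** (matrix_inv R ** matrix_inv R) ** transpose B ** P)"
    and "0 \<le> \<gamma>"
  shows "norm ((matrix_inv R ** transpose B ** P) *v x) \<le> \<gamma> * norm x"
    and "norm (P ** B ** matrix_inv R ** transpose B ** P) \<le> (real CARD('d) * \<gamma>)\<^sup>2 * norm R"
proof -
  let ?S = "matrix_inv R" and ?K = "matrix_inv R ** transpose B ** P"
  have S: "transpose ?S = ?S" "R ** ?S = mat 1" using matrix_inv_pos_def[OF R] by auto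
  have KT: "transpose ?K = P ** B ** ?S"
    by (simp add: matrix_transpose_mul S P matrix_mul_assoc)
  have bound: "norm (?K *v x) \<le> \<gamma> * norm x" for x
  proof -
    have "0 \<le> x \<bullet> ((mat (\<gamma>\<^sup>2) - P ** B ** (?S ** ?S) ** transpose B ** P) *v x)"
      using cap by (simp add: pos_semidef_def)
    also have "P ** B ** (?S ** ?S) ** transpose B ** P = transpose ?K ** ?K"
      by (simp add: KT matrix_mul_assoc)
    also have "x \<bullet> ((mat (\<gamma>\<^sup>2) - transpose ?K ** ?K) *v x) = \<gamma>\<^sup>2 * (norm x)\<^sup>2 - (norm (?K *v x))\<^sup>2"
      using inner_transpose_mult[of x "transpose ?K" "?K *v x"]
      by (simp add: matrix_vector_mult_diff_rdistrib inner_diff_right mat_mult_vec power2_norm_eq_inner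
          matrix_vector_mul_assoc)
    finally have "(norm (?K *v x))\<^sup>2 \<le> (\<gamma> * norm x)\<^sup>2"
      by (simp add: power_mult_distrib)
    then show ?thesis
      by (rule power2_le_imp_le) (simp add: \<open>0 \<le> \<gamma>\<close>)
  qed
  then show "norm (?K *v x) \<le> \<gamma> * norm x" .
  have "norm ?K \<le> real CARD('d) * \<gamma>" (is "_ \<le> ?c") using norm_matrix_le_of_bound[OF bound] .
  have "P ** B ** ?S ** transpose B ** P = P ** B ** ?S ** (R ** ?S) ** transpose B ** P"
    by (simp add: S)
  also have "\<dots> = transpose ?K ** R ** ?K"
    by (simp add: KT matrix_mul_assoc)
  also have "norm \<dots> \<le> norm (transpose ?K) * norm R * norm ?K"
    by (meson norm_matrix_mult_le mult_right_mono norm_ge_zero order_trans)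
  also have "\<dots> = (norm ?K)\<^sup>2 * norm R"
    by (simp add: norm_transpose power2_eq_square)
  also have "\<dots> \<le> ?c\<^sup>2 * norm R"
    using \<open>norm ?K \<le> ?c\<close> by (intro mult_right_mono power_mono) auto
  finally show "norm (P ** B ** ?S ** transpose B ** P) \<le> ?c\<^sup>2 * norm R" .
qed

lemma capacity_conditionsD:
  assumes "capacity_conditions G N \<tau> P" "t_init G \<le> t" "t \<le> t_end G"
  shows "pos_semidef (mat ((gam1 G)\<^sup>2) - P t ** mat_B1 G ** (matrix_inv (mat_R1 G) ** matrix_inv (mat_R1 G)) ** transpose (mat_B1 G) ** P t)"
    and "pos_semidef (mat ((gam2 G)\<^sup>2) - P t ** mat_B2 G
      ** (matrix_inv (mat_R2 G + mat (lambda2 G N \<tau> P t)) ** matrix_inv (mat_R2 G + mat (lambda2 G N \<tau> P t)))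
      ** transpose (mat_B2 G) ** P t)"
  using assms by (auto simp: capacity_conditions_def Let_def)

text \<open>Collects the bounds of the terms of \<open>riccati_rhs\<close>, with
  \<open>lambda2\<close> estimated by \<open>(norm (mat_B2 G))\<^sup>2 * norm (P t)\<close>, which
  is valid for mesh at most 1. The dimensions come from passing to Frobenius norms.\<close>

definition rhs_const :: "('d::finite, 'p::finite, 'q::finite) lq_game \<Rightarrow> real" where
  "rhs_const G = 2 * norm (mat_A G) + norm (mat_Q G)
    + (real CARD('d) * gam1 G)\<^sup>2 * norm (mat_R1 G)
    + (real CARD('d) * gam2 G)\<^sup>2 * (norm (mat_R2 G) + real CARD('q) * (norm (mat_B2 G))\<^sup>2)
    + real CARD('d) * (gam2 G)\<^sup>2 * (norm (mat_B2 G))\<^sup>2"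

text \<open>By \<open>gain_bound\<close> the first quadratic term is bounded by a constant. The
  second is bounded by a multiple of its weight, and this weight contains \<open>lambda2\<close>,
  hence may grow linearly in \<open>P\<close>.\<close>

lemma riccati_rhs_bound:
  fixes G :: "('d::finite, 'p::finite, 'q::finite) lq_game"
  assumes data: "lq_game_data G" and part: "time_partition (t_init G) (t_end G) N \<tau>"
    and mesh: "mesh N \<tau> \<le> 1" and cap: "capacity_conditions G N \<tau> P"
    and sym: "transpose (P t) = P t" and t: "t_init G \<le> t" "t \<le> t_end G"
  shows "norm (riccati_rhs G N \<tau> P t) \<le> rhs_const G * (1 + norm (P t))"
proof -
  let ?l = "lambda2 G N \<tau> P t" and ?p = "norm (P t)" and ?b = "(norm (mat_B2 G))\<^sup>2"
  have R: "pos_def (mat_R1 G)" "pos_def (mat_R2 G)" and g: "0 \<le> gam1 G" "0 \<le> gam2 G"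
    using data by (auto simp: lq_game_data_def)
  \<comment> \<open>Taken with \<open>r = 0\<close>: at this stage only linear growth of
    \<open>lambda2\<close> is wanted.\<close>
  have r: "0 * (norm v)\<^sup>2 \<le> v \<bullet> (mat_R2 G *v v)" for v
    using R(2) by (cases "v = 0") (auto simp: pos_def_def intro: less_imp_le)
  have l0: "0 \<le> ?l" and "?l \<le> max 0 (mesh N \<tau> * ?b * ?p - 0)"
    using lambda2_bounds[where P=P, OF part t sym R(2) r order_refl] by auto
  moreover have "mesh N \<tau> * ?b * ?p \<le> 1 * ?b * ?p"
    using mesh by (intro mult_right_mono) auto
  ultimately have l1: "?l \<le> ?b * ?p" by (auto simp: max_def split: if_splits)
  have R2l: "pos_def (mat_R2 G + mat ?l)"
    using R(2) l0 by (rule pos_def_add_mat)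
  let ?T1 = "P t ** mat_B1 G ** matrix_inv (mat_R1 G) ** transpose (mat_B1 G) ** P t"
  let ?T2 = "P t ** mat_B2 G ** matrix_inv (mat_R2 G + mat ?l) ** transpose (mat_B2 G) ** P t"
  let ?c1 = "(real CARD('d) * gam1 G)\<^sup>2" and ?c2 = "(real CARD('d) * gam2 G)\<^sup>2"
  have T1: "norm ?T1 \<le> ?c1 * norm (mat_R1 G)"
    using gain_bound(2)[OF sym R(1) capacity_conditionsD(1)[OF cap t] g(1)] .
  have "norm ?T2 \<le> ?c2 * norm (mat_R2 G + mat ?l)"
    using gain_bound(2)[OF sym R2l capacity_conditionsD(2)[OF cap t] g(2)] .
  also have "\<dots> \<le> ?c2 * (norm (mat_R2 G) + real CARD('q) * (?b * ?p))"
  proof (rule mult_left_mono)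
    have "norm (mat ?l :: real ^ 'q ^ 'q) \<le> real CARD('q) * (?b * ?p)"
      using norm_mat[of ?l, where 'n='q] l0 l1
      by (smt (verit) mult_left_mono of_nat_0_le_iff abs_of_nonneg)
    then show "norm (mat_R2 G + mat ?l) \<le> norm (mat_R2 G) + real CARD('q) * (?b * ?p)"
      using norm_triangle_ineq[of "mat_R2 G" "mat ?l"] by linarith
  qed simp
  finally have T2: "norm ?T2 \<le> ?c2 * norm (mat_R2 G) + ?c2 * real CARD('q) * ?b * ?p"
    by (simp add: algebra_simps)
  have T3: "norm (mat (?l * (gam2 G)\<^sup>2) :: real ^ 'd ^ 'd) \<le> real CARD('d) * (gam2 G)\<^sup>2 * ?b * ?p"
  proof -
    have "norm (mat (?l * (gam2 G)\<^sup>2) :: real ^ 'd ^ 'd) \<le> real CARD('d) * (?l * (gam2 G)\<^sup>2)"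
      using norm_mat[of "?l * (gam2 G)\<^sup>2", where 'n='d] l0 by simp
    also have "\<dots> \<le> real CARD('d) * (?b * ?p * (gam2 G)\<^sup>2)"
      using l1 by (intro mult_left_mono mult_right_mono) auto
    finally show ?thesis by (simp add: mult_ac)
  qed
  have T4: "norm (transpose (mat_A G) ** P t) \<le> norm (mat_A G) * ?p"
    "norm (P t ** mat_A G) \<le> norm (mat_A G) * ?p"
    using norm_matrix_mult_le[of "transpose (mat_A G)" "P t"] norm_matrix_mult_le[of "P t" "mat_A G"]
    by (auto simp: norm_transpose mult.commute)
  have "norm (riccati_rhs G N \<tau> P t) \<le> norm (transpose (mat_A G) ** P t) + norm (P t ** mat_A G)
      + norm (mat_Q G) + norm ?T1 + norm ?T2 + norm (mat (?l * (gam2 G)\<^sup>2) :: real ^ 'd ^ 'd)"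
    unfolding riccati_rhs_def
    by (intro norm_triangle_le add_mono norm_triangle_le_diff order_refl)
  also have "\<dots> \<le> norm (mat_A G) * ?p + norm (mat_A G) * ?p + norm (mat_Q G)
      + ?c1 * norm (mat_R1 G) + (?c2 * norm (mat_R2 G) + ?c2 * real CARD('q) * ?b * ?p)
      + real CARD('d) * (gam2 G)\<^sup>2 * ?b * ?p"
    by (intro add_mono T1 T2 T3 T4 order_refl)
  also have "\<dots> \<le> rhs_const G * (1 + ?p)"
  proof -
    define z1 where "z1 = ?c1 * norm (mat_R1 G)"
    define z2 where "z2 = ?c2 * norm (mat_R2 G)"
    define z3 where "z3 = ?c2 * real CARD('q) * ?b"
    define z4 where "z4 = real CARD('d) * (gam2 G)\<^sup>2 * ?b"
    have "rhs_const G = 2 * norm (mat_A G) + norm (mat_Q G) + z1 + (z2 + z3) + z4"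
      by (simp add: rhs_const_def z1_def z2_def z3_def z4_def distrib_left mult.assoc)
    moreover have "0 \<le> z1 * ?p" "0 \<le> z2 * ?p" "0 \<le> norm (mat_Q G) * ?p" "0 \<le> z3" "0 \<le> z4" "0 \<le> norm (mat_A G)"
      by (auto simp: z1_def z2_def z3_def z4_def)
    ultimately show ?thesis
      unfolding z1_def[symmetric] z2_def[symmetric] z3_def[symmetric] z4_def[symmetric]
      by (simp add: algebra_simps)
  qed
  finally show ?thesis .
qed

lemma rhs_const_nonneg: "0 \<le> rhs_const G"
  by (simp add: rhs_const_def add_nonneg_nonneg)

lemma riccati_solution_deriv:
  assumes "riccati_solution G N \<tau> P" "k < N" "\<tau> k < t" "t < \<tau> (Suc k)"
  shows "(P has_vector_derivative - riccati_rhs G N \<tau> P t) (at t)"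
proof -
  have "(P has_vector_derivative - riccati_rhs G N \<tau> P t) (at t within {\<tau> k..<\<tau> (Suc k)})"
    using assms by (auto simp: riccati_solution_def)
  moreover have "at t within {\<tau> k..<\<tau> (Suc k)} = at t"
    using assms by (intro at_within_interior) auto
  ultimately show ?thesis by simp
qed

text \<open>Gronwall for \<open>1 + (norm (P t))\<^sup>2\<close>. Its derivative is at most
  \<open>2 * norm (P t) * (rhs_const G * (1 + norm (P t)))\<close> in absolute value, and
  \<open>x * (1 + x) \<le> 2 * (1 + x\<^sup>2)\<close>, whence the factor 4. The summand 1 absorbs
  the part of the growth that does not depend on \<open>P\<close>.\<close>

definition riccati_bound :: "('d::finite, 'p::finite, 'q::finite) lq_game \<Rightarrow> real" where
  "riccati_bound G = sqrt (exp (4 * rhs_const G * (t_end G - t_init G)) * (1 + (norm (mat_QT G))\<^sup>2))"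

text \<open>Gronwall is applied on one partition interval at a time, where \<open>P\<close> is
  differentiable. The estimates are chained backwards from the terminal value; their exponents add
  up, so the number of intervals does not matter.\<close>

lemma riccati_solution_bounded:
  fixes G :: "('d::finite, 'p::finite, 'q::finite) lq_game"
  assumes data: "lq_game_data G" and part: "time_partition (t_init G) (t_end G) N \<tau>"
    and mesh: "mesh N \<tau> \<le> 1" and cap: "capacity_conditions G N \<tau> P"
    and sol: "riccati_solution G N \<tau> P" and t: "t_init G \<le> t" "t \<le> t_end G"
  shows "norm (P t) \<le> riccati_bound G"
proof -
  let ?c = "4 * rhs_const G"
  define f where "f t = 1 + (norm (P t))\<^sup>2" for t
  have sym: "transpose (P t) = P t" if "t_init G \<le> t" "t \<le> t_end G" for t
    using sol that by (auto simp: riccati_solution_def)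
  have contP: "continuous_on {t_init G..t_end G} P" and end_val: "P (t_end G) = mat_QT G"
    using sol by (auto simp: riccati_solution_def)
  have step: "f s \<le> exp (?c * (\<tau> (Suc k) - s)) * f (\<tau> (Suc k))"
    if k: "k < N" and s: "\<tau> k \<le> s" "s \<le> \<tau> (Suc k)" for k s
  proof (rule gronwall_deriv_ge[OF s(2)])
    have bd: "t_init G \<le> \<tau> k" "\<tau> (Suc k) \<le> t_end G"
      using time_partition_bounds[OF part] k by auto
    show "continuous_on {s..\<tau> (Suc k)} f"
      unfolding f_def using s bd
      by (intro continuous_intros continuous_on_subset[OF contP]) auto
    fix u assume u: "s < u" "u < \<tau> (Suc k)"
    have d: "(P has_vector_derivative - riccati_rhs G N \<tau> P u) (at u)"
      using riccati_solution_deriv[OF sol k] s u by simp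
    show "(f has_real_derivative 2 * (P u \<bullet> (- riccati_rhs G N \<tau> P u))) (at u)"
      unfolding f_def using DERIV_add[OF DERIV_const has_real_derivative_norm_sq[OF d]] by simp
    have "norm (riccati_rhs G N \<tau> P u) \<le> rhs_const G * (1 + norm (P u))"
      using u s bd by (intro riccati_rhs_bound[OF data part mesh cap] sym) auto
    then have "P u \<bullet> riccati_rhs G N \<tau> P u \<le> norm (P u) * (rhs_const G * (1 + norm (P u)))"
      by (meson norm_cauchy_schwarz mult_left_mono norm_ge_zero order_trans)
    also have "\<dots> \<le> rhs_const G * (2 * f u)"
    proof -
      have "norm (P u) * (1 + norm (P u)) \<le> 2 * f u"
        using sum_squares_bound[of 1 "norm (P u)"] zero_le_power2[of "norm (P u)"]
        unfolding f_def distrib_left power2_eq_square by linarith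
      then show ?thesis
        using mult_left_mono[OF _ rhs_const_nonneg[of G]] by (metis mult.left_commute)
    qed
    finally show "- ?c * f u \<le> 2 * (P u \<bullet> (- riccati_rhs G N \<tau> P u))"
      by simp
  qed
  have f_nn: "0 \<le> f u" for u by (simp add: f_def)
  \<comment> \<open>\<open>j\<close> counts the nodes from the right end, where \<open>P\<close> is
    prescribed.\<close>
  have nodes: "f (\<tau> (N - j)) \<le> exp (?c * (t_end G - \<tau> (N - j))) * f (t_end G)" if "j \<le> N" for j
    using that
  proof (induction j)
    case 0
    then show ?case using part by (simp add: time_partition_def)
  next
    case (Suc j)
    let ?k = "N - Suc j"
    have k: "?k < N" "Suc ?k = N - j" using Suc.prems by auto
    have "f (\<tau> ?k) \<le> exp (?c * (\<tau> (N - j) - \<tau> ?k)) * f (\<tau> (N - j))"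
      using step[OF k(1), of "\<tau> ?k"] time_partition_mono[OF part, of ?k "Suc ?k"] k by simp
    also have "\<dots> \<le> exp (?c * (\<tau> (N - j) - \<tau> ?k)) * (exp (?c * (t_end G - \<tau> (N - j))) * f (t_end G))"
      using Suc by (intro mult_left_mono) auto
    also have "\<dots> = exp (?c * (\<tau> (N - j) - \<tau> ?k) + ?c * (t_end G - \<tau> (N - j))) * f (t_end G)"
      by (simp only: exp_add mult.assoc)
    also have "?c * (\<tau> (N - j) - \<tau> ?k) + ?c * (t_end G - \<tau> (N - j)) = ?c * (t_end G - \<tau> ?k)"
      by (simp add: algebra_simps)
    finally show ?case .
  qed
  have "f t \<le> exp (?c * (t_end G - t)) * f (t_end G)"
  proof (cases "t = t_end G")
    case False
    then obtain k where k: "k < N" "\<tau> k \<le> t" "t < \<tau> (Suc k)"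
      using time_partition_cover[OF part t(1)] t by auto
    have "f t \<le> exp (?c * (\<tau> (Suc k) - t)) * f (\<tau> (Suc k))"
      using step[OF k(1,2)] k by simp
    also have "\<dots> \<le> exp (?c * (\<tau> (Suc k) - t)) * (exp (?c * (t_end G - \<tau> (Suc k))) * f (t_end G))"
      using nodes[of "N - Suc k"] k by (intro mult_left_mono) auto
    also have "\<dots> = exp (?c * (\<tau> (Suc k) - t) + ?c * (t_end G - \<tau> (Suc k))) * f (t_end G)"
      by (simp only: exp_add mult.assoc)
    also have "?c * (\<tau> (Suc k) - t) + ?c * (t_end G - \<tau> (Suc k)) = ?c * (t_end G - t)"
      by (simp add: algebra_simps)
    finally show ?thesis .
  qed simp
  also have "\<dots> \<le> exp (?c * (t_end G - t_init G)) * f (t_end G)"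
    using f_nn t rhs_const_nonneg[of G] by (intro mult_right_mono) (auto intro: mult_left_mono)
  finally have "(norm (P t))\<^sup>2 \<le> exp (?c * (t_end G - t_init G)) * (1 + (norm (mat_QT G))\<^sup>2)"
    by (simp add: f_def end_val)
  then show ?thesis
    unfolding riccati_bound_def by (rule real_le_rsqrt)
qed

text \<open>Closes the circle between \<open>P\<close> and the multiplier: once \<open>P\<close> is
  bounded, a mesh below a threshold fixed by the game data leaves the matrix under
  \<open>lambda_max\<close> without positive eigenvalues.\<close>

lemma lambda2_eq_0:
  fixes G :: "('d::finite, 'p::finite, 'q::finite) lq_game"
  assumes data: "lq_game_data G" and part: "time_partition (t_init G) (t_end G) N \<tau>"
    and mesh: "mesh N \<tau> \<le> 1" and cap: "capacity_conditions G N \<tau> P"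
    and sol: "riccati_solution G N \<tau> P" and t: "t_init G \<le> t" "t \<le> t_end G"
    and r: "\<And>v. r * (norm v)\<^sup>2 \<le> v \<bullet> (mat_R2 G *v v)" "0 \<le> r"
    and small: "mesh N \<tau> * ((norm (mat_B2 G))\<^sup>2 * riccati_bound G) \<le> r"
  shows "lambda2 G N \<tau> P t = 0"
proof -
  have sym: "transpose (P t) = P t" using sol t by (auto simp: riccati_solution_def)
  have R: "pos_def (mat_R2 G)" using data by (simp add: lq_game_data_def)
  have "mesh N \<tau> * ((norm (mat_B2 G))\<^sup>2 * norm (P t)) \<le> mesh N \<tau> * ((norm (mat_B2 G))\<^sup>2 * riccati_bound G)"
    using riccati_solution_bounded[OF data part mesh cap sol t] mesh_pos[OF part]
    by (intro mult_left_mono) auto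
  then have "mesh N \<tau> * (norm (mat_B2 G))\<^sup>2 * norm (P t) - r \<le> 0"
    using small by (simp add: mult.assoc)
  then show ?thesis
    using lambda2_bounds[where P=P, OF part t sym R r] by linarith
qed

lemma riccati_solution_lipschitz:
  fixes G :: "('d::finite, 'p::finite, 'q::finite) lq_game"
  assumes data: "lq_game_data G" and part: "time_partition (t_init G) (t_end G) N \<tau>"
    and mesh: "mesh N \<tau> \<le> 1" and cap: "capacity_conditions G N \<tau> P"
    and sol: "riccati_solution G N \<tau> P" and k: "k < N" and s: "\<tau> k \<le> s" "s \<le> \<tau> (Suc k)"
  shows "norm (P s - P (\<tau> k)) \<le> rhs_const G * (1 + riccati_bound G) * (s - \<tau> k)"
proof (cases "s = \<tau> k")
  case False
  let ?c = "rhs_const G * (1 + riccati_bound G)"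
  have bd: "t_init G \<le> \<tau> k" "\<tau> (Suc k) \<le> t_end G"
    using time_partition_bounds[OF part] k by auto
  have "norm (P s - P (\<tau> k)) \<le> ?c * s - ?c * \<tau> k"
  proof (rule differentiable_bound_general[of "\<tau> k" s P "\<lambda>t. ?c * t"])
    show "\<tau> k < s" using False s by simp
    show "continuous_on {\<tau> k..s} P"
      using sol s bd by (auto simp: riccati_solution_def intro: continuous_on_subset)
    show "continuous_on {\<tau> k..s} (\<lambda>t. ?c * t)"
      by (intro continuous_intros)
    fix t assume t: "\<tau> k < t" "t < s"
    show "(P has_vector_derivative - riccati_rhs G N \<tau> P t) (at t)"
      using riccati_solution_deriv[OF sol k] t s by simp
    show "((\<lambda>t. ?c * t) has_vector_derivative ?c) (at t)"
      using has_vector_derivative_mult_right[OF has_vector_derivative_id, of ?c] by simp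
    have "transpose (P t) = P t"
      using sol t s bd by (auto simp: riccati_solution_def)
    then have "norm (riccati_rhs G N \<tau> P t) \<le> rhs_const G * (1 + norm (P t))"
      using t s bd by (intro riccati_rhs_bound[OF data part mesh cap]) auto
    also have "\<dots> \<le> ?c"
      using riccati_solution_bounded[OF data part mesh cap sol, of t] t s bd rhs_const_nonneg[of G]
      by (intro mult_left_mono) auto
    finally show "norm (- riccati_rhs G N \<tau> P t) \<le> ?c" by simp
  qed
  then show ?thesis by (simp add: right_diff_distrib)
qed simp

subsection \<open>Completion of squares along a sampled trajectory\<close>

lemma bounded_bilinear_matrix_vector_mult:
  "bounded_bilinear ((*v) :: real ^ 'n ^ 'm \<Rightarrow> real ^ 'n \<Rightarrow> real ^ 'm)"
proof
  show "\<exists>K. \<forall>(M :: real ^ 'n ^ 'm) x. norm (M *v x) \<le> norm M * norm x * K"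
    by (intro exI[of _ 1]) (simp add: norm_matrix_vector_le)
qed (simp_all add: matrix_vector_mult_add_rdistrib matrix_vector_right_distrib
    matrix_vector_mult_scaleR scaleR_matrix_vector_assoc)

text \<open>Since \<open>R ** K = transpose B ** P\<close>, the cross term is the action of the
  control on the derivative of \<open>y \<bullet> (P *v y)\<close>, and the last term is the
  quadratic term of the Riccati equation.\<close>

lemma complete_square:
  fixes P :: "real ^ 'd ^ 'd" and B :: "real ^ 'm ^ 'd"
  assumes P: "transpose P = P" and R: "pos_def R"
  defines "K \<equiv> matrix_inv R ** transpose B ** P"
  shows "(u + K *v y) \<bullet> (R *v (u + K *v y))
    = u \<bullet> (R *v u) + 2 * ((B *v u) \<bullet> (P *v y)) + y \<bullet> ((P ** B ** matrix_inv R ** transpose B ** P) *v y)"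
proof -
  let ?S = "matrix_inv R" and ?w = "transpose B *v (P *v y)"
  have S: "R ** ?S = mat 1" using matrix_inv_pos_def[OF R] by auto
  have Rs: "transpose R = R" using R by (simp add: pos_def_def)
  have Ky: "K *v y = ?S *v ?w"
    by (simp add: K_def matrix_vector_mul_assoc matrix_mul_assoc)
  have RK: "R *v (K *v y) = ?w"
    unfolding Ky by (simp only: matrix_vector_mul_assoc[of R] S matrix_vector_mul_lid)
  have 1: "u \<bullet> ?w = (B *v u) \<bullet> (P *v y)"
    using inner_transpose_mult[of u "transpose B" "P *v y"] by simp
  have 2: "(K *v y) \<bullet> (R *v u) = ?w \<bullet> u"
    using inner_transpose_mult[of "K *v y" R u] by (simp add: Rs RK)
  have "y \<bullet> ((P ** B ** ?S ** transpose B ** P) *v y) = y \<bullet> (P *v (B *v (K *v y)))"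
    unfolding Ky by (simp add: matrix_vector_mul_assoc matrix_mul_assoc)
  also have "\<dots> = (P *v y) \<bullet> (B *v (K *v y))"
    using inner_transpose_mult[of y P] by (simp add: P)
  also have "\<dots> = ?w \<bullet> (K *v y)"
    by (rule inner_transpose_mult)
  finally have 3: "y \<bullet> ((P ** B ** ?S ** transpose B ** P) *v y) = (K *v y) \<bullet> ?w"
    by (simp add: inner_commute)
  show ?thesis
    unfolding matrix_vector_right_distrib inner_add_left inner_add_right RK 2 3
    using 1 by (simp add: inner_commute)
qed

definition gain1 :: "('d::finite, 'p::finite, 'q::finite) lq_game \<Rightarrow> real ^ 'd ^ 'd \<Rightarrow> real ^ 'd ^ 'p" where
  "gain1 G P = matrix_inv (mat_R1 G) ** transpose (mat_B1 G) ** P"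

definition gain2 :: "('d::finite, 'p::finite, 'q::finite) lq_game \<Rightarrow> real ^ 'd ^ 'd \<Rightarrow> real ^ 'd ^ 'q" where
  "gain2 G P = matrix_inv (mat_R2 G) ** transpose (mat_B2 G) ** P"

definition running_cost ::
  "('d::finite, 'p::finite, 'q::finite) lq_game \<Rightarrow> real ^ 'd \<Rightarrow> (real ^ 'p) \<times> (real ^ 'q) \<Rightarrow> real" where
  "running_cost G y a = y \<bullet> (mat_Q G *v y) + fst a \<bullet> (mat_R1 G *v fst a) - snd a \<bullet> (mat_R2 G *v snd a)"

text \<open>Verification argument for the value function. Without the multiplier the Riccati
  equation contains exactly the two quadratic terms that complete the squares; the terms with
  \<open>mat_A G\<close> cancel, and \<open>mat_Q G\<close> goes into the running cost.\<close>

lemma value_function_derivative: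
  fixes G :: "('d::finite, 'p::finite, 'q::finite) lq_game"
  assumes data: "lq_game_data G" and sym: "transpose (P t) = P t"
    and l0: "lambda2 G N \<tau> P t = 0"
    and P: "(P has_vector_derivative - riccati_rhs G N \<tau> P t) (at t)"
    and y: "(y has_vector_derivative mat_A G *v y t + control_input G a) (at t)"
  shows "((\<lambda>t. y t \<bullet> (P t *v y t)) has_vector_derivative
    - running_cost G (y t) a
    + (fst a + gain1 G (P t) *v y t) \<bullet> (mat_R1 G *v (fst a + gain1 G (P t) *v y t))
    - (snd a - gain2 G (P t) *v y t) \<bullet> (mat_R2 G *v (snd a - gain2 G (P t) *v y t))) (at t)"
proof -
  let ?y = "y t" and ?P = "P t" and ?A = "mat_A G" and ?u = "fst a" and ?v = "snd a"
  let ?y' = "?A *v ?y + control_input G a" and ?P' = "- riccati_rhs G N \<tau> P t"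
  have R: "pos_def (mat_R1 G)" "pos_def (mat_R2 G)"
    using data by (auto simp: lq_game_data_def)
  let ?T1 = "?P ** mat_B1 G ** matrix_inv (mat_R1 G) ** transpose (mat_B1 G) ** ?P"
  let ?T2 = "?P ** mat_B2 G ** matrix_inv (mat_R2 G) ** transpose (mat_B2 G) ** ?P"
  have m0: "mat 0 = (0 :: real ^ 'n ^ 'n)" by (simp add: mat_def vec_eq_iff)
  have rhs: "riccati_rhs G N \<tau> P t = transpose ?A ** ?P + ?P ** ?A + mat_Q G - ?T1 + ?T2"
    unfolding riccati_rhs_def l0 by (simp add: m0)
  have d: "((\<lambda>t. y t \<bullet> (P t *v y t)) has_vector_derivative
      ?y \<bullet> (?P *v ?y' + ?P' *v ?y) + ?y' \<bullet> (?P *v ?y)) (at t)"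
    by (intro bounded_bilinear.has_vector_derivative[OF bounded_bilinear_inner]
        bounded_bilinear.has_vector_derivative[OF bounded_bilinear_matrix_vector_mult] P y)
  have 1: "?y \<bullet> (?P *v z) = z \<bullet> (?P *v ?y)" for z
    using inner_transpose_mult[of ?y ?P z] by (simp add: sym inner_commute)
  have 2: "?y \<bullet> ((transpose ?A ** ?P) *v ?y) = (?A *v ?y) \<bullet> (?P *v ?y)"
    using inner_transpose_mult[of ?y "transpose ?A" "?P *v ?y"] by (simp add: matrix_vector_mul_assoc)
  have 3: "?y \<bullet> ((?P ** ?A) *v ?y) = (?A *v ?y) \<bullet> (?P *v ?y)"
    using 1[of "?A *v ?y"] by (simp add: matrix_vector_mul_assoc)
  have P': "?y \<bullet> (?P' *v ?y) = - (2 * ((?A *v ?y) \<bullet> (?P *v ?y)) + ?y \<bullet> (mat_Q G *v ?y)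
      - ?y \<bullet> (?T1 *v ?y) + ?y \<bullet> (?T2 *v ?y))"
    unfolding matrix_vector_mult_uminus rhs matrix_vector_mult_add_rdistrib matrix_vector_mult_diff_rdistrib
      inner_add_right inner_diff_right inner_minus_right 2 3 by simp
  have sq1: "(?u + gain1 G ?P *v ?y) \<bullet> (mat_R1 G *v (?u + gain1 G ?P *v ?y))
      = ?u \<bullet> (mat_R1 G *v ?u) + 2 * ((mat_B1 G *v ?u) \<bullet> (?P *v ?y)) + ?y \<bullet> (?T1 *v ?y)"
    unfolding gain1_def by (rule complete_square[OF sym R(1)])
  \<comment> \<open>Completed at \<open>- ?v\<close>, because the optimal control of Player 2 is the
    gain applied to the state and not its negative.\<close>
  have sq2: "(?v - gain2 G ?P *v ?y) \<bullet> (mat_R2 G *v (?v - gain2 G ?P *v ?y))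
      = ?v \<bullet> (mat_R2 G *v ?v) - 2 * ((mat_B2 G *v ?v) \<bullet> (?P *v ?y)) + ?y \<bullet> (?T2 *v ?y)"
  proof -
    have e: "- ?v + gain2 G ?P *v ?y = - (?v - gain2 G ?P *v ?y)" by simp
    have m: "M *v (- x) = - (M *v x)" for M :: "real ^ 'n ^ 'm" and x
      by (simp add: matrix_vector_mult_def vec_eq_iff sum_negf)
    show ?thesis
      using complete_square[OF sym R(2), where B = "mat_B2 G" and u = "- ?v" and y = ?y]
      unfolding gain2_def[symmetric] e m inner_minus_left inner_minus_right by simp
  qed
  have "?y \<bullet> (?P *v ?y' + ?P' *v ?y) + ?y' \<bullet> (?P *v ?y)
      = - running_cost G ?y a
    + (?u + gain1 G ?P *v ?y) \<bullet> (mat_R1 G *v (?u + gain1 G ?P *v ?y))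
    - (?v - gain2 G ?P *v ?y) \<bullet> (mat_R2 G *v (?v - gain2 G ?P *v ?y))"
    unfolding sq1 sq2 unfolding inner_add_right P' 1 running_cost_def control_input_def inner_add_left by simp
  then show ?thesis using d by simp
qed

section \<open>Drift of state and gain within one step\<close>

definition drift_const ::
  "('d::finite, 'p::finite, 'q::finite) lq_game \<Rightarrow> real \<Rightarrow> real \<Rightarrow> real" where
  "drift_const G \<gamma> \<kappa> =
    (4 * \<gamma>\<^sup>2 * (2 * (norm (mat_A G))\<^sup>2 * exp (2 * norm (mat_A G) + 1) + 2)
      + 4 * (\<kappa> * (rhs_const G * (1 + riccati_bound G)))\<^sup>2 * exp (2 * norm (mat_A G) + 1))
    * (1 + 2 * (norm (mat_B1 G))\<^sup>2 + 2 * (norm (mat_B2 G))\<^sup>2)"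

lemma drift_const_nonneg: "0 \<le> drift_const G \<gamma> \<kappa>"
  by (simp add: drift_const_def add_nonneg_nonneg)

text \<open>In the applications \<open>S\<close> is the inverse weight times the transposed input
  matrix, so \<open>S ** P0\<close> is the gain at the node and \<open>S ** P1\<close> the current
  one; \<open>w\<close> is \<open>u\<close> or \<open>- v\<close>. Besides the deviation at the node
  there remain the old gain applied to the displacement and the change of gain applied to the new
  state, both of order \<open>s\<close>. \<open>drift_const\<close> collects their constants; its
  last factor passes from \<open>control_input\<close> to the controls.\<close>

lemma gain_deviation:
  fixes G :: "('d::finite, 'p::finite, 'q::finite) lq_game" and S :: "real ^ 'd ^ 'm" and a x
  assumes h: "0 \<le> s" "s \<le> m" "m \<le> 1"
    and K0: "\<And>z. norm ((S ** P0) *v z) \<le> \<gamma> * norm z"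
    and P: "norm (P1 - P0) \<le> rhs_const G * (1 + riccati_bound G) * s"
  defines "y \<equiv> affine_flow (mat_A G) (control_input G a) x s"
  shows "(norm (w + (S ** P1) *v y))\<^sup>2 \<le> 2 * (norm (w + (S ** P0) *v x))\<^sup>2
    + m\<^sup>2 * drift_const G \<gamma> (norm S) * ((norm x)\<^sup>2 + (norm (fst a))\<^sup>2 + (norm (snd a))\<^sup>2)"
proof -
  let ?E = "exp (2 * norm (mat_A G) + 1)" and ?L = "rhs_const G * (1 + riccati_bound G)"
  let ?I = "2 * (norm (mat_A G))\<^sup>2 * ?E + 2" and ?Z = "(norm x)\<^sup>2 + (norm (control_input G a))\<^sup>2"
  let ?W = "(norm x)\<^sup>2 + (norm (fst a))\<^sup>2 + (norm (snd a))\<^sup>2"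
  let ?B = "1 + 2 * (norm (mat_B1 G))\<^sup>2 + 2 * (norm (mat_B2 G))\<^sup>2"
  have s1: "s \<le> 1" using h by simp
  have Z: "?Z \<le> ?B * ?W"
  proof -
    have "?B * ?W = (norm x)\<^sup>2 + 2 * (norm (mat_B1 G))\<^sup>2 * (norm (fst a))\<^sup>2 + 2 * (norm (mat_B2 G))\<^sup>2 * (norm (snd a))\<^sup>2
        + ((norm (fst a))\<^sup>2 + (norm (snd a))\<^sup>2 + 2 * (norm (mat_B1 G))\<^sup>2 * ((norm x)\<^sup>2 + (norm (snd a))\<^sup>2)
          + 2 * (norm (mat_B2 G))\<^sup>2 * ((norm x)\<^sup>2 + (norm (fst a))\<^sup>2))"
      by (simp add: algebra_simps)
    moreover have "0 \<le> (norm (fst a))\<^sup>2 + (norm (snd a))\<^sup>2 + 2 * (norm (mat_B1 G))\<^sup>2 * ((norm x)\<^sup>2 + (norm (snd a))\<^sup>2)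
          + 2 * (norm (mat_B2 G))\<^sup>2 * ((norm x)\<^sup>2 + (norm (fst a))\<^sup>2)"
      by simp
    ultimately show ?thesis
      using norm_control_input_sq_le[of G a] by linarith
  qed
  have a1: "(norm ((S ** P0) *v (y - x)))\<^sup>2 \<le> \<gamma>\<^sup>2 * (s\<^sup>2 * (?I * ?Z))"
  proof -
    have "(norm ((S ** P0) *v (y - x)))\<^sup>2 \<le> \<gamma>\<^sup>2 * (norm (y - x))\<^sup>2"
      using power_mono[OF K0[of "y - x"], of 2] by (simp add: power_mult_distrib)
    also have "\<dots> \<le> \<gamma>\<^sup>2 * (s\<^sup>2 * (?I * ?Z))"
      unfolding y_def by (intro mult_left_mono affine_flow_increment h s1) simp
    finally show ?thesis .
  qed
  have a2: "(norm ((S ** (P1 - P0)) *v y))\<^sup>2 \<le> (norm S * ?L)\<^sup>2 * s\<^sup>2 * (?E * ?Z)"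
  proof -
    have "norm (S ** (P1 - P0)) \<le> norm S * (?L * s)"
      using norm_matrix_mult_le[of S "P1 - P0"] P by (meson mult_left_mono norm_ge_zero order_trans)
    then have "(norm (S ** (P1 - P0)))\<^sup>2 \<le> (norm S * ?L)\<^sup>2 * s\<^sup>2"
      using power_mono[of "norm (S ** (P1 - P0))" "norm S * (?L * s)" 2] by (simp add: power_mult_distrib mult.assoc)
    moreover have "(norm y)\<^sup>2 \<le> ?E * ?Z"
      unfolding y_def by (intro affine_flow_norm_sq_le_unit h s1)
    ultimately have "(norm (S ** (P1 - P0)))\<^sup>2 * (norm y)\<^sup>2 \<le> (norm S * ?L)\<^sup>2 * s\<^sup>2 * (?E * ?Z)"
      by (intro mult_mono) auto
    then show ?thesis
      using norm_matrix_vector_sq_le[of "S ** (P1 - P0)" y] by linarith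
  qed
  have "w + (S ** P1) *v y = (w + (S ** P0) *v x) + ((S ** P0) *v (y - x) + (S ** (P1 - P0)) *v y)"
  proof -
    have "S ** P1 = S ** P0 + S ** (P1 - P0)"
      by (simp flip: matrix_add_ldistrib)
    then show ?thesis
      by (simp add: matrix_vector_mult_add_rdistrib matrix_vector_mult_diff_distrib)
  qed
  note split = this
  have "(norm (w + (S ** P1) *v y))\<^sup>2 \<le> 2 * (norm (w + (S ** P0) *v x))\<^sup>2
      + 2 * (2 * (norm ((S ** P0) *v (y - x)))\<^sup>2 + 2 * (norm ((S ** (P1 - P0)) *v y))\<^sup>2)"
    unfolding split
    by (rule order_trans[OF norm_sum_sq_le]) (intro add_left_mono mult_left_mono norm_sum_sq_le, simp)
  also have "\<dots> \<le> 2 * (norm (w + (S ** P0) *v x))\<^sup>2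
      + 2 * (2 * (\<gamma>\<^sup>2 * (s\<^sup>2 * (?I * ?Z))) + 2 * ((norm S * ?L)\<^sup>2 * s\<^sup>2 * (?E * ?Z)))"
    using a1 a2 by (intro add_left_mono mult_left_mono add_mono) auto
  also have "\<dots> = 2 * (norm (w + (S ** P0) *v x))\<^sup>2 + s\<^sup>2 * ((4 * \<gamma>\<^sup>2 * ?I + 4 * (norm S * ?L)\<^sup>2 * ?E) * ?Z)"
    by (simp add: algebra_simps)
  also have "\<dots> \<le> 2 * (norm (w + (S ** P0) *v x))\<^sup>2 + m\<^sup>2 * ((4 * \<gamma>\<^sup>2 * ?I + 4 * (norm S * ?L)\<^sup>2 * ?E) * (?B * ?W))"
    using h Z by (intro add_left_mono mult_mono power_mono mult_left_mono) (auto intro!: add_nonneg_nonneg mult_nonneg_nonneg)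
  also have "\<dots> = 2 * (norm (w + (S ** P0) *v x))\<^sup>2 + m\<^sup>2 * drift_const G \<gamma> (norm S) * ?W"
    unfolding drift_const_def by (simp only: mult.assoc)
  finally show ?thesis .
qed

text \<open>Dominates the square left over by a player who should have held \<open>- K x\<close> but held \<open>u\<close>, where \<open>m\<close>
  accounts for the drift of state and gain within one step.\<close>

definition deviation_cost :: "real ^ 'm ^ 'm \<Rightarrow> real \<Rightarrow> real ^ 'd ^ 'm \<Rightarrow> real ^ 'd \<Rightarrow> real ^ 'm \<Rightarrow> real" where
  "deviation_cost R m K x u = norm R * (2 * (norm (u + K *v x))\<^sup>2 + m * ((norm x)\<^sup>2 + (norm u)\<^sup>2))"

lemma quadratic_form_le: "x \<bullet> (R *v x) \<le> norm R * (norm x)\<^sup>2" for R :: "real ^ 'n ^ 'n"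
proof -
  have "x \<bullet> (R *v x) \<le> norm x * (norm R * norm x)"
    by (meson norm_cauchy_schwarz norm_matrix_vector_le mult_left_mono norm_ge_zero order_trans)
  then show ?thesis by (simp add: power2_eq_square mult_ac)
qed

section \<open>Cost of one partition interval\<close>

lemma pos_def_nonneg: "pos_def M \<Longrightarrow> 0 \<le> x \<bullet> (M *v x)"
  by (cases "x = 0") (auto simp: pos_def_def intro: less_imp_le)

definition segment_cost ::
  "('d::finite, 'p::finite, 'q::finite) lq_game \<Rightarrow> real \<Rightarrow> real \<Rightarrow> real ^ 'd \<Rightarrow> (real ^ 'p) \<times> (real ^ 'q) \<Rightarrow> real" where
  "segment_cost G c d x a =
    (LINT t:{c..d}|lborel. running_cost G (affine_flow (mat_A G) (control_input G a) x (t - c)) a)"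

lemma continuous_on_running_cost_flow:
  "continuous_on S (\<lambda>t. running_cost G (affine_flow (mat_A G) b x (t - c)) a)"
  unfolding running_cost_def
  by (intro continuous_intros bounded_linear.continuous_on[OF matrix_vector_mul_bounded_linear]
      continuous_on_compose2[OF continuous_on_affine_flow[of UNIV]]) auto

text \<open>Links the Lebesgue integral of the cost to the gauge integral in which the fundamental
  theorem of calculus is stated.\<close>

lemma has_integral_segment_cost:
  "((\<lambda>t. running_cost G (affine_flow (mat_A G) (control_input G a) x (t - c)) a)
    has_integral segment_cost G c d x a) {c..d}"
proof -
  have "set_integrable lborel {c..d} (\<lambda>t. running_cost G (affine_flow (mat_A G) (control_input G a) x (t - c)) a)"
    unfolding set_integrable_def
    by (intro borel_integrable_compact continuous_on_running_cost_flow) simp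
  then show ?thesis
    unfolding segment_cost_def by (metis has_integral_integrable_integral set_borel_integral_eq_integral)
qed

text \<open>The situation on a fine partition: \<open>l0\<close> is supplied by
  \<open>lambda2_eq_0\<close>.\<close>

locale riccati_game =
  fixes G :: "('d::finite, 'p::finite, 'q::finite) lq_game" and N \<tau> P
  assumes data: "lq_game_data G" and part: "time_partition (t_init G) (t_end G) N \<tau>"
    and mesh1: "mesh N \<tau> \<le> 1" and cap: "capacity_conditions G N \<tau> P"
    and sol: "riccati_solution G N \<tau> P"
    and l0: "\<And>t. t_init G \<le> t \<Longrightarrow> t \<le> t_end G \<Longrightarrow> lambda2 G N \<tau> P t = 0"
begin

lemma P_symmetric: "t_init G \<le> t \<Longrightarrow> t \<le> t_end G \<Longrightarrow> transpose (P t) = P t"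
  using sol by (auto simp: riccati_solution_def)

lemma weights_pos_def: "pos_def (mat_R1 G)" "pos_def (mat_R2 G)"
  using data by (auto simp: lq_game_data_def)

text \<open>In this form the capacity condition says that the Riccati feedback is
  admissible.\<close>

lemma gain1_bound: "t_init G \<le> t \<Longrightarrow> t \<le> t_end G \<Longrightarrow> norm (gain1 G (P t) *v x) \<le> gam1 G * norm x"
  unfolding gain1_def using data
  by (intro gain_bound(1)[OF P_symmetric weights_pos_def(1) capacity_conditionsD(1)[OF cap]]) (auto simp: lq_game_data_def)

lemma gain2_bound:
  assumes "t_init G \<le> t" "t \<le> t_end G"
  shows "norm (gain2 G (P t) *v x) \<le> gam2 G * norm x"
proof -
  have "mat 0 = (0 :: real ^ 'q ^ 'q)" by (simp add: mat_def vec_eq_iff)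
  then show ?thesis
    using gain_bound(1)[OF P_symmetric[OF assms] weights_pos_def(2) capacity_conditionsD(2)[OF cap assms, unfolded l0[OF assms], simplified], of x]
      data unfolding gain2_def by (simp add: lq_game_data_def)
qed

definition "drift1 = (mesh N \<tau>)\<^sup>2 * drift_const G (gam1 G) (norm (matrix_inv (mat_R1 G) ** transpose (mat_B1 G)))"
definition "drift2 = (mesh N \<tau>)\<^sup>2 * drift_const G (gam2 G) (norm (matrix_inv (mat_R2 G) ** transpose (mat_B2 G)))"

text \<open>The fundamental theorem of calculus identifies \<open>\<Delta> x a\<close> with the
  integral of \<open>sq1 - sq2\<close>. Dropping one nonnegative square leaves a one-sided bound in
  which only the other player's deviation and the drift appear.\<close>

lemma segment_estimate:
  assumes k: "k < N"
  defines "h \<equiv> \<tau> (Suc k) - \<tau> k"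
  defines "\<Delta> \<equiv> \<lambda>x a. segment_cost G (\<tau> k) (\<tau> (Suc k)) x a
    + affine_flow (mat_A G) (control_input G a) x h \<bullet> (P (\<tau> (Suc k)) *v affine_flow (mat_A G) (control_input G a) x h)
    - x \<bullet> (P (\<tau> k) *v x)"
  shows "\<Delta> x a \<le> h * (deviation_cost (mat_R1 G) drift1 (gain1 G (P (\<tau> k))) x (fst a) + norm (mat_R1 G) * drift1 * (norm (snd a))\<^sup>2)"
    and "- \<Delta> x a \<le> h * (norm (mat_R2 G) * drift2 * (norm (fst a))\<^sup>2 + deviation_cost (mat_R2 G) drift2 (- gain2 G (P (\<tau> k))) x (snd a))"
proof -
  let ?a = "\<tau> k" and ?b = "\<tau> (Suc k)"
  have ab: "?a < ?b" using part k by (auto simp: time_partition_def)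
  have bd: "t_init G \<le> ?a" "?a \<le> t_end G" "?b \<le> t_end G"
    using time_partition_bounds[OF part] k by auto
  define y where "y t = affine_flow (mat_A G) (control_input G a) x (t - ?a)" for t
  define sq1 where "sq1 t = (fst a + gain1 G (P t) *v y t) \<bullet> (mat_R1 G *v (fst a + gain1 G (P t) *v y t))" for t
  define sq2 where "sq2 t = (snd a - gain2 G (P t) *v y t) \<bullet> (mat_R2 G *v (snd a - gain2 G (P t) *v y t))" for t
  have y: "(y has_vector_derivative mat_A G *v y t + control_input G a) (at t)" for t
  proof -
    have "((\<lambda>t. t - ?a) has_vector_derivative 1) (at t)"
      by (auto intro!: derivative_eq_intros)
    from vector_diff_chain_at[OF this affine_flow_deriv] show ?thesis
      by (simp add: y_def[abs_def] o_def)
  qed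
  have cy: "continuous_on {?a..?b} y"
    by (meson continuous_at_imp_continuous_on has_vector_derivative_continuous y)
  have cP: "continuous_on {?a..?b} P"
    using sol bd by (auto simp: riccati_solution_def intro: continuous_on_subset)
  \<comment> \<open>The derivative of \<open>P\<close> may jump at the nodes, so at the two ends
    only continuity is used.\<close>
  have "((\<lambda>t. - running_cost G (y t) a + sq1 t - sq2 t) has_integral
      (y ?b \<bullet> (P ?b *v y ?b) - y ?a \<bullet> (P ?a *v y ?a))) {?a..?b}"
  proof (rule fundamental_theorem_of_calculus_interior)
    show "continuous_on {?a..?b} (\<lambda>t. y t \<bullet> (P t *v y t))"
      by (intro continuous_intros bounded_bilinear.continuous_on[OF bounded_bilinear_matrix_vector_mult] cy cP)
    fix t assume t: "t \<in> {?a<..<?b}"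
    then have "t_init G \<le> t" "t \<le> t_end G" using bd by auto
    then show "((\<lambda>t. y t \<bullet> (P t *v y t)) has_vector_derivative - running_cost G (y t) a + sq1 t - sq2 t) (at t)"
      unfolding sq1_def sq2_def
      using t by (intro value_function_derivative[OF data P_symmetric l0 riccati_solution_deriv[OF sol k] y]) auto
  qed (use ab in simp)
  moreover have "((\<lambda>t. running_cost G (y t) a) has_integral segment_cost G ?a ?b x a) {?a..?b}"
    unfolding y_def by (rule has_integral_segment_cost)
  ultimately have "((\<lambda>t. (- running_cost G (y t) a + sq1 t - sq2 t) + running_cost G (y t) a) has_integral
      (y ?b \<bullet> (P ?b *v y ?b) - y ?a \<bullet> (P ?a *v y ?a)) + segment_cost G ?a ?b x a) {?a..?b}"
    by (rule has_integral_add)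
  then have int: "((\<lambda>t. sq1 t - sq2 t) has_integral \<Delta> x a) {?a..?b}"
    by (simp add: \<Delta>_def y_def h_def algebra_simps)
  have sq_nn: "0 \<le> sq1 t" "0 \<le> sq2 t" for t
    using pos_def_nonneg weights_pos_def by (auto simp: sq1_def sq2_def)
  have dP: "norm (P t - P ?a) \<le> rhs_const G * (1 + riccati_bound G) * (t - ?a)" if "t \<in> {?a..?b}" for t
    using that by (intro riccati_solution_lipschitz[OF data part mesh1 cap sol k]) auto
  have hm: "h \<le> mesh N \<tau>" using step_le_mesh[OF k] by (simp add: h_def)
  have sq1_le: "sq1 t \<le> deviation_cost (mat_R1 G) drift1 (gain1 G (P ?a)) x (fst a) + norm (mat_R1 G) * drift1 * (norm (snd a))\<^sup>2"
    if t: "t \<in> {?a..?b}" for t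
  proof -
    have "sq1 t \<le> norm (mat_R1 G) * (norm (fst a + gain1 G (P t) *v y t))\<^sup>2"
      unfolding sq1_def by (rule quadratic_form_le)
    also have "\<dots> \<le> norm (mat_R1 G) * (2 * (norm (fst a + gain1 G (P ?a) *v x))\<^sup>2
        + drift1 * ((norm x)\<^sup>2 + (norm (fst a))\<^sup>2 + (norm (snd a))\<^sup>2))"
      unfolding y_def gain1_def drift1_def using t hm gain1_bound[OF bd(1,2)] dP[OF t] mesh1
      by (intro mult_left_mono gain_deviation) (auto simp: gain1_def h_def)
    also have "\<dots> = deviation_cost (mat_R1 G) drift1 (gain1 G (P ?a)) x (fst a) + norm (mat_R1 G) * drift1 * (norm (snd a))\<^sup>2"
      by (simp add: deviation_cost_def algebra_simps)
    finally show ?thesis .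
  qed
  have sq2_le: "sq2 t \<le> norm (mat_R2 G) * drift2 * (norm (fst a))\<^sup>2 + deviation_cost (mat_R2 G) drift2 (- gain2 G (P ?a)) x (snd a)"
    if t: "t \<in> {?a..?b}" for t
  proof -
    \<comment> \<open>Brings the square of Player 2 to the form treated by
      \<open>gain_deviation\<close>, with \<open>w = - snd a\<close>.\<close>
    have n2: "norm (snd a - gain2 G M *v z) = norm (- snd a + gain2 G M *v z)" for M z
      using norm_minus_cancel[of "snd a - gain2 G M *v z"] by simp
    have "sq2 t \<le> norm (mat_R2 G) * (norm (- snd a + gain2 G (P t) *v y t))\<^sup>2"
      unfolding sq2_def n2[symmetric] by (rule quadratic_form_le)
    also have "\<dots> \<le> norm (mat_R2 G) * (2 * (norm (- snd a + gain2 G (P ?a) *v x))\<^sup>2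
        + drift2 * ((norm x)\<^sup>2 + (norm (fst a))\<^sup>2 + (norm (snd a))\<^sup>2))"
      unfolding y_def gain2_def drift2_def using t hm gain2_bound[OF bd(1,2)] dP[OF t] mesh1
      by (intro mult_left_mono gain_deviation) (auto simp: gain2_def h_def)
    also have "\<dots> = norm (mat_R2 G) * drift2 * (norm (fst a))\<^sup>2 + deviation_cost (mat_R2 G) drift2 (- gain2 G (P ?a)) x (snd a)"
      unfolding n2[symmetric] by (simp add: deviation_cost_def algebra_simps matrix_vector_mult_uminus)
    finally show ?thesis .
  qed
  have const: "((\<lambda>t. c) has_integral h * c) {?a..?b}" for c :: real
    using has_integral_const_real[of c ?a ?b] ab by (simp add: h_def)
  show "\<Delta> x a \<le> h * (deviation_cost (mat_R1 G) drift1 (gain1 G (P ?a)) x (fst a) + norm (mat_R1 G) * drift1 * (norm (snd a))\<^sup>2)"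
  proof (rule has_integral_le[OF int const])
    fix t assume "t \<in> {?a..?b}"
    from sq1_le[OF this] sq_nn(2)[of t]
    show "sq1 t - sq2 t \<le> deviation_cost (mat_R1 G) drift1 (gain1 G (P ?a)) x (fst a) + norm (mat_R1 G) * drift1 * (norm (snd a))\<^sup>2"
      by linarith
  qed
  show "- \<Delta> x a \<le> h * (norm (mat_R2 G) * drift2 * (norm (fst a))\<^sup>2 + deviation_cost (mat_R2 G) drift2 (- gain2 G (P ?a)) x (snd a))"
  proof (rule has_integral_le[OF has_integral_neg[OF int] const])
    fix t assume "t \<in> {?a..?b}"
    from sq2_le[OF this] sq_nn(1)[of t]
    show "- (sq1 t - sq2 t) \<le> norm (mat_R2 G) * drift2 * (norm (fst a))\<^sup>2 + deviation_cost (mat_R2 G) drift2 (- gain2 G (P ?a)) x (snd a)"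
      by linarith
  qed
qed

end

subsection \<open>Decomposition of the cost along the partition\<close>

lemma integral_singleton: "(LINT t|lborel. indicator {b :: real} t *\<^sub>R (f t :: real)) = 0"
  and integrable_singleton: "integrable lborel (\<lambda>t. indicator {b :: real} t *\<^sub>R (f t :: real))"
proof -
  have eq: "(\<lambda>t. indicator {b} t *\<^sub>R f t) = (\<lambda>t. f b * indicator {b} t)"
    by (auto simp: indicator_def)
  show "(LINT t|lborel. indicator {b} t *\<^sub>R f t) = 0"
    unfolding eq by simp
  show "integrable lborel (\<lambda>t. indicator {b} t *\<^sub>R f t)"
    unfolding eq by simp
qed

text \<open>\<open>g\<close> agrees with \<open>f k\<close> only on half-open intervals, and its
  value at \<open>b\<close> is arbitrary; passing to closed intervals costs finitely many
  points.\<close>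

lemma set_lebesgue_integral_piecewise:
  fixes g :: "real \<Rightarrow> real" and f :: "nat \<Rightarrow> real \<Rightarrow> real"
  assumes part: "time_partition a b N \<tau>"
    and g: "\<And>k t. k < N \<Longrightarrow> \<tau> k \<le> t \<Longrightarrow> t < \<tau> (Suc k) \<Longrightarrow> g t = f k t"
    and f: "\<And>k. k < N \<Longrightarrow> continuous_on {\<tau> k..\<tau> (Suc k)} (f k)"
  shows "(LINT t:{a..b}|lborel. g t) = (\<Sum>k<N. LINT t:{\<tau> k..\<tau> (Suc k)}|lborel. f k t)"
proof -
  \<comment> \<open>The half-open interval as a closed one minus a point: the closed part is
    integrable by compactness, and the point integrates to 0.\<close>
  let ?p = "\<lambda>k t. indicator {\<tau> k..\<tau> (Suc k)} t *\<^sub>R f k t - indicator {\<tau> (Suc k)} t *\<^sub>R f k t"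
  have lt: "\<tau> k < \<tau> (Suc k)" if "k < N" for k
    using part that by (auto simp: time_partition_def)
  have int: "integrable lborel (\<lambda>t. indicator {\<tau> k..\<tau> (Suc k)} t *\<^sub>R f k t)" if "k < N" for k
    using that f by (intro borel_integrable_compact) auto
  have p: "?p k t = indicator {\<tau> k..<\<tau> (Suc k)} t *\<^sub>R f k t" if "k < N" for k t
    using lt[OF that] by (auto simp: indicator_def)
  have "indicator {a..b} t *\<^sub>R g t = (\<Sum>k<N. ?p k t) + indicator {b} t *\<^sub>R g t" for t
  proof (cases "a \<le> t \<and> t < b")
    case True
    then obtain k where k: "k < N" "\<tau> k \<le> t" "t < \<tau> (Suc k)"
      using time_partition_cover[OF part] by blast
    have "(\<Sum>j<N. ?p j t) = (\<Sum>j<N. if j = k then f k t else 0)"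
    proof (rule sum.cong)
      fix j assume "j \<in> {..<N}"
      then have j: "j < N" by simp
      have "t \<in> {\<tau> j..<\<tau> (Suc j)} \<longleftrightarrow> j = k"
        using interval_index_eq[OF part j, of t] interval_index_eq[OF part k] k by auto
      then show "?p j t = (if j = k then f k t else 0)"
        unfolding p[OF j] by (cases "j = k") (simp_all add: indicator_def)
    qed simp
    then show ?thesis using True k g[of k t] by simp
  next
    case False
    have "?p k t = 0" if "k < N" for k
    proof -
      have "a \<le> \<tau> k" "\<tau> (Suc k) \<le> b"
        using time_partition_bounds[OF part] that by auto
      then have "t \<notin> {\<tau> k..<\<tau> (Suc k)}" using False by auto
      then show ?thesis unfolding p[OF that] by simp
    qed
    then have "(\<Sum>k<N. ?p k t) = 0"
      by (intro sum.neutral) simp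
    moreover have "a < b"
      using lt[of 0] part time_partition_bounds[OF part, of 1] by (auto simp: time_partition_def)
    ultimately show ?thesis using False by (simp only:) (auto simp: indicator_def)
  qed
  then have "(LINT t:{a..b}|lborel. g t) = (LINT t|lborel. (\<Sum>k<N. ?p k t) + indicator {b} t *\<^sub>R g t)"
    unfolding set_lebesgue_integral_def by (simp only:)
  also have "\<dots> = (LINT t|lborel. (\<Sum>k<N. ?p k t)) + (LINT t|lborel. indicator {b} t *\<^sub>R g t)"
    by (intro Bochner_Integration.integral_add Bochner_Integration.integrable_sum
        Bochner_Integration.integrable_diff int integrable_singleton) simp
  also have "\<dots> = (\<Sum>k<N. LINT t|lborel. ?p k t)"
    unfolding integral_singleton using int
    by (subst Bochner_Integration.integral_sum)
       (auto intro!: Bochner_Integration.integrable_diff integrable_singleton simp del: real_scaleR_def)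
  also have "\<dots> = (\<Sum>k<N. LINT t:{\<tau> k..\<tau> (Suc k)}|lborel. f k t)"
    unfolding set_lebesgue_integral_def
    using int by (intro sum.cong refl)
      (simp add: Bochner_Integration.integral_diff integrable_singleton integral_singleton del: real_scaleR_def)
  finally show ?thesis .
qed

text \<open>The terminal time belongs to the last interval, so the state there is the flow over the
  full last step, which is the state at node \<open>N\<close>.\<close>

lemma path_cost_eq:
  fixes G :: "('d::finite, 'p::finite, 'q::finite) lq_game"
  assumes part: "time_partition (t_init G) (t_end G) N \<tau>"
  shows "path_cost G N \<tau> \<omega> = (\<Sum>k<N. segment_cost G (\<tau> k) (\<tau> (Suc k)) (sampled_state G \<tau> \<omega> k) (\<omega> k))
    + sampled_state G \<tau> \<omega> N \<bullet> (mat_QT G *v sampled_state G \<tau> \<omega> N)"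
proof -
  have N: "0 < N" "\<tau> N = t_end G" using part by (auto simp: time_partition_def)
  have "state_at G N \<tau> \<omega> (t_end G) = sampled_state G \<tau> \<omega> N"
    unfolding state_at_def interval_index_end[OF part] Let_def
    using N by (cases N) auto
  moreover have "(LINT t:{t_init G..t_end G}|lborel.
        running_cost G (state_at G N \<tau> \<omega> t) (\<omega> (interval_index N \<tau> t)))
      = (\<Sum>k<N. segment_cost G (\<tau> k) (\<tau> (Suc k)) (sampled_state G \<tau> \<omega> k) (\<omega> k))"
    unfolding segment_cost_def
    by (rule set_lebesgue_integral_piecewise[OF part])
       (simp_all add: interval_index_eq[OF part] state_at_def continuous_on_running_cost_flow)
  ultimately show ?thesis
    by (simp add: path_cost_def running_cost_def Let_def)
qed

lemma borel_measurable_segment_cost [measurable (raw)]: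
  fixes G :: "('d::finite, 'p::finite, 'q::finite) lq_game"
  assumes [measurable]: "x \<in> borel_measurable M" "a \<in> borel_measurable M"
  shows "(\<lambda>w. segment_cost G c d (x w) (a w)) \<in> borel_measurable M"
proof -
  have "continuous_on UNIV (\<lambda>z. running_cost G (fst z) (snd z))"
    unfolding running_cost_def
    by (intro continuous_intros bounded_linear.continuous_on[OF matrix_vector_mul_bounded_linear])
  then have rc: "(\<lambda>z. running_cost G (fst z) (snd z)) \<in> borel_measurable borel"
    by (rule borel_measurable_continuous_onI)
  have "(\<lambda>(w, t). running_cost G (affine_flow (mat_A G) (control_input G (a w)) (x w) (t - c)) (a w))
      \<in> borel_measurable (M \<Otimes>\<^sub>M lborel)"
  proof -
    have "(\<lambda>z. (affine_flow (mat_A G) (control_input G (a (fst z))) (x (fst z)) (snd z - c), a (fst z)))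
        \<in> borel_measurable (M \<Otimes>\<^sub>M lborel)"
      by (intro borel_measurable_Pair) measurable
    from measurable_compose[OF this rc] show ?thesis
      by (simp add: case_prod_beta)
  qed
  then have "(\<lambda>(w, t). indicator {c..d} t *\<^sub>R running_cost G (affine_flow (mat_A G) (control_input G (a w)) (x w) (t - c)) (a w))
      \<in> borel_measurable (M \<Otimes>\<^sub>M lborel)"
    unfolding case_prod_beta by measurable
  then show ?thesis
    unfolding segment_cost_def set_lebesgue_integral_def
    by (rule lborel.borel_measurable_lebesgue_integral)
qed

lemma borel_measurable_path_cost:
  fixes G :: "('d::finite, 'p::finite, 'q::finite) lq_game"
  assumes part: "time_partition (t_init G) (t_end G) N \<tau>"
  shows "path_cost G N \<tau> \<in> borel_measurable (controls_space N)"
proof -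
  have x: "(\<lambda>\<omega>. sampled_state G \<tau> \<omega> k) \<in> borel_measurable (controls_space N)" if "k \<le> N" for k
    using that by (rule measurable_sampled_state)
  have "(\<lambda>\<omega>. (\<Sum>k<N. segment_cost G (\<tau> k) (\<tau> (Suc k)) (sampled_state G \<tau> \<omega> k) (\<omega> k))
    + sampled_state G \<tau> \<omega> N \<bullet> (mat_QT G *v sampled_state G \<tau> \<omega> N)) \<in> borel_measurable (controls_space N)"
    by (intro borel_measurable_add borel_measurable_sum borel_measurable_segment_cost borel_measurable_inner
        borel_measurable_matrix_mult x) auto
  moreover have "path_cost G N \<tau> = (\<lambda>\<omega>. (\<Sum>k<N. segment_cost G (\<tau> k) (\<tau> (Suc k)) (sampled_state G \<tau> \<omega> k) (\<omega> k))
    + sampled_state G \<tau> \<omega> N \<bullet> (mat_QT G *v sampled_state G \<tau> \<omega> N))"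
    using path_cost_eq[OF part] by (rule ext)
  ultimately show ?thesis by simp
qed

context riccati_game
begin

text \<open>The increments of the value function telescope: the start gives the surrogate value, and
  \<open>P (t_end G) = mat_QT G\<close> cancels against the terminal cost.\<close>

lemma path_cost_estimate:
  defines "W \<equiv> surrogate_value P (t_init G) (x_init G)"
  defines "x \<equiv> \<lambda>\<omega> k. sampled_state G \<tau> \<omega> k"
  shows "path_cost G N \<tau> \<omega> - W \<le> (\<Sum>k<N. (\<tau> (Suc k) - \<tau> k) *
      (deviation_cost (mat_R1 G) drift1 (gain1 G (P (\<tau> k))) (x \<omega> k) (fst (\<omega> k))
        + norm (mat_R1 G) * drift1 * (norm (snd (\<omega> k)))\<^sup>2))"
    and "W - path_cost G N \<tau> \<omega> \<le> (\<Sum>k<N. (\<tau> (Suc k) - \<tau> k) *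
      (norm (mat_R2 G) * drift2 * (norm (fst (\<omega> k)))\<^sup>2
        + deviation_cost (mat_R2 G) drift2 (- gain2 G (P (\<tau> k))) (x \<omega> k) (snd (\<omega> k))))"
proof -
  have ends: "\<tau> 0 = t_init G" "\<tau> N = t_end G" "P (t_end G) = mat_QT G"
    using part sol by (auto simp: time_partition_def riccati_solution_def)
  define D where "D k = segment_cost G (\<tau> k) (\<tau> (Suc k)) (x \<omega> k) (\<omega> k)
    + x \<omega> (Suc k) \<bullet> (P (\<tau> (Suc k)) *v x \<omega> (Suc k)) - x \<omega> k \<bullet> (P (\<tau> k) *v x \<omega> k)" for k
  have "(\<Sum>k<N. D k) = (\<Sum>k<N. segment_cost G (\<tau> k) (\<tau> (Suc k)) (x \<omega> k) (\<omega> k))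
      + (\<Sum>k<N. x \<omega> (Suc k) \<bullet> (P (\<tau> (Suc k)) *v x \<omega> (Suc k)) - x \<omega> k \<bullet> (P (\<tau> k) *v x \<omega> k))"
    unfolding D_def add_diff_eq[symmetric] by (rule sum.distrib)
  also have "\<dots> = path_cost G N \<tau> \<omega> - W"
    unfolding sum_lessThan_telescope[of "\<lambda>k. x \<omega> k \<bullet> (P (\<tau> k) *v x \<omega> k)"] path_cost_eq[OF part]
    by (simp add: ends W_def x_def surrogate_value_def)
  finally have D: "path_cost G N \<tau> \<omega> - W = (\<Sum>k<N. D k)" by simp
  show "path_cost G N \<tau> \<omega> - W \<le> (\<Sum>k<N. (\<tau> (Suc k) - \<tau> k) *
      (deviation_cost (mat_R1 G) drift1 (gain1 G (P (\<tau> k))) (x \<omega> k) (fst (\<omega> k))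
        + norm (mat_R1 G) * drift1 * (norm (snd (\<omega> k)))\<^sup>2))"
    unfolding D
  proof (rule sum_mono)
    fix k assume "k \<in> {..<N}"
    then show "D k \<le> (\<tau> (Suc k) - \<tau> k) *
      (deviation_cost (mat_R1 G) drift1 (gain1 G (P (\<tau> k))) (x \<omega> k) (fst (\<omega> k))
        + norm (mat_R1 G) * drift1 * (norm (snd (\<omega> k)))\<^sup>2)"
      using segment_estimate(1)[of k "x \<omega> k" "\<omega> k"] by (simp add: D_def x_def)
  qed
  have "W - path_cost G N \<tau> \<omega> = (\<Sum>k<N. - D k)"
    using D by (simp add: sum_negf)
  also have "\<dots> \<le> (\<Sum>k<N. (\<tau> (Suc k) - \<tau> k) *
      (norm (mat_R2 G) * drift2 * (norm (fst (\<omega> k)))\<^sup>2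
        + deviation_cost (mat_R2 G) drift2 (- gain2 G (P (\<tau> k))) (x \<omega> k) (snd (\<omega> k))))"
  proof (rule sum_mono)
    fix k assume "k \<in> {..<N}"
    then show "- D k \<le> (\<tau> (Suc k) - \<tau> k) *
      (norm (mat_R2 G) * drift2 * (norm (fst (\<omega> k)))\<^sup>2
        + deviation_cost (mat_R2 G) drift2 (- gain2 G (P (\<tau> k))) (x \<omega> k) (snd (\<omega> k)))"
      using segment_estimate(2)[of k "x \<omega> k" "\<omega> k"] by (simp add: D_def x_def)
  qed
  finally show "W - path_cost G N \<tau> \<omega> \<le> (\<Sum>k<N. (\<tau> (Suc k) - \<tau> k) *
      (norm (mat_R2 G) * drift2 * (norm (fst (\<omega> k)))\<^sup>2
        + deviation_cost (mat_R2 G) drift2 (- gain2 G (P (\<tau> k))) (x \<omega> k) (snd (\<omega> k))))" .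
qed

end

subsection \<open>Expectations\<close>

text \<open>The bound on the nonnegative integral is finite, which yields integrability and the
  bound on the real integral together.\<close>

lemma (in mixed_play) running_sum_integrable:
  fixes f :: "nat \<Rightarrow> real ^ 'd \<Rightarrow> real ^ 'p \<Rightarrow> real" and g :: "nat \<Rightarrow> real ^ 'd \<Rightarrow> real ^ 'q \<Rightarrow> real"
  assumes h: "\<And>k. k < N \<Longrightarrow> 0 \<le> \<tau> (Suc k) - \<tau> k \<and> \<tau> (Suc k) - \<tau> k \<le> 1"
    and meas: "\<And>k. k < N \<Longrightarrow> case_prod (f k) \<in> borel_measurable borel"
      "\<And>k. k < N \<Longrightarrow> case_prod (g k) \<in> borel_measurable borel"
    and nonneg: "\<And>k x u. 0 \<le> f k x u" "\<And>k x v. 0 \<le> g k x v"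
    and le: "\<And>k x. k < N \<Longrightarrow> (\<integral>\<^sup>+u. ennreal (f k x u) \<partial>\<mu> k x) \<le> ennreal p * ennreal ((norm x)\<^sup>2)"
      "\<And>k x. k < N \<Longrightarrow> (\<integral>\<^sup>+v. ennreal (g k x v) \<partial>\<nu> k x) \<le> ennreal q * ennreal ((norm x)\<^sup>2)"
    and nn: "0 \<le> p" "0 \<le> q" and \<tau>: "\<tau> 0 \<le> \<tau> N"
  defines "U \<equiv> \<lambda>\<omega>. \<Sum>k<N. (\<tau> (Suc k) - \<tau> k) * (f k (state k \<omega>) (fst (\<omega> k)) + g k (state k \<omega>) (snd (\<omega> k)))"
  shows "integrable (law N) U"
    and "(\<integral>\<omega>. U \<omega> \<partial>law N) \<le> (\<tau> N - \<tau> 0) * ((p + q) * (exp (growth_rate G \<gamma> \<gamma>' * (\<tau> N - \<tau> 0)) * (norm (x_init G))\<^sup>2))"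
      (is "_ \<le> ?B")
proof -
  have U_nn: "0 \<le> U \<omega>" for \<omega>
    unfolding U_def using h nonneg by (intro sum_nonneg mult_nonneg_nonneg add_nonneg_nonneg) auto
  have "(\<lambda>\<omega>. U \<omega>) \<in> borel_measurable (controls_space N)"
    unfolding U_def using meas
    by (intro borel_measurable_sum borel_measurable_times borel_measurable_add borel_measurable_const
        borel_measurable_case_prod_compose[of "f _"] borel_measurable_case_prod_compose[of "g _"]
        measurable_sampled_state measurable_control_fst measurable_control_snd) auto
  then have mU: "U \<in> borel_measurable (law N)"
    using sets_control_law[of N] by (simp cong: measurable_cong_sets)
  have "(\<integral>\<^sup>+\<omega>. ennreal (U \<omega>) \<partial>law N) = (\<integral>\<^sup>+\<omega>. (\<Sum>k<N. ennreal (\<tau> (Suc k) - \<tau> k) *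
        (ennreal (f k (state k \<omega>) (fst (\<omega> k))) + ennreal (g k (state k \<omega>) (snd (\<omega> k))))) \<partial>law N)"
  proof (rule nn_integral_cong)
    fix \<omega>
    have "ennreal (U \<omega>) = (\<Sum>k<N. ennreal ((\<tau> (Suc k) - \<tau> k) * (f k (state k \<omega>) (fst (\<omega> k)) + g k (state k \<omega>) (snd (\<omega> k)))))"
      unfolding U_def using h nonneg
      by (intro sum_ennreal[symmetric] mult_nonneg_nonneg add_nonneg_nonneg) auto
    also have "\<dots> = (\<Sum>k<N. ennreal (\<tau> (Suc k) - \<tau> k) *
        (ennreal (f k (state k \<omega>) (fst (\<omega> k))) + ennreal (g k (state k \<omega>) (snd (\<omega> k)))))"
      using h nonneg by (intro sum.cong refl) (simp add: ennreal_mult add_nonneg_nonneg)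
    finally show "ennreal (U \<omega>) = (\<Sum>k<N. ennreal (\<tau> (Suc k) - \<tau> k) *
        (ennreal (f k (state k \<omega>) (fst (\<omega> k))) + ennreal (g k (state k \<omega>) (snd (\<omega> k)))))" .
  qed
  also have "\<dots> \<le> ennreal ?B"
    using meas unfolding case_prod_beta
    by (intro running_sum_expectation_le[OF h _ _ le nn order_refl]) (auto simp: case_prod_beta)
  finally have le_B: "(\<integral>\<^sup>+\<omega>. ennreal (U \<omega>) \<partial>law N) \<le> ennreal ?B" .
  then show int: "integrable (law N) U"
    using mU U_nn by (intro integrableI_nonneg) (auto simp: top.not_eq_extremum[symmetric] top_unique intro: le_less_trans)
  have "ennreal (\<integral>\<omega>. U \<omega> \<partial>law N) \<le> ennreal ?B"
    using le_B U_nn by (subst nn_integral_eq_integral[OF int, symmetric]) auto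
  moreover have "0 \<le> ?B" using nn \<tau> by simp
  ultimately show "(\<integral>\<omega>. U \<omega> \<partial>law N) \<le> ?B"
    by (simp only: ennreal_le_iff)
qed

section \<open>Moments of the deviation costs and admissible feedbacks\<close>

lemma deviation_cost_nonneg: "0 \<le> m \<Longrightarrow> 0 \<le> deviation_cost R m K x u"
  by (simp add: deviation_cost_def)

lemma borel_measurable_deviation_cost: "case_prod (deviation_cost R m K) \<in> borel_measurable borel"
  unfolding deviation_cost_def case_prod_beta
  by (intro borel_measurable_continuous_onI continuous_intros
      bounded_linear.continuous_on[OF matrix_vector_mul_bounded_linear])

lemma borel_measurable_norm_sq_snd:
  "case_prod (\<lambda>(x :: real ^ 'd) (u :: real ^ 'm). c * (norm u)\<^sup>2) \<in> borel_measurable borel"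
  unfolding case_prod_beta by (intro borel_measurable_continuous_onI continuous_intros)

lemma norm_sq_moment_le:
  fixes M :: "(real ^ 'm) measure" and x :: "real ^ 'd"
  assumes "prob_space M" "sets M = sets borel" "0 \<le> c"
    and "(\<integral>\<^sup>+u. ennreal ((norm u)\<^sup>2) \<partial>M) \<le> ennreal (\<gamma>\<^sup>2 * (norm x)\<^sup>2)"
  shows "(\<integral>\<^sup>+u. ennreal (c * (norm u)\<^sup>2) \<partial>M) \<le> ennreal (c * \<gamma>\<^sup>2) * ennreal ((norm x)\<^sup>2)"
  using nn_integral_const_add_le[OF assms(1,2) order_refl assms(3,4)] assms(3)
  by (simp add: ennreal_mult[symmetric] mult.assoc)

text \<open>A crude bound for an arbitrary admissible control, used for integrability. It does not
  become small with \<open>m\<close>: half of \<open>8 * \<gamma>\<^sup>2\<close> comes from the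
  control and half from the gain.\<close>

lemma deviation_cost_moment_le:
  fixes M :: "(real ^ 'm) measure" and x :: "real ^ 'd"
  assumes M: "prob_space M" "sets M = sets borel" "0 \<le> m"
    and u: "(\<integral>\<^sup>+u. ennreal ((norm u)\<^sup>2) \<partial>M) \<le> ennreal (\<gamma>\<^sup>2 * (norm x)\<^sup>2)"
    and K: "norm (K *v x) \<le> \<gamma> * norm x"
  shows "(\<integral>\<^sup>+u. ennreal (deviation_cost R m K x u) \<partial>M)
    \<le> ennreal (norm R * (8 * \<gamma>\<^sup>2 + m * (1 + \<gamma>\<^sup>2))) * ennreal ((norm x)\<^sup>2)"
proof -
  let ?a = "norm R * (4 * \<gamma>\<^sup>2 + m) * (norm x)\<^sup>2" and ?b = "norm R * (4 + m)"
  have "deviation_cost R m K x u \<le> ?a + ?b * (norm u)\<^sup>2" for u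
  proof -
    have "(norm (K *v x))\<^sup>2 \<le> \<gamma>\<^sup>2 * (norm x)\<^sup>2"
      using power_mono[OF K, of 2] by (simp add: power_mult_distrib)
    then have "2 * (norm (u + K *v x))\<^sup>2 \<le> 4 * (norm u)\<^sup>2 + 4 * \<gamma>\<^sup>2 * (norm x)\<^sup>2"
      using norm_sum_sq_le[of u "K *v x"] by linarith
    then have "deviation_cost R m K x u \<le> norm R * ((4 * (norm u)\<^sup>2 + 4 * \<gamma>\<^sup>2 * (norm x)\<^sup>2) + m * ((norm x)\<^sup>2 + (norm u)\<^sup>2))"
      unfolding deviation_cost_def by (intro mult_left_mono add_right_mono) auto
    also have "\<dots> = ?a + ?b * (norm u)\<^sup>2" by (simp add: algebra_simps)
    finally show ?thesis .
  qed
  then have "(\<integral>\<^sup>+u. ennreal (deviation_cost R m K x u) \<partial>M) \<le> (\<integral>\<^sup>+u. ennreal (?a + ?b * (norm u)\<^sup>2) \<partial>M)"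
    by (intro nn_integral_mono ennreal_leI)
  also have "\<dots> \<le> ennreal (?a + ?b * (\<gamma>\<^sup>2 * (norm x)\<^sup>2))"
    using M u by (intro nn_integral_const_add_le) auto
  also have "?a + ?b * (\<gamma>\<^sup>2 * (norm x)\<^sup>2) = norm R * (8 * \<gamma>\<^sup>2 + m * (1 + \<gamma>\<^sup>2)) * (norm x)\<^sup>2"
    by (simp add: algebra_simps)
  also have "ennreal \<dots> = ennreal (norm R * (8 * \<gamma>\<^sup>2 + m * (1 + \<gamma>\<^sup>2))) * ennreal ((norm x)\<^sup>2)"
    using M by (intro ennreal_mult) auto
  finally show ?thesis .
qed

text \<open>Holding \<open>- (K *v x)\<close> removes the first square; what is left carries the
  factor \<open>m\<close>, which is proportional to the squared mesh in the application.\<close>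

lemma deviation_cost_feedback:
  fixes x :: "real ^ 'd" and K :: "real ^ 'd ^ 'm"
  assumes "0 \<le> m" and K: "norm (K *v x) \<le> \<gamma> * norm x"
  shows "(\<integral>\<^sup>+u. ennreal (deviation_cost R m K x u) \<partial>return borel (- (K *v x)))
    \<le> ennreal (norm R * (m * (1 + \<gamma>\<^sup>2))) * ennreal ((norm x)\<^sup>2)"
proof -
  have "(\<integral>\<^sup>+u. ennreal (deviation_cost R m K x u) \<partial>return borel (- (K *v x)))
      = ennreal (deviation_cost R m K x (- (K *v x)))"
    using borel_measurable_case_prod_compose[OF borel_measurable_deviation_cost, of "\<lambda>_. x" borel "\<lambda>u. u" R m K]
    by (intro nn_integral_return) auto
  also have "\<dots> \<le> ennreal (norm R * (m * (1 + \<gamma>\<^sup>2)) * (norm x)\<^sup>2)"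
  proof (rule ennreal_leI)
    have "(norm (K *v x))\<^sup>2 \<le> \<gamma>\<^sup>2 * (norm x)\<^sup>2"
      using power_mono[OF K, of 2] by (simp add: power_mult_distrib)
    then have "norm R * (m * ((norm x)\<^sup>2 + (norm (K *v x))\<^sup>2)) \<le> norm R * (m * ((norm x)\<^sup>2 + \<gamma>\<^sup>2 * (norm x)\<^sup>2))"
      using assms(1) by (intro mult_left_mono add_left_mono) auto
    then show "deviation_cost R m K x (- (K *v x)) \<le> norm R * (m * (1 + \<gamma>\<^sup>2)) * (norm x)\<^sup>2"
      by (simp add: deviation_cost_def algebra_simps)
  qed
  also have "\<dots> = ennreal (norm R * (m * (1 + \<gamma>\<^sup>2))) * ennreal ((norm x)\<^sup>2)"
    using assms by (intro ennreal_mult) auto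
  finally show ?thesis .
qed

lemma feedback_mixed_strategy:
  fixes K :: "nat \<Rightarrow> real ^ 'd ^ 'm"
  assumes "\<And>k x. k < N \<Longrightarrow> norm (K k *v x) \<le> \<gamma> * norm x"
  shows "(\<lambda>k x. return borel (- (K k *v x))) \<in> mixed_strategies \<gamma> N"
proof -
  have "(\<lambda>x. return borel (- (K k *v x))) \<in> borel \<rightarrow>\<^sub>M prob_algebra borel" for k
  proof (rule measurable_compose[OF _ measurable_return_prob_space])
    show "(\<lambda>x. - (K k *v x)) \<in> borel \<rightarrow>\<^sub>M borel"
      by (intro borel_measurable_uminus borel_measurable_matrix_mult) simp
  qed
  moreover have "(\<integral>\<^sup>+u. ennreal ((norm u)\<^sup>2) \<partial>return borel (- (K k *v x))) \<le> ennreal (\<gamma>\<^sup>2 * (norm x)\<^sup>2)"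
    if "k < N" for k x
  proof -
    have "(\<integral>\<^sup>+u. ennreal ((norm u)\<^sup>2) \<partial>return borel (- (K k *v x))) = ennreal ((norm (- (K k *v x)))\<^sup>2)"
      by (intro nn_integral_return) auto
    also have "\<dots> \<le> ennreal (\<gamma>\<^sup>2 * (norm x)\<^sup>2)"
      using power_mono[OF assms[OF that, of x], of 2] by (intro ennreal_leI) (simp add: power_mult_distrib)
    finally show ?thesis .
  qed
  ultimately show ?thesis by (auto simp: mixed_strategies_def)
qed

text \<open>The integral of a nonintegrable function is 0, so domination from one side alone says
  nothing about the integral of \<open>X\<close>. Domination from both sides makes \<open>X\<close>
  integrable, and then each bound may be integrated.\<close>

lemma integral_le_of_two_sided:
  fixes X U U' :: "'a \<Rightarrow> real"
  assumes "prob_space M" "X \<in> borel_measurable M" "integrable M U" "integrable M U'"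
    and "\<And>w. X w - c \<le> U w" "\<And>w. c - X w \<le> U' w"
  shows "(\<integral>w. X w \<partial>M) - c \<le> (\<integral>w. U w \<partial>M)" "c - (\<integral>w. X w \<partial>M) \<le> (\<integral>w. U' w \<partial>M)"
proof -
  interpret prob_space M by fact
  have X: "integrable M X"
  proof (rule Bochner_Integration.integrable_bound)
    show "integrable M (\<lambda>w. \<bar>U w\<bar> + \<bar>U' w\<bar> + \<bar>c\<bar>)"
      using assms by (intro Bochner_Integration.integrable_add integrable_abs) auto
    show "AE w in M. norm (X w) \<le> norm (\<bar>U w\<bar> + \<bar>U' w\<bar> + \<bar>c\<bar>)"
    proof (rule AE_I2)
      fix w
      show "norm (X w) \<le> norm (\<bar>U w\<bar> + \<bar>U' w\<bar> + \<bar>c\<bar>)"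
        using assms(5,6)[of w] unfolding real_norm_def by linarith
    qed
  qed fact
  have "(\<integral>w. X w - c \<partial>M) \<le> (\<integral>w. U w \<partial>M)"
    by (rule integral_mono) (use X assms in simp_all)
  moreover have "(\<integral>w. c - X w \<partial>M) \<le> (\<integral>w. U' w \<partial>M)"
    by (rule integral_mono) (use X assms in simp_all)
  ultimately show "(\<integral>w. X w \<partial>M) - c \<le> (\<integral>w. U w \<partial>M)" "c - (\<integral>w. X w \<partial>M) \<le> (\<integral>w. U' w \<partial>M)"
    using X by (simp_all add: prob_space)
qed

subsection \<open>Performance of the Riccati feedbacks\<close>

lemma time_partition_steps:
  assumes "time_partition a b N \<tau>" "mesh N \<tau> \<le> 1" "k < N"
  shows "0 \<le> \<tau> (Suc k) - \<tau> k \<and> \<tau> (Suc k) - \<tau> k \<le> 1"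
proof
  show "0 \<le> \<tau> (Suc k) - \<tau> k"
    using assms by (auto simp: time_partition_def intro: less_imp_le)
  show "\<tau> (Suc k) - \<tau> k \<le> 1"
    using step_le_mesh[OF assms(3), of \<tau>] assms(2) by linarith
qed

definition moment_bound :: "('d::finite, 'p::finite, 'q::finite) lq_game \<Rightarrow> real" where
  "moment_bound G = exp (growth_rate G (gam1 G) (gam2 G) * (t_end G - t_init G)) * (norm (x_init G))\<^sup>2"

context riccati_game
begin

lemma drift_nonneg: "0 \<le> drift1" "0 \<le> drift2"
  by (simp_all add: drift1_def drift2_def drift_const_nonneg)

lemma ends: "\<tau> 0 = t_init G" "\<tau> N = t_end G"
  using part by (auto simp: time_partition_def)

lemma node_bounds: "k < N \<Longrightarrow> t_init G \<le> \<tau> k" "k < N \<Longrightarrow> \<tau> k \<le> t_end G"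
  using time_partition_bounds[OF part] by auto

lemma gain2_neg_bound: "t_init G \<le> t \<Longrightarrow> t \<le> t_end G \<Longrightarrow> norm ((- gain2 G (P t)) *v x) \<le> gam2 G * norm x"
  using gain2_bound[of t x] by (simp add: matrix_vector_mult_uminus)

text \<open>Both estimates are proved together because the integrability of the path cost rests on
  both. In each application one of \<open>p\<close> and \<open>q\<close> is small and the other is
  the crude moment bound.\<close>

lemma mixed_cost_deviation:
  fixes \<mu> \<nu>
  assumes \<mu>: "\<mu> \<in> strategies1 G N" and \<nu>: "\<nu> \<in> strategies2 G N"
    and p: "\<And>k x. k < N \<Longrightarrow> (\<integral>\<^sup>+u. ennreal (deviation_cost (mat_R1 G) drift1 (gain1 G (P (\<tau> k))) x u) \<partial>\<mu> k x)
      \<le> ennreal p * ennreal ((norm x)\<^sup>2)" "0 \<le> p"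
    and q: "\<And>k x. k < N \<Longrightarrow> (\<integral>\<^sup>+v. ennreal (deviation_cost (mat_R2 G) drift2 (- gain2 G (P (\<tau> k))) x v) \<partial>\<nu> k x)
      \<le> ennreal q * ennreal ((norm x)\<^sup>2)" "0 \<le> q"
  defines "W \<equiv> surrogate_value P (t_init G) (x_init G)"
  shows "mixed_cost G N \<tau> \<mu> \<nu> - W \<le> (t_end G - t_init G) * ((p + norm (mat_R1 G) * drift1 * (gam2 G)\<^sup>2) * moment_bound G)"
    and "W - mixed_cost G N \<tau> \<mu> \<nu> \<le> (t_end G - t_init G) * ((norm (mat_R2 G) * drift2 * (gam1 G)\<^sup>2 + q) * moment_bound G)"
proof -
  interpret mp: mixed_play G \<tau> N \<mu> \<nu> "gam1 G" "gam2 G"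
    by standard (fact \<mu>, fact \<nu>)
  define U where "U \<omega> = (\<Sum>k<N. (\<tau> (Suc k) - \<tau> k) *
      (deviation_cost (mat_R1 G) drift1 (gain1 G (P (\<tau> k))) (sampled_state G \<tau> \<omega> k) (fst (\<omega> k))
        + norm (mat_R1 G) * drift1 * (norm (snd (\<omega> k)))\<^sup>2))" for \<omega>
  define U' where "U' \<omega> = (\<Sum>k<N. (\<tau> (Suc k) - \<tau> k) *
      (norm (mat_R2 G) * drift2 * (norm (fst (\<omega> k)))\<^sup>2
        + deviation_cost (mat_R2 G) drift2 (- gain2 G (P (\<tau> k))) (sampled_state G \<tau> \<omega> k) (snd (\<omega> k))))" for \<omega>
  have ge: "t_init G \<le> t_end G" using data by (simp add: lq_game_data_def)
  note steps = time_partition_steps[OF part mesh1]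
  have \<tau>: "\<tau> 0 \<le> \<tau> N" using ge by (simp add: ends)
  have nn: "0 \<le> norm (mat_R1 G) * drift1" "0 \<le> norm (mat_R2 G) * drift2"
    using drift_nonneg by simp_all
  have v2: "(\<integral>\<^sup>+v. ennreal (norm (mat_R1 G) * drift1 * (norm v)\<^sup>2) \<partial>\<nu> k x)
      \<le> ennreal (norm (mat_R1 G) * drift1 * (gam2 G)\<^sup>2) * ennreal ((norm x)\<^sup>2)" if "k < N" for k x
    using that nn by (intro norm_sq_moment_le mp.prob_space_strategy2 mp.sets_strategy2 mp.second_moment2)
  have u2: "(\<integral>\<^sup>+u. ennreal (norm (mat_R2 G) * drift2 * (norm u)\<^sup>2) \<partial>\<mu> k x)
      \<le> ennreal (norm (mat_R2 G) * drift2 * (gam1 G)\<^sup>2) * ennreal ((norm x)\<^sup>2)" if "k < N" for k x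
    using that nn by (intro norm_sq_moment_le mp.prob_space_strategy1 mp.sets_strategy1 mp.second_moment1)
  have nn1: "0 \<le> norm (mat_R1 G) * drift1 * c\<^sup>2" and nn2: "0 \<le> norm (mat_R2 G) * drift2 * c\<^sup>2"
    and nn3: "0 \<le> norm (mat_R1 G) * drift1 * (norm (v :: real ^ 'q))\<^sup>2"
    and nn4: "0 \<le> norm (mat_R2 G) * drift2 * (norm (u :: real ^ 'p))\<^sup>2" for c u v
    by (rule mult_nonneg_nonneg[OF nn(1) zero_le_power2] mult_nonneg_nonneg[OF nn(2) zero_le_power2])+
  note U = mp.running_sum_integrable[where f = "\<lambda>k. deviation_cost (mat_R1 G) drift1 (gain1 G (P (\<tau> k)))"
      and g = "\<lambda>k x v. norm (mat_R1 G) * drift1 * (norm v)\<^sup>2",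
      OF steps borel_measurable_deviation_cost borel_measurable_norm_sq_snd
        deviation_cost_nonneg[OF drift_nonneg(1)] nn3 p(1) v2 p(2) nn1 \<tau>,
      folded U_def, unfolded ends, folded moment_bound_def]
  note U' = mp.running_sum_integrable[where f = "\<lambda>k x u. norm (mat_R2 G) * drift2 * (norm u)\<^sup>2"
      and g = "\<lambda>k. deviation_cost (mat_R2 G) drift2 (- gain2 G (P (\<tau> k)))",
      OF steps borel_measurable_norm_sq_snd borel_measurable_deviation_cost nn4
        deviation_cost_nonneg[OF drift_nonneg(2)] u2 q(1) nn2 q(2) \<tau>,
      folded U'_def, unfolded ends, folded moment_bound_def]
  have X: "path_cost G N \<tau> \<in> borel_measurable (mp.law N)"
    using borel_measurable_path_cost[OF part] mp.sets_control_law[of N]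
    by (simp cong: measurable_cong_sets)
  have prob: "prob_space (mp.law N)" by (rule mp.prob_space_control_law) simp
  have "path_cost G N \<tau> \<omega> - W \<le> U \<omega>" "W - path_cost G N \<tau> \<omega> \<le> U' \<omega>" for \<omega>
    unfolding W_def U_def U'_def by (rule path_cost_estimate)+
  from integral_le_of_two_sided[OF prob X U(1) U'(1) this] U(2) U'(2)
  show "mixed_cost G N \<tau> \<mu> \<nu> - W \<le> (t_end G - t_init G) * ((p + norm (mat_R1 G) * drift1 * (gam2 G)\<^sup>2) * moment_bound G)"
    "W - mixed_cost G N \<tau> \<mu> \<nu> \<le> (t_end G - t_init G) * ((norm (mat_R2 G) * drift2 * (gam1 G)\<^sup>2 + q) * moment_bound G)"
    unfolding mixed_cost_def by linarith+
qed

definition "feedback1 = (\<lambda>k x. return borel (- (gain1 G (P (\<tau> k)) *v x)))"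
text \<open>Written with \<open>- gain2\<close>, so that both players hold the negative of a gain
  applied to the state and share the lemmas on feedbacks.\<close>

definition "feedback2 = (\<lambda>k x. return borel (- ((- gain2 G (P (\<tau> k))) *v x)))"

lemma feedback1_strategy: "feedback1 \<in> strategies1 G N"
  unfolding feedback1_def by (intro feedback_mixed_strategy gain1_bound node_bounds)

lemma feedback2_strategy: "feedback2 \<in> strategies2 G N"
  unfolding feedback2_def by (intro feedback_mixed_strategy gain2_neg_bound node_bounds)

text \<open>The controls of Player 2 enter only through the drift that they cause, and admissibility
  bounds their second moment; hence the estimate is uniform in \<open>\<nu>\<close>.\<close>

lemma feedback1_performance:
  assumes \<nu>: "\<nu> \<in> strategies2 G N"
  shows "mixed_cost G N \<tau> feedback1 \<nu> - surrogate_value P (t_init G) (x_init G)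
    \<le> (t_end G - t_init G) * (norm (mat_R1 G) * (drift1 * (1 + (gam1 G)\<^sup>2 + (gam2 G)\<^sup>2)) * moment_bound G)"
proof -
  have "mixed_cost G N \<tau> feedback1 \<nu> - surrogate_value P (t_init G) (x_init G)
    \<le> (t_end G - t_init G) * ((norm (mat_R1 G) * (drift1 * (1 + (gam1 G)\<^sup>2)) + norm (mat_R1 G) * drift1 * (gam2 G)\<^sup>2) * moment_bound G)"
  proof (rule mixed_cost_deviation(1)[OF feedback1_strategy \<nu>])
    show "(\<integral>\<^sup>+u. ennreal (deviation_cost (mat_R1 G) drift1 (gain1 G (P (\<tau> k))) x u) \<partial>feedback1 k x)
      \<le> ennreal (norm (mat_R1 G) * (drift1 * (1 + (gam1 G)\<^sup>2))) * ennreal ((norm x)\<^sup>2)" if "k < N" for k x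
      unfolding feedback1_def using that
      by (intro deviation_cost_feedback drift_nonneg gain1_bound node_bounds)
    \<comment> \<open>A constant for an arbitrary opponent: it secures integrability and does not
      enter the estimate from above.\<close>
    show "(\<integral>\<^sup>+v. ennreal (deviation_cost (mat_R2 G) drift2 (- gain2 G (P (\<tau> k))) x v) \<partial>\<nu> k x)
      \<le> ennreal (norm (mat_R2 G) * (8 * (gam2 G)\<^sup>2 + drift2 * (1 + (gam2 G)\<^sup>2))) * ennreal ((norm x)\<^sup>2)"
      if "k < N" for k x
      using that by (intro deviation_cost_moment_le strategy_moments[OF \<nu>] drift_nonneg gain2_neg_bound node_bounds)
  qed (use drift_nonneg in simp_all)
  then show ?thesis by (simp add: algebra_simps)
qed

lemma feedback2_performance:
  assumes \<mu>: "\<mu> \<in> strategies1 G N"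
  shows "surrogate_value P (t_init G) (x_init G) - mixed_cost G N \<tau> \<mu> feedback2
    \<le> (t_end G - t_init G) * (norm (mat_R2 G) * (drift2 * (1 + (gam1 G)\<^sup>2 + (gam2 G)\<^sup>2)) * moment_bound G)"
proof -
  have "surrogate_value P (t_init G) (x_init G) - mixed_cost G N \<tau> \<mu> feedback2
    \<le> (t_end G - t_init G) * ((norm (mat_R2 G) * drift2 * (gam1 G)\<^sup>2 + norm (mat_R2 G) * (drift2 * (1 + (gam2 G)\<^sup>2))) * moment_bound G)"
  proof (rule mixed_cost_deviation(2)[OF \<mu> feedback2_strategy])
    show "(\<integral>\<^sup>+v. ennreal (deviation_cost (mat_R2 G) drift2 (- gain2 G (P (\<tau> k))) x v) \<partial>feedback2 k x)
      \<le> ennreal (norm (mat_R2 G) * (drift2 * (1 + (gam2 G)\<^sup>2))) * ennreal ((norm x)\<^sup>2)" if "k < N" for k x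
      unfolding feedback2_def using that
      by (intro deviation_cost_feedback drift_nonneg gain2_neg_bound node_bounds)
    show "(\<integral>\<^sup>+u. ennreal (deviation_cost (mat_R1 G) drift1 (gain1 G (P (\<tau> k))) x u) \<partial>\<mu> k x)
      \<le> ennreal (norm (mat_R1 G) * (8 * (gam1 G)\<^sup>2 + drift1 * (1 + (gam1 G)\<^sup>2))) * ennreal ((norm x)\<^sup>2)"
      if "k < N" for k x
      using that by (intro deviation_cost_moment_le strategy_moments[OF \<mu>] drift_nonneg gain1_bound node_bounds)
  qed (use drift_nonneg in simp_all)
  then show ?thesis by (simp add: algebra_simps)
qed

end

section \<open>Comparison with the saddle point value\<close>

lemma saddle_point_game_value:
  assumes "saddle_point G N \<tau> \<alpha> \<beta>"
  shows "is_game_value G N \<tau> (mixed_cost G N \<tau> \<alpha> \<beta>)"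
proof -
  let ?J = "\<lambda>\<mu> \<nu>. ereal (mixed_cost G N \<tau> \<mu> \<nu>)"
  have mem: "\<alpha> \<in> strategies1 G N" "\<beta> \<in> strategies2 G N"
    and le: "\<And>\<nu>. \<nu> \<in> strategies2 G N \<Longrightarrow> ?J \<alpha> \<nu> \<le> ?J \<alpha> \<beta>"
    and ge: "\<And>\<mu>. \<mu> \<in> strategies1 G N \<Longrightarrow> ?J \<alpha> \<beta> \<le> ?J \<mu> \<beta>"
    using assms by (auto simp: saddle_point_def)
  have "?J \<alpha> \<beta> = (INF \<mu>\<in>strategies1 G N. SUP \<nu>\<in>strategies2 G N. ?J \<mu> \<nu>)"
  proof (rule antisym)
    show "?J \<alpha> \<beta> \<le> (INF \<mu>\<in>strategies1 G N. SUP \<nu>\<in>strategies2 G N. ?J \<mu> \<nu>)"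
      by (intro INF_greatest SUP_upper2[OF mem(2)] ge)
    show "(INF \<mu>\<in>strategies1 G N. SUP \<nu>\<in>strategies2 G N. ?J \<mu> \<nu>) \<le> ?J \<alpha> \<beta>"
      by (intro INF_lower2[OF mem(1)] SUP_least le)
  qed
  moreover have "?J \<alpha> \<beta> = (SUP \<nu>\<in>strategies2 G N. INF \<mu>\<in>strategies1 G N. ?J \<mu> \<nu>)"
  proof (rule antisym)
    show "?J \<alpha> \<beta> \<le> (SUP \<nu>\<in>strategies2 G N. INF \<mu>\<in>strategies1 G N. ?J \<mu> \<nu>)"
      by (intro SUP_upper2[OF mem(2)] INF_greatest ge)
    show "(SUP \<nu>\<in>strategies2 G N. INF \<mu>\<in>strategies1 G N. ?J \<mu> \<nu>) \<le> ?J \<alpha> \<beta>"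
      by (intro SUP_least INF_lower2[OF mem(1)] le)
  qed
  ultimately show ?thesis by (simp add: is_game_value_def)
qed

lemma square_le_sqrt:
  fixes x :: real
  assumes "0 \<le> x" "x \<le> 1"
  shows "x\<^sup>2 \<le> sqrt x"
proof (rule real_le_rsqrt)
  have "(x\<^sup>2)\<^sup>2 = x ^ 4" by simp
  also have "\<dots> \<le> x ^ 1" using assms by (intro power_decreasing) auto
  finally show "(x\<^sup>2)\<^sup>2 \<le> x" by simp
qed

text \<open>\<open>C\<close> and \<open>\<delta>\<close> are chosen before the partition, which
  expresses the uniformity of the error term. Since \<open>is_game_value\<close> determines
  \<open>V\<close>, the estimate is one for the game value itself.\<close>

theorem theorem4:
  fixes G :: "('d::finite, 'p::finite, 'q::finite) lq_game" and L :: real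
  assumes "lq_game_data G"
  shows "\<exists>C \<delta>. 0 < \<delta> \<and>
    (\<forall>N \<tau> P \<alpha> \<beta>.
       time_partition (t_init G) (t_end G) N \<tau> \<and> mesh N \<tau> < \<delta> \<and>
       saddle_point G N \<tau> \<alpha> \<beta> \<and>
       lipschitz_moments L N \<alpha> \<and> lipschitz_moments L N \<beta> \<and>
       riccati_solution G N \<tau> P \<and>
       capacity_conditions G N \<tau> P \<longrightarrow>
       (\<exists>V. is_game_value G N \<tau> V \<and>
            \<bar>V - surrogate_value P (t_init G) (x_init G)\<bar> \<le> C * sqrt (mesh N \<tau>)))"
proof -
  have "pos_def (mat_R2 G)" using assms by (simp add: lq_game_data_def)
  then obtain r where r: "r > 0" "\<And>v. r * (norm v)\<^sup>2 \<le> v \<bullet> (mat_R2 G *v v)"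
    using pos_def_coercive[of "mat_R2 G"] by blast
  have ge: "t_init G \<le> t_end G" using assms by (simp add: lq_game_data_def)
  define b where "b = (norm (mat_B2 G))\<^sup>2 * riccati_bound G"
  have b: "0 \<le> b" using ge by (simp add: b_def riccati_bound_def)
  \<comment> \<open>Mesh at most 1 serves the one-step estimates; the quotient gives
    \<open>mesh N \<tau> * b \<le> r\<close>, which makes the multiplier vanish. The added 1 avoids
    a division by 0.\<close>
  define \<delta> where "\<delta> = min 1 (r / (b + 1))"
  let ?C1 = "(t_end G - t_init G) * (norm (mat_R1 G) *
      (drift_const G (gam1 G) (norm (matrix_inv (mat_R1 G) ** transpose (mat_B1 G))) * (1 + (gam1 G)\<^sup>2 + (gam2 G)\<^sup>2)) * moment_bound G)"
  let ?C2 = "(t_end G - t_init G) * (norm (mat_R2 G) *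
      (drift_const G (gam2 G) (norm (matrix_inv (mat_R2 G) ** transpose (mat_B2 G))) * (1 + (gam1 G)\<^sup>2 + (gam2 G)\<^sup>2)) * moment_bound G)"
  have C_nn: "0 \<le> ?C1" "0 \<le> ?C2"
    using ge by (auto simp: moment_bound_def drift_const_nonneg intro!: mult_nonneg_nonneg add_nonneg_nonneg)
  show ?thesis
  proof (rule exI[of _ "?C1 + ?C2"], rule exI[of _ \<delta>], intro conjI allI impI)
    show "0 < \<delta>" using r b by (simp add: \<delta>_def)
    fix N \<tau> P \<alpha> \<beta>
    assume "time_partition (t_init G) (t_end G) N \<tau> \<and> mesh N \<tau> < \<delta> \<and>
       saddle_point G N \<tau> \<alpha> \<beta> \<and>
       lipschitz_moments L N \<alpha> \<and> lipschitz_moments L N \<beta> \<and>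
       riccati_solution G N \<tau> P \<and>
       capacity_conditions G N \<tau> P"
    then have part: "time_partition (t_init G) (t_end G) N \<tau>" and mesh: "mesh N \<tau> < \<delta>"
      and saddle: "saddle_point G N \<tau> \<alpha> \<beta>" and sol: "riccati_solution G N \<tau> P"
      and cap: "capacity_conditions G N \<tau> P"
      by auto
    let ?m = "mesh N \<tau>" and ?V = "mixed_cost G N \<tau> \<alpha> \<beta>" and ?W = "surrogate_value P (t_init G) (x_init G)"
    have m: "0 < ?m" "?m \<le> 1" using mesh mesh_pos[OF part] by (auto simp: \<delta>_def)
    have "?m * (b + 1) \<le> r"
      using mesh b by (simp add: \<delta>_def field_simps)
    then have small: "?m * ((norm (mat_B2 G))\<^sup>2 * riccati_bound G) \<le> r"
      using m by (simp add: b_def distrib_left)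
    interpret riccati_game G N \<tau> P
      using lambda2_eq_0[OF assms part m(2) cap sol _ _ r(2) _ small] r(1)
      by unfold_locales (use assms part m(2) cap sol in auto)
    have strat: "\<alpha> \<in> strategies1 G N" "\<beta> \<in> strategies2 G N"
      using saddle by (auto simp: saddle_point_def)
    \<comment> \<open>Player 1 cannot gain by leaving \<open>\<alpha>\<close> for the feedback, so
      the performance of the feedback against \<open>\<beta>\<close> bounds the value from
      above.\<close>
    have "?V \<le> mixed_cost G N \<tau> feedback1 \<beta>"
      using saddle feedback1_strategy by (auto simp: saddle_point_def)
    then have "?V - ?W \<le> ?C1 * ?m\<^sup>2"
      using feedback1_performance[OF strat(2)] by (simp add: drift1_def mult_ac)
    \<comment> \<open>Dually, Player 2 cannot gain by leaving \<open>\<beta>\<close>, which bounds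
      the value from below.\<close>
    moreover have "mixed_cost G N \<tau> \<alpha> feedback2 \<le> ?V"
      using saddle feedback2_strategy by (auto simp: saddle_point_def)
    then have "?W - ?V \<le> ?C2 * ?m\<^sup>2"
      using feedback2_performance[OF strat(1)] by (simp add: drift2_def mult_ac)
    moreover have "0 \<le> ?C1 * ?m\<^sup>2" "0 \<le> ?C2 * ?m\<^sup>2"
      by (rule mult_nonneg_nonneg[OF C_nn(1) zero_le_power2] mult_nonneg_nonneg[OF C_nn(2) zero_le_power2])+
    ultimately have "\<bar>?V - ?W\<bar> \<le> (?C1 + ?C2) * ?m\<^sup>2"
      unfolding distrib_right by linarith
    also have "\<dots> \<le> (?C1 + ?C2) * sqrt ?m"
      using m C_nn by (intro mult_left_mono square_le_sqrt add_nonneg_nonneg) auto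
    finally have "\<bar>?V - ?W\<bar> \<le> (?C1 + ?C2) * sqrt ?m" .
    then show "\<exists>V. is_game_value G N \<tau> V \<and> \<bar>V - ?W\<bar> \<le> (?C1 + ?C2) * sqrt ?m"
      using saddle_point_game_value[OF saddle] by blast
  qed
qed

end
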